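(* Let $\Lambda$ be a real $q$-constrained Willmore surface, let $\alpha,L^\alpha$ be (real) Bäcklund transformation parameters to $\Lambda$ corresponding to the multiplier $q$, and suppose that the Bäcklund transform $\Lambda^*$ of $\Lambda$ of parameters $\alpha,L^\alpha$ immerses. Then the quadratic differentials associated to the multiplier $q$ of $\Lambda$ and to the multiplier $q^*$ of $\Lambda^*$ coincide: $$q^*_Q=q_Q.$$
   Context: $n\ge 3$; $\mathbb{R}^{n+1,1}$ has metric $(\,,\,)$ of signature $(n+1,1)$, extended complex bilinearly to $\mathbb{C}^{n+2}$; $\mathcal{L}$ is the set of non-zero null vectors of $\mathbb{R}^{n+1,1}$; $M$ is an oriented surface; $\underline{\mathbb{C}}^{n+2}=M\times\mathbb{C}^{n+2}$ with trivial flat connection $d$. The theory is local: restriction to a suitable non-empty open subset of $M$ is always understood. $\wedge^{2}\mathbb{C}^{n+2}\cong o(\mathbb{C}^{n+2})$ by $(v_1\wedge v_2)(w)=(w,v_1)v_2-(w,v_2)v_1$; $[\mu\wedge\eta](X,Y)=[\mu_X,\eta_Y]-[\mu_Y,\eta_X]$ for Lie-algebra-valued $1$-forms; $d^\nabla$ is the exterior derivative on endomorphism-valued forms. Surfaces. A real surface is a null line subbundle $\Lambda\subset M\times\mathbb{R}^{n+1,1}$ defining an immersion $M\to\mathbb{P}(\mathcal{L})\cong S^n$ (standing assumption: not contained in any proper subsphere of $S^n$). $M$ carries the conformal structure of the metrics $g_\sigma(X,Y)=(d_X\sigma,d_Y\sigma)$, $\sigma\in\Gamma(\Lambda)$ never-zero,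 and $(1,0)$/$(0,1)$-parts and $*$ (with $*\omega=-\omega\circ J$) refer to it. For $z$ a holomorphic chart, $\Lambda^{1,0}=\langle\sigma,\sigma_z\rangle$, $\Lambda^{0,1}=\langle\sigma,\sigma_{\bar z}\rangle$, $\Lambda^{(1)}=\Lambda^{1,0}+\Lambda^{0,1}$, and the (complexified) central sphere congruence is $S=\langle\sigma,\sigma_z,\sigma_{\bar z},\sigma_{z\bar z}\rangle$. Set $\mathcal{D}:=\pi_S\circ d\circ\pi_S+\pi_{S^\perp}\circ d\circ\pi_{S^\perp}$, $\mathcal{N}:=d-\mathcal{D}$. For a real $q\in\Omega^1(\Lambda\wedge\Lambda^{(1)})$, $\Lambda$ is a real $q$-constrained Willmore surface ($q$ is a multiplier) if $d^{\mathcal{D}}q=0$ and $d^{\mathcal{D}}*\mathcal{N}=2[q\wedge*\mathcal{N}]$. Set $d^{\lambda,q}_S:=\mathcal{D}+\lambda^{-1}\mathcal{N}^{1,0}+\lambda\mathcal{N}^{0,1}+(\lambda^{-2}-1)q^{1,0}+(\lambda^2-1)q^{0,1}$. Quadratic differential. For $q\in\Omega^1(\Lambda\wedge\Lambda^{(1)})$, $q_Q$ is given in a holomorphic chart $z$ by $q_Q=q^z\,dz^2+\overline{q^z}\,d\bar z^2$, where $q^z$ is the complex function defined by $q^z\sigma=-2\,q_{\delta_z}\sigma_z$, independently of the never-zero $\sigma\in\Gamma(\Lambda)$ ($\delta_z=\partial/\partial z$). $q^*_Q$ is defined likewise from $q^*$ and $\Lambda^*$; $\Lambda$ and $\Lambda^*$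 induce the same conformal structure. Bäcklund transformation. Let $\rho=\pi_S-\pi_{S^\perp}$. For $a\in\mathbb{C}\backslash\{-1,0,1\}$ and a null line subbundle $L\subset\underline{\mathbb{C}}^{n+2}$ with $\rho L\cap L^\perp=\{0\}$, let $\pi_L,\pi_{\rho L},\pi_\perp$ be the projections for $\underline{\mathbb{C}}^{n+2}=L\oplus\rho L\oplus(L\oplus\rho L)^\perp$ and $$p_{a,L}(\lambda)=\tfrac{a-\lambda}{a+\lambda}\pi_L+\pi_\perp+\tfrac{a+\lambda}{a-\lambda}\pi_{\rho L},\qquad q_{a,L}(\lambda)=\tfrac{\lambda-a}{\lambda+a}\pi_L+\pi_\perp+\tfrac{\lambda+a}{\lambda-a}\pi_{\rho L},$$ extended by $p_{a,L}(\infty)=-\pi_L+\pi_\perp-\pi_{\rho L}$, $q_{a,L}(\infty)=I$. Real Bäcklund transformation parameters to $\Lambda$ (for the multiplier $q$) are $\alpha\in\mathbb{C}\backslash(S^1\cup\{0\})$ and a $d^{\alpha,q}_S$-parallel null line subbundle $L^\alpha$ with, locally, $\rho L^\alpha\cap(L^\alpha)^\perp=\{0\}$ and $\rho\tilde L^\alpha\cap(\tilde L^\alpha)^\perp=\{0\}$, where $\tilde L^\alpha:=q_{\overline\alpha^{-1},\overline{L^\alpha}}(\alpha)L^\alpha$. Set $r^*:=p_{\alpha,\tilde L^\alpha}\,q_{\overline\alpha^{-1},\overline{L^\alpha}}$ and $$(\Lambda^* )^{1,0}:=r^*(1)^{-1}r^*(\infty)\Lambda^{1,0},\quad(\Lambda^*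 )^{0,1}:=r^*(1)^{-1}r^*(0)\Lambda^{0,1},\quad\Lambda^*:=(\Lambda^* )^{1,0}\cap(\Lambda^* )^{0,1},$$ $$q^*:=\mathrm{Ad}_{r^*(1)^{-1}}\big(\mathrm{Ad}_{r^*(0)}q^{1,0}+\mathrm{Ad}_{r^*(\infty)}q^{0,1}\big).$$ $\Lambda^*$ is the Bäcklund transform; it immerses if it defines an immersion of $M$ into $\mathbb{P}(\mathcal{L})$. *)

theory Defs
  imports "HOL-Analysis.Analysis"
begin

section \<open>The space \<open>\<real>\<^sup>n\<^sup>+\<^sup>1\<^sup>,\<^sup>1\<close> and its complexification\<close>

text \<open>
  The type variable \<open>'n\<close> has \<open>n\<close> elements, so \<open>'n cvec\<close> is \<open>\<complex>\<close>-space of dimension \<open>n + 2\<close>; the index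
  \<open>None\<close> is the timelike one. Real vectors, and real endomorphisms, are those with real entries.
\<close>

type_synonym 'n cvec = "complex ^ 'n option option"
type_synonym 'n cmat = "complex ^ 'n option option ^ 'n option option"

definition mform :: "'n::finite cvec \<Rightarrow> 'n cvec \<Rightarrow> complex" where
  "mform v w = (\<Sum>i\<in>UNIV. (if i = None then - 1 else 1) * v $ i * w $ i)"

definition vcnj :: "'n::finite cvec \<Rightarrow> 'n cvec" where
  "vcnj v = (\<chi> i. cnj (v $ i))"

definition real_vec :: "'n::finite cvec \<Rightarrow> bool" where
  "real_vec v \<longleftrightarrow> vcnj v = v"

definition real_mat :: "'n::finite cmat \<Rightarrow> bool" where
  "real_mat B \<longleftrightarrow> (\<forall>i j. B $ i $ j \<in> \<real>)"

definition mscale :: "complex \<Rightarrow> 'n::finite cmat \<Rightarrow> 'n cmat" where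
  "mscale k B = (\<chi> i. k *s B $ i)"

definition orth :: "'n::finite cvec set \<Rightarrow> 'n cvec set" where
  "orth W = {v. \<forall>w\<in>W. mform v w = 0}"

text \<open>Projection onto \<open>W\<close> along a complementary subspace \<open>W'\<close>.\<close>

definition proj_along :: "'n::finite cvec set \<Rightarrow> 'n cvec set \<Rightarrow> 'n cmat" where
  "proj_along W W' = (THE P. (\<forall>v\<in>W. P *v v = v) \<and> (\<forall>v\<in>W'. P *v v = 0))"

definition wedge :: "'n::finite cvec \<Rightarrow> 'n cvec \<Rightarrow> 'n cmat" where
  "wedge v1 v2 = matrix (\<lambda>w. mform w v1 *s v2 - mform w v2 *s v1)"

text \<open>For complex subspaces \<open>V\<close>, \<open>W\<close> the real span below is already a complex subspace.\<close>

definition wedge_space :: "'n::finite cvec set \<Rightarrow> 'n cvec set \<Rightarrow> 'n cmat set" where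
  "wedge_space V W = span {wedge v w | v w. v \<in> V \<and> w \<in> W}"

definition commutator :: "'n::finite cmat \<Rightarrow> 'n cmat \<Rightarrow> 'n cmat" where
  "commutator B C = B ** C - C ** B"

definition Ad :: "'n::finite cmat \<Rightarrow> 'n cmat \<Rightarrow> 'n cmat" where
  "Ad r B = r ** B ** matrix_inv r"


section \<open>Oriented surfaces\<close>

text \<open>Continuous differentiability of order \<open>k\<close> on an open subset of \<open>\<complex> = \<real>\<^sup>2\<close>, in the real sense.\<close>

primrec Ck_on :: "nat \<Rightarrow> (complex \<Rightarrow> 'v::real_normed_vector) \<Rightarrow> complex set \<Rightarrow> bool" where
  "Ck_on 0 f U \<longleftrightarrow> continuous_on U f"
| "Ck_on (Suc k) f U \<longleftrightarrow> f differentiable_on U \<and>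
     (\<forall>X. Ck_on k (\<lambda>x. frechet_derivative f (at x) X) U)"

definition smooth_on :: "(complex \<Rightarrow> 'v::real_normed_vector) \<Rightarrow> complex set \<Rightarrow> bool" where
  "smooth_on f U \<longleftrightarrow> (\<forall>k. Ck_on k f U)"

text \<open>
  The surface \<open>M\<close> is the type \<open>'m\<close>. A chart \<open>(U, z)\<close> has domain \<open>U\<close>; the values of \<open>z\<close> outside \<open>U\<close> are
  irrelevant. A tangent vector at \<open>p \<in> U\<close> is described by its component \<open>X \<in> \<complex> = \<real>\<^sup>2\<close> in the chart, and
  \<open>pd c X f p\<close> is the derivative \<open>d\<^sub>X f\<close> at \<open>p\<close>.
\<close>

type_synonym 'm chart = "'m set \<times> ('m \<Rightarrow> complex)"

abbreviation cdom :: "'m chart \<Rightarrow> 'm set" where "cdom c \<equiv> fst c"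

definition in_chart :: "'m chart \<Rightarrow> ('m \<Rightarrow> 'v) \<Rightarrow> complex \<Rightarrow> 'v" where
  "in_chart c f = (\<lambda>x. f (inv_into (fst c) (snd c) x))"

definition pd :: "'m chart \<Rightarrow> complex \<Rightarrow> ('m \<Rightarrow> 'v::real_normed_vector) \<Rightarrow> 'm \<Rightarrow> 'v" where
  "pd c X f p = frechet_derivative (in_chart c f) (at (snd c p)) X"

definition is_chart :: "'m::topological_space chart \<Rightarrow> bool" where
  "is_chart c \<longleftrightarrow> open (cdom c) \<and> open (snd c ` cdom c) \<and> inj_on (snd c) (cdom c) \<and>
     continuous_on (cdom c) (snd c) \<and>
     continuous_on (snd c ` cdom c) (inv_into (cdom c) (snd c))"

text \<open>\<open>Im (cnj a * b)\<close> is the determinant of the real \<open>2 \<times> 2\<close> matrix with columns \<open>a\<close>, \<open>b\<close>.\<close>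

definition compatible :: "'m chart \<Rightarrow> 'm chart \<Rightarrow> bool" where
  "compatible c c' \<longleftrightarrow>
     smooth_on (in_chart c (snd c')) (snd c ` (cdom c \<inter> cdom c')) \<and>
     (\<forall>p \<in> cdom c \<inter> cdom c'. 0 < Im (cnj (pd c 1 (snd c') p) * pd c \<i> (snd c') p))"

text \<open>\<open>A\<close> is the maximal oriented atlas of the surface.\<close>

definition oriented_surface :: "'m::{t2_space, second_countable_topology} chart set \<Rightarrow> bool" where
  "oriented_surface A \<longleftrightarrow>
     (\<Union>c\<in>A. cdom c) = UNIV \<and>
     (\<forall>c\<in>A. is_chart c) \<and>
     (\<forall>c\<in>A. \<forall>c'\<in>A. compatible c c') \<and>
     (\<forall>c. is_chart c \<and> (\<forall>c'\<in>A. compatible c c' \<and> compatible c' c) \<longrightarrow> c \<in> A)"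

definition smooth_map :: "'m chart set \<Rightarrow> 'm set \<Rightarrow> ('m \<Rightarrow> 'v::real_normed_vector) \<Rightarrow> bool" where
  "smooth_map A U f \<longleftrightarrow> (\<forall>c\<in>A. smooth_on (in_chart c f) (snd c ` (U \<inter> cdom c)))"

definition pdz :: "'m chart \<Rightarrow> ('m \<Rightarrow> 'n::finite cvec) \<Rightarrow> 'm \<Rightarrow> 'n cvec" where
  "pdz c f p = (1/2) *s (pd c 1 f p - \<i> *s pd c \<i> f p)"

definition pdzbar :: "'m chart \<Rightarrow> ('m \<Rightarrow> 'n::finite cvec) \<Rightarrow> 'm \<Rightarrow> 'n cvec" where
  "pdzbar c f p = (1/2) *s (pd c 1 f p + \<i> *s pd c \<i> f p)"


section \<open>Endomorphism-valued 1-forms\<close>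

text \<open>\<open>\<omega> c p X\<close> is the value of \<open>\<omega>\<close> on the tangent vector at \<open>p\<close> with component \<open>X\<close> in the chart \<open>c\<close>.\<close>

type_synonym ('m, 'n) form1 = "'m chart \<Rightarrow> 'm \<Rightarrow> complex \<Rightarrow> 'n cmat"

definition one_form :: "'m chart set \<Rightarrow> ('m, 'n::finite) form1 \<Rightarrow> bool" where
  "one_form A \<omega> \<longleftrightarrow>
     (\<forall>c\<in>A. \<forall>p\<in>cdom c. linear (\<omega> c p)) \<and>
     (\<forall>c\<in>A. \<forall>c'\<in>A. \<forall>p\<in>cdom c \<inter> cdom c'. \<forall>X. \<omega> c p X = \<omega> c' p (pd c X (snd c') p)) \<and>
     (\<forall>c\<in>A. \<forall>X. smooth_on (in_chart c (\<lambda>p. \<omega> c p X)) (snd c ` cdom c))"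

text \<open>
  The operations below refer to the complex structure \<open>J\<close>, which in a holomorphic chart is
  multiplication by \<open>\<i>\<close> on components; they are meaningful in such charts only.
\<close>

definition star :: "('m, 'n::finite) form1 \<Rightarrow> ('m, 'n) form1" where
  "star \<omega> = (\<lambda>c p X. - \<omega> c p (\<i> * X))"

definition part10 :: "('m, 'n::finite) form1 \<Rightarrow> ('m, 'n) form1" where
  "part10 \<omega> = (\<lambda>c p X. mscale (1/2) (\<omega> c p X - mscale \<i> (\<omega> c p (\<i> * X))))"

definition part01 :: "('m, 'n::finite) form1 \<Rightarrow> ('m, 'n) form1" where
  "part01 \<omega> = (\<lambda>c p X. mscale (1/2) (\<omega> c p X + mscale \<i> (\<omega> c p (\<i> * X))))"

text \<open>The value of the complexified form on \<open>\<delta>\<^sub>z = (\<partial>\<^sub>x - \<i> \<partial>\<^sub>y) / 2\<close>.\<close>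

definition at_dz :: "('m, 'n::finite) form1 \<Rightarrow> 'm chart \<Rightarrow> 'm \<Rightarrow> 'n cmat" where
  "at_dz \<omega> c p = mscale (1/2) (\<omega> c p 1 - mscale \<i> (\<omega> c p \<i>))"

definition bracket_wedge ::
  "('m, 'n::finite) form1 \<Rightarrow> ('m, 'n) form1 \<Rightarrow> 'm chart \<Rightarrow> 'm \<Rightarrow> complex \<Rightarrow> complex \<Rightarrow> 'n cmat" where
  "bracket_wedge \<mu> \<eta> c p X Y =
     commutator (\<mu> c p X) (\<eta> c p Y) - commutator (\<mu> c p Y) (\<eta> c p X)"


section \<open>Surfaces in the conformal sphere\<close>

text \<open>
  A subbundle of the trivial bundle with fibre \<open>\<complex>\<close>-space of dimension \<open>n + 2\<close> is given by its fibres. A real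
  line bundle is represented by its complexification, that is, its fibres are complex lines with
  local frames of real vectors.
\<close>

definition null_line_bundle :: "'m::topological_space chart set \<Rightarrow> ('m \<Rightarrow> 'n::finite cvec set) \<Rightarrow> bool" where
  "null_line_bundle A L \<longleftrightarrow>
     (\<forall>p. \<exists>U \<sigma>. open U \<and> p \<in> U \<and> smooth_map A U \<sigma> \<and>
        (\<forall>x\<in>U. \<sigma> x \<noteq> 0 \<and> mform (\<sigma> x) (\<sigma> x) = 0 \<and> L x = vec.span {\<sigma> x}))"

definition real_null_line_bundle ::
  "'m::topological_space chart set \<Rightarrow> ('m \<Rightarrow> 'n::finite cvec set) \<Rightarrow> bool" where
  "real_null_line_bundle A L \<longleftrightarrow>
     (\<forall>p. \<exists>U \<sigma>. open U \<and> p \<in> U \<and> smooth_map A U \<sigma> \<and>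
        (\<forall>x\<in>U. real_vec (\<sigma> x) \<and> \<sigma> x \<noteq> 0 \<and> mform (\<sigma> x) (\<sigma> x) = 0 \<and> L x = vec.span {\<sigma> x}))"

text \<open>Never-zero sections near \<open>p\<close>, complex and real respectively.\<close>

definition local_section ::
  "'m::topological_space chart set \<Rightarrow> ('m \<Rightarrow> 'n::finite cvec set) \<Rightarrow> 'm \<Rightarrow> ('m \<Rightarrow> 'n cvec) \<Rightarrow> bool" where
  "local_section A L p \<sigma> \<longleftrightarrow>
     (\<exists>U. open U \<and> p \<in> U \<and> smooth_map A U \<sigma> \<and> (\<forall>x\<in>U. \<sigma> x \<in> L x \<and> \<sigma> x \<noteq> 0))"

definition local_real_section ::
  "'m::topological_space chart set \<Rightarrow> ('m \<Rightarrow> 'n::finite cvec set) \<Rightarrow> 'm \<Rightarrow> ('m \<Rightarrow> 'n cvec) \<Rightarrow> bool" where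
  "local_real_section A L p \<sigma> \<longleftrightarrow>
     (\<exists>U. open U \<and> p \<in> U \<and> smooth_map A U \<sigma> \<and> (\<forall>x\<in>U. \<sigma> x \<in> L x \<and> \<sigma> x \<noteq> 0 \<and> real_vec (\<sigma> x)))"

text \<open>
  \<open>T\<^bsub>[\<sigma>]\<^esub> P(\<L>) = Hom(\<Lambda>, \<Lambda>\<^sup>\<bottom>/\<Lambda>)\<close>, and the differential of \<open>\<Lambda>\<close> sends \<open>X\<close> to \<open>\<sigma> \<mapsto> d\<^sub>X\<sigma> mod \<Lambda>\<close>; so \<open>\<Lambda>\<close> is an
  immersion iff \<open>d\<^sub>X\<sigma> \<in> \<Lambda>\<close> only for \<open>X = 0\<close>.
\<close>

definition immerses :: "'m::topological_space chart set \<Rightarrow> ('m \<Rightarrow> 'n::finite cvec set) \<Rightarrow> bool" where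
  "immerses A \<Lambda> \<longleftrightarrow> real_null_line_bundle A \<Lambda> \<and>
     (\<forall>c\<in>A. \<forall>p\<in>cdom c. \<forall>\<sigma> X. local_real_section A \<Lambda> p \<sigma> \<and> pd c X \<sigma> p \<in> \<Lambda> p \<longrightarrow> X = 0)"

text \<open>
  Every proper subsphere of \<open>P(\<L>)\<close> lies in a hypersphere, and the hyperspheres are the sets of null
  lines orthogonal to a spacelike vector.
\<close>

definition real_surface :: "'m::topological_space chart set \<Rightarrow> ('m \<Rightarrow> 'n::finite cvec set) \<Rightarrow> bool" where
  "real_surface A \<Lambda> \<longleftrightarrow> immerses A \<Lambda> \<and>
     \<not> (\<exists>v. real_vec v \<and> 0 < Re (mform v v) \<and> (\<forall>p. \<Lambda> p \<subseteq> orth {v}))"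

definition induced_metric ::
  "'m chart \<Rightarrow> ('m \<Rightarrow> 'n::finite cvec) \<Rightarrow> 'm \<Rightarrow> complex \<Rightarrow> complex \<Rightarrow> complex" where
  "induced_metric c \<sigma> p X Y = mform (pd c X \<sigma> p) (pd c Y \<sigma> p)"

text \<open>
  An oriented chart is holomorphic for the conformal structure of the metrics \<open>g\<^sub>\<sigma>\<close> iff rotation by a
  right angle in the chart is orthogonal for them.
\<close>

definition holomorphic_chart ::
  "'m::topological_space chart set \<Rightarrow> ('m \<Rightarrow> 'n::finite cvec set) \<Rightarrow> 'm chart \<Rightarrow> bool" where
  "holomorphic_chart A \<Lambda> c \<longleftrightarrow> c \<in> A \<and>
     (\<forall>p\<in>cdom c. \<forall>\<sigma>. local_real_section A \<Lambda> p \<sigma> \<longrightarrow>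
        (\<forall>X. induced_metric c \<sigma> p (\<i> * X) (\<i> * X) = induced_metric c \<sigma> p X X))"

text \<open>
  The next three subspaces do not depend on the holomorphic chart and on the section \<open>\<sigma>\<close>; the span is
  taken over all choices in order not to single one out.
\<close>

definition Lam10 :: "'m::topological_space chart set \<Rightarrow> ('m \<Rightarrow> 'n::finite cvec set) \<Rightarrow> 'm \<Rightarrow> 'n cvec set" where
  "Lam10 A \<Lambda> p = vec.span (\<Union>{{\<sigma> p, pdz c \<sigma> p} | c \<sigma>.
     holomorphic_chart A \<Lambda> c \<and> p \<in> cdom c \<and> local_real_section A \<Lambda> p \<sigma>})"

definition Lam01 :: "'m::topological_space chart set \<Rightarrow> ('m \<Rightarrow> 'n::finite cvec set) \<Rightarrow> 'm \<Rightarrow> 'n cvec set" where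
  "Lam01 A \<Lambda> p = vec.span (\<Union>{{\<sigma> p, pdzbar c \<sigma> p} | c \<sigma>.
     holomorphic_chart A \<Lambda> c \<and> p \<in> cdom c \<and> local_real_section A \<Lambda> p \<sigma>})"

definition central_sphere ::
  "'m::topological_space chart set \<Rightarrow> ('m \<Rightarrow> 'n::finite cvec set) \<Rightarrow> 'm \<Rightarrow> 'n cvec set" where
  "central_sphere A \<Lambda> p = vec.span (\<Union>{{\<sigma> p, pdz c \<sigma> p, pdzbar c \<sigma> p, pdz c (pdzbar c \<sigma>) p} | c \<sigma>.
     holomorphic_chart A \<Lambda> c \<and> p \<in> cdom c \<and> local_real_section A \<Lambda> p \<sigma>})"

definition Lam1 :: "'m::topological_space chart set \<Rightarrow> ('m \<Rightarrow> 'n::finite cvec set) \<Rightarrow> 'm \<Rightarrow> 'n cvec set" where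
  "Lam1 A \<Lambda> p = vec.span (Lam10 A \<Lambda> p \<union> Lam01 A \<Lambda> p)"


section \<open>Constrained Willmore surfaces\<close>

text \<open>In this section \<open>S\<close> is a nondegenerate subbundle.\<close>

definition piS :: "'n::finite cvec set \<Rightarrow> 'n cmat" where
  "piS S = proj_along S (orth S)"

definition piSperp :: "'n::finite cvec set \<Rightarrow> 'n cmat" where
  "piSperp S = proj_along (orth S) S"

definition Dconn ::
  "('m \<Rightarrow> 'n::finite cvec set) \<Rightarrow> 'm chart \<Rightarrow> complex \<Rightarrow> ('m \<Rightarrow> 'n cvec) \<Rightarrow> 'm \<Rightarrow> 'n cvec" where
  "Dconn S c X f p =
     piS (S p) *v pd c X (\<lambda>x. piS (S x) *v f x) p +
     piSperp (S p) *v pd c X (\<lambda>x. piSperp (S x) *v f x) p"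

text \<open>
  \<open>\<N> = d - \<D>\<close> is tensorial, hence determined by its action on constant sections; likewise for the
  derivative \<open>\<D>\<^sub>X B = \<D>\<^sub>X \<circ> B - B \<circ> \<D>\<^sub>X\<close> of a field \<open>B\<close> of endomorphisms.
\<close>

definition Nform :: "('m \<Rightarrow> 'n::finite cvec set) \<Rightarrow> ('m, 'n) form1" where
  "Nform S = (\<lambda>c p X. matrix (\<lambda>v. pd c X (\<lambda>x. v) p - Dconn S c X (\<lambda>x. v) p))"

definition DEnd ::
  "('m \<Rightarrow> 'n::finite cvec set) \<Rightarrow> 'm chart \<Rightarrow> complex \<Rightarrow> ('m \<Rightarrow> 'n cmat) \<Rightarrow> 'm \<Rightarrow> 'n cmat" where
  "DEnd S c X B p = matrix (\<lambda>v. Dconn S c X (\<lambda>x. B x *v v) p - B p *v Dconn S c X (\<lambda>x. v) p)"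

text \<open>
  The exterior derivative, on the vector fields with constant components \<open>X\<close>, \<open>Y\<close> in the chart \<open>c\<close>;
  these commute, so there is no bracket term.
\<close>

definition extD ::
  "('m \<Rightarrow> 'n::finite cvec set) \<Rightarrow> ('m, 'n) form1 \<Rightarrow> 'm chart \<Rightarrow> 'm \<Rightarrow> complex \<Rightarrow> complex \<Rightarrow> 'n cmat" where
  "extD S \<omega> c p X Y = DEnd S c X (\<lambda>x. \<omega> c x Y) p - DEnd S c Y (\<lambda>x. \<omega> c x X) p"

definition constrained_willmore ::
  "'m::topological_space chart set \<Rightarrow> ('m \<Rightarrow> 'n::finite cvec set) \<Rightarrow> ('m, 'n) form1 \<Rightarrow> bool" where
  "constrained_willmore A \<Lambda> q \<longleftrightarrow>
     real_surface A \<Lambda> \<and> one_form A q \<and>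
     (\<forall>c\<in>A. \<forall>p\<in>cdom c. \<forall>X. real_mat (q c p X) \<and> q c p X \<in> wedge_space (\<Lambda> p) (Lam1 A \<Lambda> p)) \<and>
     (let S = central_sphere A \<Lambda>; N = Nform S in
      \<forall>c. holomorphic_chart A \<Lambda> c \<longrightarrow> (\<forall>p\<in>cdom c. \<forall>X Y.
        extD S q c p X Y = 0 \<and>
        extD S (star N) c p X Y = mscale 2 (bracket_wedge q (star N) c p X Y)))"

definition spectral_connection ::
  "('m \<Rightarrow> 'n::finite cvec set) \<Rightarrow> ('m, 'n) form1 \<Rightarrow> complex \<Rightarrow>
   'm chart \<Rightarrow> complex \<Rightarrow> ('m \<Rightarrow> 'n cvec) \<Rightarrow> 'm \<Rightarrow> 'n cvec" where
  "spectral_connection S q l c X f p =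
     Dconn S c X f p +
     (1 / l) *s (part10 (Nform S) c p X *v f p) + l *s (part01 (Nform S) c p X *v f p) +
     (1 / l\<^sup>2 - 1) *s (part10 q c p X *v f p) + (l\<^sup>2 - 1) *s (part01 q c p X *v f p)"


section \<open>The quadratic differential\<close>

definition qz ::
  "'m::topological_space chart set \<Rightarrow> ('m \<Rightarrow> 'n::finite cvec set) \<Rightarrow> ('m, 'n) form1 \<Rightarrow>
   'm chart \<Rightarrow> 'm \<Rightarrow> complex" where
  "qz A \<Lambda> q c p = (THE k. \<forall>\<sigma>. local_real_section A \<Lambda> p \<sigma> \<longrightarrow>
     k *s \<sigma> p = (- 2) *s (at_dz q c p *v pdz c \<sigma> p))"

text \<open>The quadratic form \<open>q\<^sup>z dz\<^sup>2 + cnj q\<^sup>z d(cnj z)\<^sup>2\<close> on the tangent vector with component \<open>X\<close>.\<close>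

definition quad_diff ::
  "'m::topological_space chart set \<Rightarrow> ('m \<Rightarrow> 'n::finite cvec set) \<Rightarrow> ('m, 'n) form1 \<Rightarrow>
   'm chart \<Rightarrow> 'm \<Rightarrow> complex \<Rightarrow> complex" where
  "quad_diff A \<Lambda> q c p X = qz A \<Lambda> q c p * X\<^sup>2 + cnj (qz A \<Lambda> q c p) * (cnj X)\<^sup>2"


section \<open>Baecklund transformation\<close>

text \<open>Up to the definition of \<open>r_star\<close>, \<open>S\<close> and \<open>L\<close> are the fibres at one point.\<close>

datatype riemann_sphere = Fin complex | Infty

definition rho :: "'n::finite cvec set \<Rightarrow> 'n cmat" where
  "rho S = piS S - piSperp S"

definition rhoL :: "'n::finite cvec set \<Rightarrow> 'n cvec set \<Rightarrow> 'n cvec set" where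
  "rhoL S L = (\<lambda>v. rho S *v v) ` L"

definition pi_L :: "'n::finite cvec set \<Rightarrow> 'n cvec set \<Rightarrow> 'n cmat" where
  "pi_L S L = proj_along L (vec.span (rhoL S L \<union> orth (L \<union> rhoL S L)))"

definition pi_rhoL :: "'n::finite cvec set \<Rightarrow> 'n cvec set \<Rightarrow> 'n cmat" where
  "pi_rhoL S L = proj_along (rhoL S L) (vec.span (L \<union> orth (L \<union> rhoL S L)))"

definition pi_perp :: "'n::finite cvec set \<Rightarrow> 'n cvec set \<Rightarrow> 'n cmat" where
  "pi_perp S L = proj_along (orth (L \<union> rhoL S L)) (vec.span (L \<union> rhoL S L))"

fun dress_p :: "'n::finite cvec set \<Rightarrow> complex \<Rightarrow> 'n cvec set \<Rightarrow> riemann_sphere \<Rightarrow> 'n cmat" where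
  "dress_p S a L (Fin l) =
     mscale ((a - l) / (a + l)) (pi_L S L) + pi_perp S L + mscale ((a + l) / (a - l)) (pi_rhoL S L)"
| "dress_p S a L Infty = - pi_L S L + pi_perp S L - pi_rhoL S L"

fun dress_q :: "'n::finite cvec set \<Rightarrow> complex \<Rightarrow> 'n cvec set \<Rightarrow> riemann_sphere \<Rightarrow> 'n cmat" where
  "dress_q S a L (Fin l) =
     mscale ((l - a) / (l + a)) (pi_L S L) + pi_perp S L + mscale ((l + a) / (l - a)) (pi_rhoL S L)"
| "dress_q S a L Infty = mat 1"

definition L_tilde :: "'n::finite cvec set \<Rightarrow> complex \<Rightarrow> 'n cvec set \<Rightarrow> 'n cvec set" where
  "L_tilde S \<alpha> L = (\<lambda>v. dress_q S (inverse (cnj \<alpha>)) (vcnj ` L) (Fin \<alpha>) *v v) ` L"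

definition r_star :: "'n::finite cvec set \<Rightarrow> complex \<Rightarrow> 'n cvec set \<Rightarrow> riemann_sphere \<Rightarrow> 'n cmat" where
  "r_star S \<alpha> L l = dress_p S \<alpha> (L_tilde S \<alpha> L) l ** dress_q S (inverse (cnj \<alpha>)) (vcnj ` L) l"

definition backlund_parameters ::
  "'m::topological_space chart set \<Rightarrow> ('m \<Rightarrow> 'n::finite cvec set) \<Rightarrow> ('m, 'n) form1 \<Rightarrow>
   complex \<Rightarrow> ('m \<Rightarrow> 'n cvec set) \<Rightarrow> bool" where
  "backlund_parameters A \<Lambda> q \<alpha> L \<longleftrightarrow>
     \<alpha> \<noteq> 0 \<and> cmod \<alpha> \<noteq> 1 \<and> null_line_bundle A L \<and>
     (let S = central_sphere A \<Lambda> in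
      (\<forall>c. holomorphic_chart A \<Lambda> c \<longrightarrow> (\<forall>p\<in>cdom c. \<forall>\<sigma> X. local_section A L p \<sigma> \<longrightarrow>
         spectral_connection S q \<alpha> c X \<sigma> p \<in> L p)) \<and>
      (\<forall>p. rhoL (S p) (L p) \<inter> orth (L p) = {0} \<and>
           rhoL (S p) (L_tilde (S p) \<alpha> (L p)) \<inter> orth (L_tilde (S p) \<alpha> (L p)) = {0}))"

definition backlund_transform ::
  "'m::topological_space chart set \<Rightarrow> ('m \<Rightarrow> 'n::finite cvec set) \<Rightarrow> complex \<Rightarrow>
   ('m \<Rightarrow> 'n cvec set) \<Rightarrow> 'm \<Rightarrow> 'n cvec set" where
  "backlund_transform A \<Lambda> \<alpha> L p =
     (let r = r_star (central_sphere A \<Lambda> p) \<alpha> (L p) in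
      (\<lambda>v. (matrix_inv (r (Fin 1)) ** r Infty) *v v) ` Lam10 A \<Lambda> p \<inter>
      (\<lambda>v. (matrix_inv (r (Fin 1)) ** r (Fin 0)) *v v) ` Lam01 A \<Lambda> p)"

definition backlund_multiplier ::
  "'m::topological_space chart set \<Rightarrow> ('m \<Rightarrow> 'n::finite cvec set) \<Rightarrow> ('m, 'n) form1 \<Rightarrow>
   complex \<Rightarrow> ('m \<Rightarrow> 'n cvec set) \<Rightarrow> ('m, 'n) form1" where
  "backlund_multiplier A \<Lambda> q \<alpha> L = (\<lambda>c p X.
     let r = r_star (central_sphere A \<Lambda> p) \<alpha> (L p) in
     Ad (matrix_inv (r (Fin 1)))
       (Ad (r (Fin 0)) (part10 q c p X) + Ad (r Infty) (part01 q c p X)))"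

end

theory Submission
  imports Defs "HOL-Complex_Analysis.Cauchy_Integral_Formula"
begin

text \<open>
  All computations take place at one point, on \<open>(1,0)\<close>-parts, with the parameter \<open>t = \<lambda>\<^sup>-\<^sup>1\<close>. There
  \<open>d\<^sub>S\<^sup>\<lambda>\<^sup>,\<^sup>q\<close> is \<open>\<partial>\<^sub>z + M(t)\<close> for a quadratic polynomial \<open>M\<close> in \<open>t\<close> with skew coefficients and
  \<open>M(1) = 0\<close>. A null line spanned by \<open>l\<close>, with \<open>k = \<rho>l\<close>, is encoded by the skew operator \<open>\<Delta>\<close> with
  \<open>\<Delta>l = l\<close>, \<open>\<Delta>k = -k\<close> that vanishes on the orthogonal complement of \<open>l, k\<close>; the simple factors are
  polynomials in \<open>\<Delta>\<close>. Parallelism of the line makes the gauge-transformed connection again a quadratic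
  polynomial in \<open>t\<close>, with an explicit formula. Up to left multiplication by an involution that does not
  depend on the parameter, \<open>r\<^sup>*(\<lambda>)\<close> is the product of two such factors, which are trivial at \<open>\<lambda> = 0\<close>; so
  \<open>r\<^sup>*(1)\<^sup>-\<^sup>1 r\<^sup>*(0)\<close> is the inverse of the product \<open>V\<close> of the two factors at \<open>\<lambda> = 1\<close>. Since
  \<open>M(1) = 0\<close>, \<open>\<partial>\<^sub>z V = - W V\<close> for the twice dressed connection \<open>W\<close> at \<open>t = 1\<close>. As \<open>d\<^sup>\<D>q = 0\<close> forces
  \<open>q\<^sup>1\<^sup>,\<^sup>0\<close> to take values in \<open>\<Lambda> \<and> \<Lambda>\<^sup>0\<^sup>,\<^sup>1\<close>, the explicit formula gives \<open>(W v, w) = 0\<close> on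
  \<open>\<Lambda>\<^sup>0\<^sup>,\<^sup>1\<close>. A section of \<open>\<Lambda>\<^sup>*\<close> is \<open>V\<^sup>-\<^sup>1 v\<close> with \<open>v\<close> in \<open>\<Lambda>\<^sup>0\<^sup>,\<^sup>1\<close>, and \<open>q\<^sub>z v\<^sub>z = - q\<^sup>z v / 2\<close> for all
  such \<open>v\<close>; conjugating by \<open>V\<close> gives the claim.
\<close>

section \<open>Skew operators attached to null lines\<close>

text \<open>In \<open>t\<close> the point \<lambda> = 0 becomes infinity, where the simple factors
  tend to the identity. So dressing keeps the leading coefficient q_z of \<open>M\<close>, and the
  other new coefficients are read off an expansion at infinity. A factor has poles at t = s and t =
  -s; they cancel because \<open>l\<close> is parallel at s and \<open>k\<close> at -s. The second
  follows from the first: \<rho> commutes with q and anticommutes with \<N>, so it carries the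
  connection at t to the one at -t. One line gives two factors: conjugation exchanges types and
  sends \<lambda> to 1 / cnj \<lambda>, so cnj L is parallel at t = cnj \<alpha>, while L is
  parallel at t = 1 / \<alpha>. Products on \<Lambda>^(0,1) suffice because q_z is a wedge of
  \<sigma> with a multiple of \<sigma>_zbar and sees a vector only through its products with these
  two. In V s_z = v_z + W v the W part therefore drops out, and the products of v_z come from
  differentiating (v, \<sigma>) = (v, \<sigma>_zbar) = 0. The bundles are spans over all charts and
  sections, and projections are definite descriptions; an explicit local null frame has to replace
  them before anything can be differentiated.\<close>

lemma mscale_nth [simp]: "mscale k B $ i $ j = k * B $ i $ j"
  by (simp add: mscale_def)

lemma mscale_mult_vec: "mscale k B *v x = k *s (B *v x)"
  by (simp add: vec_eq_iff matrix_vector_mult_def sum_distrib_left mult.assoc)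

lemma mult_vec_smult: "(B::'n::finite cmat) *v (k *s x) = k *s (B *v x)"
  by (simp add: vec_eq_iff matrix_vector_mult_def sum_distrib_left mult.left_commute)

lemma mult_vec_minus: "(B::'n::finite cmat) *v (- x) = - (B *v x)"
  by (simp add: vec_eq_iff matrix_vector_mult_def sum_negf)

lemma minus_mult_vec: "(- B::'n::finite cmat) *v x = - (B *v x)"
  by (simp add: vec_eq_iff matrix_vector_mult_def sum_negf)

lemmas mat_apply = matrix_vector_mul_assoc[symmetric] matrix_vector_mult_add_rdistrib
  matrix_vector_mult_diff_rdistrib mscale_mult_vec minus_mult_vec matrix_vector_mul_lid

lemmas vec_linear = matrix_vector_right_distrib matrix_vector_mult_diff_distrib mult_vec_smult
  mult_vec_minus

lemma matrix_apply:
  assumes "\<And>x y. f (x + y) = f x + f y" "\<And>k x. f (k *s x) = k *s f x"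
  shows "matrix f *v x = (f x :: 'n::finite cvec)"
  by (rule matrix_works) (use assms in \<open>auto simp: Vector_Spaces.linear_iff vector_space_pair_def
        vec.vector_space_axioms\<close>)

lemma mform_commute: "mform x y = mform y x"
  by (simp add: mform_def mult_ac)

lemma mform_add_left: "mform (x + y) z = mform x z + mform y z"
  by (simp add: mform_def algebra_simps sum.distrib[symmetric])

lemma mform_smult_left: "mform (k *s x) z = k * mform x z"
  by (simp add: mform_def sum_distrib_left mult_ac)

lemma mform_minus_left: "mform (- x) z = - mform x z"
  using mform_smult_left[of "-1" x z] by simp

lemma mform_diff_left: "mform (x - y) z = mform x z - mform y z"
  using mform_add_left[of x "- y" z] by (simp add: mform_minus_left)

lemma mform_zero_left [simp]: "mform 0 z = 0"
  by (simp add: mform_def)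

lemma mform_add_right: "mform z (x + y) = mform z x + mform z y"
  by (metis mform_add_left mform_commute)

lemma mform_smult_right: "mform z (k *s x) = k * mform z x"
  by (metis mform_smult_left mform_commute)

lemma mform_minus_right: "mform z (- x) = - mform z x"
  by (metis mform_minus_left mform_commute)

lemma mform_diff_right: "mform z (x - y) = mform z x - mform z y"
  by (metis mform_diff_left mform_commute)

lemma mform_zero_right [simp]: "mform z 0 = 0"
  by (simp add: mform_def)

lemmas mform_linear = mform_add_left mform_smult_left mform_minus_left mform_diff_left
  mform_add_right mform_smult_right mform_minus_right mform_diff_right

lemma mform_axis: "mform x (axis i 1) = (if i = None then - 1 else 1) * x $ i"
  by (simp add: mform_def axis_def if_distrib cong: if_cong)

lemma mform_nondegenerate:
  assumes "\<And>y. mform x y = 0" shows "x = 0"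
proof -
  have "x $ i = 0" for i
    using assms[of "axis i 1"] by (auto simp: mform_axis split: if_splits)
  then show ?thesis by (simp add: vec_eq_iff)
qed

definition outer :: "'n::finite cvec \<Rightarrow> 'n cvec \<Rightarrow> 'n cmat" where
  "outer u w = (\<chi> i j. u $ i * ((if j = None then - 1 else 1) * w $ j))"

lemma outer_apply: "outer u w *v x = mform x w *s u"
  by (simp add: vec_eq_iff matrix_vector_mult_def outer_def mform_def sum_distrib_left
      sum_distrib_right mult_ac)

lemma wedge_apply: "wedge v1 v2 *v w = mform w v1 *s v2 - mform w v2 *s v1"
  unfolding wedge_def by (rule matrix_apply) (auto simp: mform_linear algebra_simps vec_eq_iff)

definition skew :: "'n::finite cmat \<Rightarrow> bool" where
  "skew Z \<longleftrightarrow> (\<forall>x y. mform (Z *v x) y = - mform x (Z *v y))"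

lemma skew_diag:
  assumes "skew Z" shows "mform (Z *v x) x = 0"
  using assms[unfolded skew_def, rule_format, of x x] mform_commute[of x "Z *v x"] by simp

lemma skew_add: "skew B \<Longrightarrow> skew C \<Longrightarrow> skew (B + C)"
  by (auto simp: skew_def mat_apply mform_linear)

lemma skew_mscale: "skew B \<Longrightarrow> skew (mscale k B)"
  by (auto simp: skew_def mat_apply mform_linear)

text \<open>This is \<open>wedge k l\<close> divided by the product of \<open>l\<close> and
  \<open>k\<close>. The division makes it depend on the two lines only, so the multiples of
  \<open>l\<close> and \<open>k\<close> that appear in their derivatives cancel.\<close>

definition line_rot :: "'n::finite cvec \<Rightarrow> 'n cvec \<Rightarrow> 'n cmat" where
  "line_rot l k = mscale (1 / mform l k) (outer l k - outer k l)"

lemma line_rot_apply: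
  "line_rot l k *v x = (1 / mform l k) *s (mform x k *s l - mform x l *s k)"
  by (simp add: line_rot_def mat_apply outer_apply)

locale null_pair =
  fixes l k :: "'n::finite cvec"
  assumes ll: "mform l l = 0" and kk: "mform k k = 0" and lk: "mform l k \<noteq> 0"
begin

abbreviation "\<Delta> \<equiv> line_rot l k"

lemma rot_l: "\<Delta> *v l = l"
  using ll lk by (simp add: line_rot_apply vec_eq_iff)

lemma rot_k: "\<Delta> *v k = - k"
  using kk lk mform_commute[of k l] by (simp add: line_rot_apply vec_eq_iff)

lemma rot2: "\<Delta> *v (\<Delta> *v x) = (1 / mform l k) *s (mform x k *s l + mform x l *s k)"
  by (subst (2) line_rot_apply)
    (simp add: vec_linear rot_l rot_k vec_eq_iff algebra_simps)

lemma rot3: "\<Delta> *v (\<Delta> *v (\<Delta> *v x)) = \<Delta> *v x"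
proof -
  have "\<Delta> *v (\<Delta> *v (\<Delta> *v x)) = \<Delta> *v ((1 / mform l k) *s (mform x k *s l + mform x l *s k))"
    by (simp only: rot2)
  also have "\<dots> = (1 / mform l k) *s (mform x k *s l - mform x l *s k)"
    by (simp only: vec_linear rot_l rot_k) simp
  finally show ?thesis by (simp only: line_rot_apply[of l k x])
qed

lemma skew_rot: "skew \<Delta>"
  by (auto simp: skew_def line_rot_apply mform_linear algebra_simps mform_commute)

text \<open>For skew \<open>Z\<close> the products (Zl, l) and (Zk, k) vanish and the two diagonal
  entries on \<open>l\<close>, \<open>k\<close> are opposite, so the compression of \<open>Z\<close>
  to the plane of \<open>l\<close>, \<open>k\<close> is a multiple of \<Delta>. This relation is
  what reduces the gauge formula to scalar algebra.\<close>

lemma rot_skew_rot: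
  assumes "skew Z"
  shows "\<Delta> *v (Z *v (\<Delta> *v x)) = (mform (Z *v l) k / mform l k) *s (\<Delta> *v x)"
proof -
  have zk: "mform (Z *v k) l = - mform (Z *v l) k" "mform (Z *v l) l = 0" "mform (Z *v k) k = 0"
    using assms skew_diag[OF assms] mform_commute[of k "Z *v l"] by (simp_all add: skew_def)
  define e where "e = mform (Z *v l) k / mform l k"
  have 1: "\<Delta> *v (Z *v l) = e *s l" "\<Delta> *v (Z *v k) = e *s k"
    unfolding line_rot_apply zk e_def by simp_all
  have "\<Delta> *v (Z *v (\<Delta> *v x)) = \<Delta> *v (Z *v ((1 / mform l k) *s (mform x k *s l - mform x l *s k)))"
    by (simp only: line_rot_apply[of l k x])
  also have "\<dots> = (1 / mform l k) *s (mform x k *s (e *s l) - mform x l *s (e *s k))"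
    by (simp only: vec_linear 1)
  also have "\<dots> = e *s (\<Delta> *v x)"
    by (simp add: line_rot_apply[of l k x] vec_eq_iff right_diff_distrib mult_ac)
  finally show ?thesis by (simp add: e_def)
qed

end

section \<open>Simple factors and their gauge action on quadratic pencils\<close>

text \<open>
  With \<open>D = \<pi>\<^sub>L - \<pi>\<^sub>\<rho>\<^sub>L\<close> this is \<open>p\<^bsub>a,L\<^esub>(\<lambda>)\<close> for \<open>s = 1/a\<close>, \<open>t = 1/\<lambda>\<close>: there
  \<open>(a - \<lambda>) / (a + \<lambda>) = (t - s) / (t + s)\<close>, and \<open>D\<^sup>2 = \<pi>\<^sub>L + \<pi>\<^sub>\<rho>\<^sub>L\<close>.
\<close>

definition dressing :: "complex \<Rightarrow> 'n::finite cmat \<Rightarrow> complex \<Rightarrow> 'n cmat" where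
  "dressing s D t =
     mat 1 + mscale (1 / (t\<^sup>2 - s\<^sup>2)) (mscale (- (2 * s * t)) D + mscale (2 * s\<^sup>2) (D ** D))"

definition dressing_deriv :: "complex \<Rightarrow> 'n::finite cmat \<Rightarrow> 'n cmat \<Rightarrow> complex \<Rightarrow> 'n cmat" where
  "dressing_deriv s D D' t =
     mscale (1 / (t\<^sup>2 - s\<^sup>2)) (mscale (- (2 * s * t)) D' + mscale (2 * s\<^sup>2) (D' ** D + D ** D'))"

text \<open>\<open>D\<close> has eigenvalues among 1, 0, -1, and on each eigenspace the scalars at
  \<open>t\<close> and \<open>- t\<close> are reciprocal.\<close>

lemma dressing_inverse:
  assumes "\<And>x. D *v (D *v (D *v x)) = D *v x" "t\<^sup>2 \<noteq> s\<^sup>2"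
  shows "dressing s D t ** dressing s D (- t) = mat 1"
proof -
  define c where "c = 1 / (t\<^sup>2 - s\<^sup>2)"
  have c: "c * (t\<^sup>2 - s\<^sup>2) = 1" using assms(2) by (simp add: c_def)
  have "dressing s D t *v (dressing s D (- t) *v x) = x" for x
  proof -
    have "(dressing s D t *v (dressing s D (- t) *v x)) $ i = x $ i" for i
      unfolding dressing_def power2_minus c_def[symmetric]
      using c
      by (simp add: mat_apply vec_linear assms(1) del: vector_smult_assoc) algebra
    then show ?thesis by (simp add: vec_eq_iff)
  qed
  then show ?thesis
    by (simp add: matrix_eq matrix_vector_mul_assoc[symmetric])
qed

text \<open>At t = infinity the factor is 1 - 2 s D / t + 2 s^2 D^2 / t^2 + ..., its inverse has the
  sign of \<open>t\<close> reversed, and its derivative is O(1/t). This is the coefficient of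
  \<open>t\<close> in the product factor * pencil * inverse.\<close>

definition dressed_conn :: "complex \<Rightarrow> 'n::finite cmat \<Rightarrow> 'n cmat \<Rightarrow> 'n cmat \<Rightarrow> 'n cmat" where
  "dressed_conn s D Q N = N + mscale (2 * s) (Q ** D - D ** Q)"

text \<open>The constant coefficient of the same expansion. It produces the term -4 s^2 D Q D,
  written here with D D Q D D: for skew \<open>Q\<close> both are the same multiple of
  \<open>D\<close>.\<close>

definition dressed_const :: "complex \<Rightarrow> 'n::finite cmat \<Rightarrow> 'n cmat \<Rightarrow> 'n cmat \<Rightarrow> 'n cmat \<Rightarrow> 'n cmat" where
  "dressed_const s D Q N C = C + mscale (2 * s) (N ** D - D ** N)
     + mscale (2 * s\<^sup>2) (Q ** D ** D + D ** D ** Q - mscale 2 (D ** D ** Q ** D ** D))"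

text \<open>The derivative of \<open>D\<close> forced by parallelism of \<open>l\<close> at s and of
  \<open>k\<close> at -s. The part of the pencil even in s moves both lines alike and gives the
  commutator; the odd part s N moves them oppositely and gives the last term.\<close>

definition rot_deriv :: "complex \<Rightarrow> 'n::finite cmat \<Rightarrow> 'n cmat \<Rightarrow> 'n cmat \<Rightarrow> 'n cmat \<Rightarrow> 'n cmat" where
  "rot_deriv s D Q N C =
     D ** (mscale (s\<^sup>2) Q + C) - (mscale (s\<^sup>2) Q + C) ** D
     - mscale s (D ** D ** N + N ** D ** D - mscale 2 (D ** D ** N ** D ** D))"

definition pencil :: "'n::finite cmat \<Rightarrow> 'n cmat \<Rightarrow> 'n cmat \<Rightarrow> complex \<Rightarrow> 'n cmat" where
  "pencil Q N C t = mscale (t\<^sup>2) Q + mscale t N + C"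

text \<open>This is the gauge transformation with denominators on the factor cleared. The hypotheses
  \<open>eQ\<close>, \<open>eN\<close>, \<open>eC\<close> come from \<open>rot_skew_rot\<close>;
  with \<open>D3\<close> they shorten every word in the matrices, after which each vector component
  is a polynomial identity modulo c (t^2 - s^2) = 1.\<close>

lemma dressing_gauge:
  assumes D3: "\<And>x. D *v (D *v (D *v x)) = D *v x"
    and eQ: "\<And>x. D *v (Q *v (D *v x)) = eq *s (D *v x)"
    and eN: "\<And>x. D *v (N *v (D *v x)) = en *s (D *v x)"
    and eC: "\<And>x. D *v (C *v (D *v x)) = ec *s (D *v x)"
    and t: "t\<^sup>2 \<noteq> s\<^sup>2"
  shows "pencil Q (dressed_conn s D Q N) (dressed_const s D Q N C) t ** dressing s D t
    = dressing s D t ** pencil Q N C t - dressing_deriv s D (rot_deriv s D Q N C) t"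
proof -
  define c where "c = 1 / (t\<^sup>2 - s\<^sup>2)"
  have c: "c * (t\<^sup>2 - s\<^sup>2) = 1" using t by (simp add: c_def)
  have *: "(pencil Q (dressed_conn s D Q N) (dressed_const s D Q N C) t *v (dressing s D t *v x)) $ i
    = (dressing s D t *v (pencil Q N C t *v x) - dressing_deriv s D (rot_deriv s D Q N C) t *v x) $ i"
    for x i
    unfolding dressing_def dressing_deriv_def c_def[symmetric] pencil_def dressed_conn_def
      dressed_const_def rot_deriv_def
    using c
    by (simp add: mat_apply vec_linear D3 eQ eN eC del: vector_smult_assoc) algebra
  then show ?thesis
    by (simp add: matrix_eq matrix_vector_mul_assoc[symmetric] mat_apply vec_eq_iff)
qed

section \<open>Directional derivatives and dressing\<close>

text \<open>\<open>w\<close> is the complexified direction \<open>fst w \<partial>\<^sub>x + snd w \<partial>\<^sub>y\<close>.\<close>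

definition dirder :: "complex \<times> complex \<Rightarrow> (complex \<Rightarrow> complex) \<Rightarrow> complex \<Rightarrow> complex \<Rightarrow> bool" where
  "dirder w f f' z \<longleftrightarrow> (\<exists>D. (f has_derivative D) (at z) \<and> f' = fst w * D 1 + snd w * D \<i>)"

definition vdirder ::
  "complex \<times> complex \<Rightarrow> (complex \<Rightarrow> 'n::finite cvec) \<Rightarrow> 'n cvec \<Rightarrow> complex \<Rightarrow> bool" where
  "vdirder w f f' z \<longleftrightarrow> (\<forall>i. dirder w (\<lambda>x. f x $ i) (f' $ i) z)"

definition mdirder ::
  "complex \<times> complex \<Rightarrow> (complex \<Rightarrow> 'n::finite cmat) \<Rightarrow> 'n cmat \<Rightarrow> complex \<Rightarrow> bool" where
  "mdirder w f f' z \<longleftrightarrow> (\<forall>i j. dirder w (\<lambda>x. f x $ i $ j) (f' $ i $ j) z)"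

lemma dirder_unique: "dirder w f a z \<Longrightarrow> dirder w f b z \<Longrightarrow> a = b"
  unfolding dirder_def using has_derivative_unique by blast

lemma dirder_cong:
  assumes "eventually (\<lambda>x. f x = g x) (nhds z)" "dirder w f a z" shows "dirder w g a z"
proof -
  have "(g has_derivative D) (at z)" if "(f has_derivative D) (at z)" for D
    by (rule has_derivative_transform_eventually[OF that])
      (use assms(1) eventually_nhds_x_imp_x[OF assms(1)] in \<open>auto simp: eventually_at_filter elim: eventually_mono\<close>)
  then show ?thesis using assms(2) unfolding dirder_def by blast
qed

lemma dirder_const: "dirder w (\<lambda>x. c) 0 z"
  unfolding dirder_def by (rule exI[of _ "\<lambda>x. 0"]) auto

lemma dirder_add: "dirder w f f' z \<Longrightarrow> dirder w g g' z \<Longrightarrow> dirder w (\<lambda>x. f x + g x) (f' + g') z"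
  unfolding dirder_def
  by (elim exE conjE, rule exI, rule conjI, erule (1) has_derivative_add) (simp add: algebra_simps)

lemma dirder_mult:
  assumes "dirder w f f' z" "dirder w g g' z"
  shows "dirder w (\<lambda>x. f x * g x) (f' * g z + f z * g') z"
proof -
  obtain D E where "(f has_derivative D) (at z)" "f' = fst w * D 1 + snd w * D \<i>"
    "(g has_derivative E) (at z)" "g' = fst w * E 1 + snd w * E \<i>"
    using assms unfolding dirder_def by blast
  then show ?thesis unfolding dirder_def
    by (intro exI[of _ "\<lambda>h. f z * E h + D h * g z"] conjI has_derivative_mult)
      (auto simp: algebra_simps)
qed

lemma dirder_cmult: "dirder w f f' z \<Longrightarrow> dirder w (\<lambda>x. c * f x) (c * f') z"
  using dirder_mult[OF dirder_const] by fastforce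

lemma dirder_minus: "dirder w f f' z \<Longrightarrow> dirder w (\<lambda>x. - f x) (- f') z"
  using dirder_cmult[of w f f' z "-1"] by simp

lemma dirder_diff: "dirder w f f' z \<Longrightarrow> dirder w g g' z \<Longrightarrow> dirder w (\<lambda>x. f x - g x) (f' - g') z"
  using dirder_add[OF _ dirder_minus] by fastforce

lemma dirder_sum:
  assumes "\<And>i. i \<in> I \<Longrightarrow> dirder w (f i) (f' i) z"
  shows "dirder w (\<lambda>x. \<Sum>i\<in>I. f i x) (\<Sum>i\<in>I. f' i) z"
  using assms by (induction I rule: infinite_finite_induct) (auto intro: dirder_const dirder_add)

lemma dirder_inverse:
  assumes "dirder w f f' z" "f z \<noteq> 0"
  shows "dirder w (\<lambda>x. 1 / f x) (- f' / (f z)\<^sup>2) z"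
proof -
  obtain D where D: "(f has_derivative D) (at z)" "f' = fst w * D 1 + snd w * D \<i>"
    using assms unfolding dirder_def by blast
  have "((\<lambda>x. inverse (f x)) has_derivative (\<lambda>h. - (inverse (f z) * D h * inverse (f z)))) (at z)"
    by (rule Deriv.has_derivative_inverse) (use D assms in auto)
  then show ?thesis unfolding dirder_def using D
    by (intro exI[of _ "\<lambda>h. - (inverse (f z) * D h * inverse (f z))"])
      (auto simp: field_simps power2_eq_square add_divide_distrib[symmetric])
qed

text \<open>Conjugation is only real linear, so the complexified direction is conjugated along with
  the function.\<close>

lemma dirder_cnj:
  assumes "dirder w f f' z" shows "dirder (cnj (fst w), cnj (snd w)) (\<lambda>x. cnj (f x)) (cnj f') z"
proof -
  obtain D where D: "(f has_derivative D) (at z)" "f' = fst w * D 1 + snd w * D \<i>"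
    using assms unfolding dirder_def by blast
  then show ?thesis unfolding dirder_def
    by (intro exI[of _ "\<lambda>h. cnj (D h)"] conjI has_derivative_cnj) auto
qed

lemma vdirder_unique: "vdirder w f a z \<Longrightarrow> vdirder w f b z \<Longrightarrow> a = b"
  by (auto simp: vdirder_def vec_eq_iff intro: dirder_unique)

lemma vdirder_cong:
  assumes "eventually (\<lambda>x. f x = g x) (nhds z)" "vdirder w f a z" shows "vdirder w g a z"
  unfolding vdirder_def
proof
  fix i
  show "dirder w (\<lambda>x. g x $ i) (a $ i) z"
    by (rule dirder_cong[of "\<lambda>x. f x $ i"])
      (use assms in \<open>auto simp: vdirder_def elim: eventually_mono\<close>)
qed

lemma mdirder_unique: "mdirder w f a z \<Longrightarrow> mdirder w f b z \<Longrightarrow> a = b"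
  unfolding mdirder_def vec_eq_iff using dirder_unique by blast

lemma vdirder_const: "vdirder w (\<lambda>x. c) 0 z"
  by (simp add: vdirder_def dirder_const)

lemma mdirder_const: "mdirder w (\<lambda>x. c) 0 z"
  by (simp add: mdirder_def dirder_const)

lemma vdirder_add: "vdirder w f f' z \<Longrightarrow> vdirder w g g' z \<Longrightarrow> vdirder w (\<lambda>x. f x + g x) (f' + g') z"
  by (simp add: vdirder_def dirder_add)

lemma vdirder_diff: "vdirder w f f' z \<Longrightarrow> vdirder w g g' z \<Longrightarrow> vdirder w (\<lambda>x. f x - g x) (f' - g') z"
  by (simp add: vdirder_def dirder_diff)

lemma mdirder_add: "mdirder w f f' z \<Longrightarrow> mdirder w g g' z \<Longrightarrow> mdirder w (\<lambda>x. f x + g x) (f' + g') z"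
  by (simp add: mdirder_def dirder_add)

lemma mdirder_diff: "mdirder w f f' z \<Longrightarrow> mdirder w g g' z \<Longrightarrow> mdirder w (\<lambda>x. f x - g x) (f' - g') z"
  by (simp add: mdirder_def dirder_diff)

lemma vdirder_smult:
  "dirder w f f' z \<Longrightarrow> vdirder w g g' z \<Longrightarrow> vdirder w (\<lambda>x. f x *s g x) (f' *s g z + f z *s g') z"
  by (auto simp: vdirder_def intro!: dirder_mult)

lemma vdirder_csmult: "vdirder w g g' z \<Longrightarrow> vdirder w (\<lambda>x. c *s g x) (c *s g') z"
  by (simp add: vdirder_def dirder_cmult)

lemma mdirder_mscale:
  "dirder w f f' z \<Longrightarrow> mdirder w g g' z \<Longrightarrow>
   mdirder w (\<lambda>x. mscale (f x) (g x)) (mscale f' (g z) + mscale (f z) g') z"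
  by (auto simp: mdirder_def intro!: dirder_mult)

lemma mdirder_cmscale: "mdirder w g g' z \<Longrightarrow> mdirder w (\<lambda>x. mscale c (g x)) (mscale c g') z"
  by (simp add: mdirder_def dirder_cmult)

lemma mdirder_mult:
  assumes "mdirder w f f' z" "mdirder w g g' z"
  shows "mdirder w (\<lambda>x. f x ** g x) (f' ** g z + f z ** g') z"
  unfolding mdirder_def matrix_matrix_mult_def
  using assms by (auto simp: mdirder_def sum.distrib[symmetric] intro!: dirder_sum dirder_mult)

lemma vdirder_mult_vec:
  assumes "mdirder w f f' z" "vdirder w g g' z"
  shows "vdirder w (\<lambda>x. f x *v g x) (f' *v g z + f z *v g') z"
  unfolding vdirder_def matrix_vector_mult_def
  using assms by (auto simp: mdirder_def vdirder_def sum.distrib[symmetric] intro!: dirder_sum dirder_mult)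

lemma vdirder_mult_const:
  assumes "mdirder w f f' z" shows "vdirder w (\<lambda>x. f x *v v) (f' *v v) z"
  using vdirder_mult_vec[OF assms vdirder_const[of w v z]] by simp

lemma dirder_mform:
  assumes "vdirder w f f' z" "vdirder w g g' z"
  shows "dirder w (\<lambda>x. mform (f x) (g x)) (mform f' (g z) + mform (f z) g') z"
proof -
  have "dirder w (\<lambda>x. \<Sum>i\<in>UNIV. (if i = None then - 1 else 1) * (f x $ i * g x $ i))
    (\<Sum>i\<in>UNIV. (if i = None then - 1 else 1) * (f' $ i * g z $ i + f z $ i * g' $ i)) z"
    by (intro dirder_sum dirder_cmult dirder_mult) (use assms in \<open>auto simp: vdirder_def\<close>)
  then show ?thesis
    by (simp add: mform_def mult.assoc sum.distrib distrib_left)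
qed

lemma mdirder_outer:
  assumes "vdirder w f f' z" "vdirder w g g' z"
  shows "mdirder w (\<lambda>x. outer (f x) (g x)) (outer f' (g z) + outer (f z) g') z"
  unfolding mdirder_def
proof safe
  fix i j
  show "dirder w (\<lambda>x. outer (f x) (g x) $ i $ j) ((outer f' (g z) + outer (f z) g') $ i $ j) z"
    unfolding outer_def using assms
    by (simp only: vec_lambda_beta vector_add_component) (intro dirder_mult dirder_cmult, auto simp: vdirder_def)
qed

lemma vdirder_vcnj:
  "vdirder w f f' z \<Longrightarrow> vdirder (cnj (fst w), cnj (snd w)) (\<lambda>x. vcnj (f x)) (vcnj f') z"
  by (simp add: vdirder_def vcnj_def dirder_cnj)

section \<open>Dressing along parallel null lines\<close>

lemma pencil_apply: "pencil Q N C t *v x = t\<^sup>2 *s (Q *v x) + t *s (N *v x) + C *v x"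
  by (simp add: pencil_def mat_apply)

lemma skewD: "skew Z \<Longrightarrow> mform (Z *v x) y = - mform x (Z *v y)"
  by (simp add: skew_def)

text \<open>The rates \<open>c\<close> and \<open>c'\<close> express that only the lines are
  parallel, not the chosen sections; they disappear because \<open>line_rot\<close> is invariant
  under rescaling.\<close>

lemma mdirder_line_rot:
  assumes l: "vdirder w l (c *s l z - pencil Q N C s *v l z) z"
    and k: "vdirder w k (c' *s k z - pencil Q N C (- s) *v k z) z"
    and np: "null_pair (l z) (k z)" and Q: "skew Q" and N: "skew N" and C: "skew C"
  shows "mdirder w (\<lambda>x. line_rot (l x) (k x)) (rot_deriv s (line_rot (l z) (k z)) Q N C) z"
proof -
  interpret null_pair "l z" "k z" by (rule np)
  define m where "m = mform (l z) (k z)"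
  define l' where "l' = c *s l z - pencil Q N C s *v l z"
  define k' where "k' = c' *s k z - pencil Q N C (- s) *v k z"
  define e where "e = mform (N *v l z) (k z) / m"
  have m0: "m \<noteq> 0" using lk by (simp add: m_def)
  have nl: "mform (N *v l z) (k z) = e * m" using m0 by (simp add: e_def)
  define m' where "m' = mform l' (k z) + mform (l z) k'"
  \<comment> \<open>By skewness the terms with \<open>Q\<close> and \<open>C\<close>, which are even
    in s, cancel between the two products; the odd term with \<open>N\<close> doubles.\<close>
  have m': "m' = (c + c') * m - 2 * s * e * m"
    unfolding m'_def l'_def k'_def m_def[symmetric] pencil_apply
    using skewD[OF Q, of "l z" "k z"] skewD[OF N, of "l z" "k z"] skewD[OF C, of "l z" "k z"]
    by (simp add: mform_linear nl m_def[symmetric] algebra_simps) algebra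
  define D' where "D' = mscale (- m' / m\<^sup>2) (outer (l z) (k z) - outer (k z) (l z))
      + mscale (1 / m) (outer l' (k z) + outer (l z) k' - (outer k' (l z) + outer (k z) l'))"
  have "mdirder w (\<lambda>x. line_rot (l x) (k x)) D' z"
    unfolding line_rot_def D'_def m_def m'_def l'_def k'_def
    by (intro mdirder_mscale mdirder_diff mdirder_outer dirder_inverse dirder_mform l k lk)
  moreover have "D' *v x = rot_deriv s \<Delta> Q N C *v x" for x
  proof -
    define d where "d = 1 / m"
    have d: "d * m = 1" using m0 by (simp add: d_def)
    have chart_dom: "- m' / m\<^sup>2 = - (c + c' - 2 * s * e) * d"
      unfolding m' d_def using m0 by (simp add: field_simps power2_eq_square)
    have 1: "D' *v x = - (c + c' - 2 * s * e) *s (\<Delta> *v x) + d *s (mform x (k z) *s l' + mform x k' *s l z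
       - (mform x (l z) *s k' + mform x l' *s k z))"
      unfolding D'_def chart_dom
      by (simp add: mat_apply outer_apply line_rot_apply m_def[symmetric] d_def[symmetric] mult.assoc)
    \<comment> \<open>\<Delta> N \<Delta> = e \<Delta>; multiplying by \<Delta> on both sides leaves
      the cube of \<Delta>, which is \<Delta> again.\<close>
    have 2: "\<Delta> *v (\<Delta> *v (N *v (\<Delta> *v (\<Delta> *v x)))) = e *s (\<Delta> *v x)"
      using rot_skew_rot[OF N] by (simp add: vec_linear rot3 e_def m_def)
    have 3: "\<Delta> *v y = d *s (mform y (k z) *s l z - mform y (l z) *s k z)"
      "\<Delta> *v (\<Delta> *v y) = d *s (mform y (k z) *s l z + mform y (l z) *s k z)" for y
      unfolding rot2 d_def m_def by (simp_all only: line_rot_apply)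
    have s: "mform x (Q *v y) = - mform (Q *v x) y" "mform x (N *v y) = - mform (N *v x) y"
      "mform x (C *v y) = - mform (C *v x) y" for y
      using skewD[OF Q] skewD[OF N] skewD[OF C] by simp_all
    have R: "rot_deriv s \<Delta> Q N C *v x = s\<^sup>2 *s (\<Delta> *v (Q *v x)) + \<Delta> *v (C *v x)
       - (s\<^sup>2 *s (Q *v (\<Delta> *v x)) + C *v (\<Delta> *v x))
       - s *s (\<Delta> *v (\<Delta> *v (N *v x)) + N *v (\<Delta> *v (\<Delta> *v x)) - 2 *s (e *s (\<Delta> *v x)))"
      unfolding rot_deriv_def by (simp add: mat_apply vec_linear 2 del: vector_smult_assoc)
    show ?thesis
      unfolding 1 R 3(2) unfolding 3(1) l'_def k'_def pencil_apply vec_linear mform_linear s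
      by (simp add: vec_eq_iff algebra_simps)
  qed
  then have "D' = rot_deriv s \<Delta> Q N C" by (simp add: matrix_eq)
  ultimately show ?thesis by simp
qed

lemma mdirder_dressing:
  assumes "mdirder w D D' z"
  shows "mdirder w (\<lambda>x. dressing s (D x) t) (dressing_deriv s (D z) D' t) z"
  using mdirder_add[OF mdirder_const mdirder_cmscale[OF mdirder_add[OF mdirder_cmscale[OF assms]
     mdirder_cmscale[OF mdirder_mult[OF assms assms]]]]]
  by (simp add: dressing_def dressing_deriv_def)

lemma skew_dressed_conn:
  assumes "skew D" "skew Q" "skew N" shows "skew (dressed_conn s D Q N)"
  unfolding dressed_conn_def
  by (intro skew_add skew_mscale assms)
    (auto simp: skew_def mat_apply mform_linear skewD[OF assms(1)] skewD[OF assms(2)])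

lemma skew_dressed_const:
  assumes "skew D" "skew Q" "skew N" "skew C" shows "skew (dressed_const s D Q N C)"
  unfolding dressed_const_def
  by (intro skew_add skew_mscale assms)
    (auto simp: skew_def mat_apply mform_linear skewD[OF assms(1)] skewD[OF assms(2)] skewD[OF assms(3)])

text \<open>The first claim is the gauge equation for the factor. The second says that the factor
  carries parallel lines to parallel lines of the dressed connection, with the same rate
  \<open>b\<close>; it prepares the line used in the next dressing.\<close>

lemma dressing_step:
  fixes l k :: "complex \<Rightarrow> 'n::finite cvec"
  assumes l: "vdirder w l (c *s l z - pencil Q N C s *v l z) z"
    and k: "vdirder w k (c' *s k z - pencil Q N C (- s) *v k z) z"
    and np: "null_pair (l z) (k z)" and Q: "skew Q" and N: "skew N" and C: "skew C"
    and t: "t\<^sup>2 \<noteq> s\<^sup>2"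
  defines "p \<equiv> \<lambda>x. dressing s (line_rot (l x) (k x)) t"
    and "Nh \<equiv> dressed_conn s (line_rot (l z) (k z)) Q N"
    and "Ch \<equiv> dressed_const s (line_rot (l z) (k z)) Q N C"
  shows "mdirder w p (p z ** pencil Q N C t - pencil Q Nh Ch t ** p z) z"
    and "vdirder w u (b *s u z - pencil Q N C t *v u z) z \<Longrightarrow>
      vdirder w (\<lambda>x. p x *v u x) (b *s (p z *v u z) - pencil Q Nh Ch t *v (p z *v u z)) z"
proof -
  interpret null_pair "l z" "k z" by (rule np)
  have "pencil Q Nh Ch t ** p z = p z ** pencil Q N C t - dressing_deriv s \<Delta> (rot_deriv s \<Delta> Q N C) t"
    unfolding p_def Nh_def Ch_def
    by (rule dressing_gauge[OF rot3 rot_skew_rot[OF Q] rot_skew_rot[OF N] rot_skew_rot[OF C] t])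
  moreover have "mdirder w p (dressing_deriv s \<Delta> (rot_deriv s \<Delta> Q N C) t) z"
    unfolding p_def by (rule mdirder_dressing[OF mdirder_line_rot[OF l k np Q N C]])
  ultimately show *: "mdirder w p (p z ** pencil Q N C t - pencil Q Nh Ch t ** p z) z" by simp
  show "vdirder w (\<lambda>x. p x *v u x) (b *s (p z *v u z) - pencil Q Nh Ch t *v (p z *v u z)) z"
    if "vdirder w u (b *s u z - pencil Q N C t *v u z) z"
    using vdirder_mult_vec[OF * that] by (simp add: mat_apply vec_linear)
qed

lemma two_step_dressing:
  fixes l1 k1 l k :: "complex \<Rightarrow> 'n::finite cvec"
  assumes Q: "skew Q" and N: "skew N" and C: "C = - Q - N"
    and l1: "vdirder w l1 (c1 *s l1 z - pencil Q N C s1 *v l1 z) z"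
    and k1: "vdirder w k1 (c1' *s k1 z - pencil Q N C (- s1) *v k1 z) z"
    and l: "vdirder w l (c *s l z - pencil Q N C s2 *v l z) z"
    and k: "vdirder w k (c' *s k z - pencil Q N C (- s2) *v k z) z"
    and s: "s2\<^sup>2 \<noteq> s1\<^sup>2" "s1\<^sup>2 \<noteq> 1" "s2\<^sup>2 \<noteq> 1"
  defines "D1 \<equiv> \<lambda>x. line_rot (l1 x) (k1 x)"
  defines "l2 \<equiv> \<lambda>x. dressing s1 (D1 x) s2 *v l x"
    and "k2 \<equiv> \<lambda>x. dressing s1 (D1 x) (- s2) *v k x"
  defines "D2 \<equiv> \<lambda>x. line_rot (l2 x) (k2 x)"
  defines "U \<equiv> \<lambda>x. dressing s2 (D2 x) 1 ** dressing s1 (D1 x) 1"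
  assumes np1: "null_pair (l1 z) (k1 z)" and np2: "null_pair (l2 z) (k2 z)"
    and F: "\<And>a. a \<in> F \<Longrightarrow> Q *v a = 0 \<and> N *v a = 0 \<and> Q *v (D1 z *v a) = 0 \<and> Q *v (D2 z *v a) = 0"
  \<comment> \<open>\<open>W\<close> is the connection matrix at \<open>t = 1\<close> after both dressings\<close>
  shows "\<exists>W. mdirder w U (- (W ** U z)) z \<and> (\<forall>a\<in>F. \<forall>b\<in>F. mform (W *v a) b = 0)"
proof -
  interpret n1: null_pair "l1 z" "k1 z" by (rule np1)
  interpret n2: null_pair "l2 z" "k2 z" by (rule np2)
  have C': "skew C" unfolding C by (auto simp: skew_def mat_apply mform_linear skewD[OF Q] skewD[OF N])
  define N1 where "N1 = dressed_conn s1 (D1 z) Q N"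
  define C1 where "C1 = dressed_const s1 (D1 z) Q N C"
  have sk1: "skew (D1 z)" "skew (D2 z)" using n1.skew_rot n2.skew_rot by (simp_all add: D1_def D2_def)
  have N1: "skew N1" and C1: "skew C1"
    unfolding N1_def C1_def by (intro skew_dressed_conn skew_dressed_const sk1 Q N C')+
  \<comment> \<open>The connection at t = 1 is the trivial one; hence the derivative of the first
    factor at t = 1 has no term with the pencil on its right.\<close>
  have P1: "pencil Q N C 1 = 0" by (simp add: matrix_eq pencil_apply C mat_apply)
  define W where "W = pencil Q (dressed_conn s2 (D2 z) Q N1) (dressed_const s2 (D2 z) Q N1 C1) 1"
  have l2: "vdirder w l2 (c *s l2 z - pencil Q N1 C1 s2 *v l2 z) z"
    unfolding l2_def N1_def C1_def D1_def by (rule dressing_step(2)[OF l1 k1 np1 Q N C' s(1) l])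
  have k2: "vdirder w k2 (c' *s k2 z - pencil Q N1 C1 (- s2) *v k2 z) z"
    unfolding k2_def N1_def C1_def D1_def
    by (rule dressing_step(2)[OF l1 k1 np1 Q N C' _ k]) (use s in simp)
  have p1: "mdirder w (\<lambda>x. dressing s1 (D1 x) 1) (- (pencil Q N1 C1 1 ** dressing s1 (D1 z) 1)) z"
    using dressing_step(1)[OF l1 k1 np1 Q N C', of 1] s(2) P1 by (auto simp: D1_def N1_def C1_def)
  have p2: "mdirder w (\<lambda>x. dressing s2 (D2 x) 1)
      (dressing s2 (D2 z) 1 ** pencil Q N1 C1 1 - W ** dressing s2 (D2 z) 1) z"
    using dressing_step(1)[OF l2 k2 np2 Q N1 C1, of 1] s(3) by (auto simp: D2_def W_def)
  have "(dressing s2 (D2 z) 1 ** pencil Q N1 C1 1 - W ** dressing s2 (D2 z) 1) ** dressing s1 (D1 z) 1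
      + dressing s2 (D2 z) 1 ** - (pencil Q N1 C1 1 ** dressing s1 (D1 z) 1) = - (W ** U z)"
    by (simp add: U_def matrix_eq mat_apply vec_linear)
  then have "mdirder w U (- (W ** U z)) z"
    using mdirder_mult[OF p2 p1] by (simp add: U_def)
  moreover have "mform (W *v a) b = 0" if a: "a \<in> F" and b: "b \<in> F" for a b
  proof -
    note z = F[OF a] F[OF b]
    \<comment> \<open>Each word equals a multiple of D b, the same multiple as D Q D b, and
      \<open>F\<close> gives Q D b = 0.\<close>
    have zero: "D1 z *v (D1 z *v (Q *v (D1 z *v (D1 z *v b)))) = 0"
      "D2 z *v (D2 z *v (Q *v (D2 z *v (D2 z *v b)))) = 0"
      using z n1.rot_skew_rot[OF Q, of b] n2.rot_skew_rot[OF Q, of b]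
      by (auto simp: D1_def D2_def n1.rot_skew_rot[OF Q] n2.rot_skew_rot[OF Q] vec_linear n1.rot3 n2.rot3)
    \<comment> \<open>The undressed part Q + N + C is zero. In each other term, skewness moves the
      factors to the left of \<open>Q\<close> or \<open>N\<close> over to \<open>b\<close>; then
      \<open>Q\<close> or \<open>N\<close> meets \<open>a\<close>, \<open>b\<close> or their images
      under \<open>D1\<close>, \<open>D2\<close>, which \<open>F\<close> kills, or the term is
      covered by \<open>zero\<close>.\<close>
    show ?thesis unfolding W_def pencil_apply dressed_conn_def dressed_const_def N1_def C1_def C
      using z by (simp add: zero mat_apply vec_linear mform_linear skewD[OF sk1(1)] skewD[OF sk1(2)]
         skewD[OF N] skewD[OF Q])
  qed
  ultimately show ?thesis by blast
qed

section \<open>Smooth functions in charts\<close>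

lemma Ck_on_cong:
  assumes "open U" "\<And>x. x \<in> U \<Longrightarrow> f x = g x"
  shows "Ck_on k f U \<longleftrightarrow> Ck_on k g U"
  using assms(2)
proof (induction k arbitrary: f g)
  case 0
  then show ?case by (simp cong: continuous_on_cong)
next
  case (Suc k)
  have "frechet_derivative f (at x) = frechet_derivative g (at x)" if "x \<in> U" for x
  proof -
    have "(f has_derivative D) (at x) \<longleftrightarrow> (g has_derivative D) (at x)" for D
      using has_derivative_transform_within_open[OF _ assms(1) that, of f D UNIV g]
        has_derivative_transform_within_open[OF _ assms(1) that, of g D UNIV f] Suc.prems by auto
    then show ?thesis by (simp add: frechet_derivative_def)
  qed
  then have "Ck_on k (\<lambda>x. frechet_derivative f (at x) X) U \<longleftrightarrow>
      Ck_on k (\<lambda>x. frechet_derivative g (at x) X) U" for X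
    by (intro Suc.IH) simp
  moreover have "f differentiable_on U \<longleftrightarrow> g differentiable_on U"
    using Suc.prems unfolding differentiable_on_def differentiable_def
    by (metis has_derivative_transform)
  ultimately show ?case by simp
qed

lemma Ck_on_subset: "Ck_on k f U \<Longrightarrow> V \<subseteq> U \<Longrightarrow> Ck_on k f V"
  by (induction k arbitrary: f) (auto intro: continuous_on_subset differentiable_on_subset)

lemma Ck_on_bounded_linear:
  assumes "open U" "bounded_linear h" "Ck_on k f U"
  shows "Ck_on k (\<lambda>x. h (f x)) U"
  using assms(3)
proof (induction k arbitrary: f)
  case 0
  then show ?case using assms(2) by (simp add: bounded_linear.continuous_on)
next
  case (Suc k)
  have d: "((\<lambda>x. h (f x)) has_derivative (\<lambda>X. h (frechet_derivative f (at x) X))) (at x)"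
    if "x \<in> U" for x
    using Suc.prems that assms(1)
    by (intro bounded_linear.has_derivative[OF assms(2)])
      (auto simp: differentiable_on_eq_differentiable_at frechet_derivative_works)
  then have "(\<lambda>x. h (f x)) differentiable_on U"
    using assms(1) by (auto simp: differentiable_on_eq_differentiable_at intro: differentiableI)
  moreover have "Ck_on k (\<lambda>x. frechet_derivative (\<lambda>x. h (f x)) (at x) X) U" for X
  proof -
    have "Ck_on k (\<lambda>x. h (frechet_derivative f (at x) X)) U"
      by (rule Suc.IH) (use Suc.prems in auto)
    moreover have "frechet_derivative (\<lambda>x. h (f x)) (at x) = (\<lambda>X. h (frechet_derivative f (at x) X))"
      if "x \<in> U" for x
      using frechet_derivative_at[OF d[OF that]] by simp
    ultimately show ?thesis by (subst Ck_on_cong[OF assms(1)]) auto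
  qed
  ultimately show ?case by simp
qed

lemma Ck_on_add:
  assumes "open U" "Ck_on k f U" "Ck_on k g U"
  shows "Ck_on k (\<lambda>x. f x + g x) U"
  using assms(2,3)
proof (induction k arbitrary: f g)
  case 0
  then show ?case by (simp add: continuous_on_add)
next
  case (Suc k)
  have d: "((\<lambda>x. f x + g x) has_derivative
      (\<lambda>X. frechet_derivative f (at x) X + frechet_derivative g (at x) X)) (at x)"
    if "x \<in> U" for x
    using Suc.prems that assms(1)
    by (intro has_derivative_add)
      (auto simp: differentiable_on_eq_differentiable_at frechet_derivative_works)
  then have "(\<lambda>x. f x + g x) differentiable_on U"
    using assms(1) by (auto simp: differentiable_on_eq_differentiable_at intro: differentiableI)
  moreover have "Ck_on k (\<lambda>x. frechet_derivative (\<lambda>x. f x + g x) (at x) X) U" for X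
  proof -
    have "Ck_on k (\<lambda>x. frechet_derivative f (at x) X + frechet_derivative g (at x) X) U"
      by (rule Suc.IH) (use Suc.prems in auto)
    moreover have "frechet_derivative (\<lambda>x. f x + g x) (at x) =
        (\<lambda>X. frechet_derivative f (at x) X + frechet_derivative g (at x) X)" if "x \<in> U" for x
      using frechet_derivative_at[OF d[OF that]] by simp
    ultimately show ?thesis by (subst Ck_on_cong[OF assms(1)]) auto
  qed
  ultimately show ?case by simp
qed

lemma smooth_on_deriv: "smooth_on f U \<Longrightarrow> smooth_on (\<lambda>x. frechet_derivative f (at x) X) U"
  unfolding smooth_on_def by (metis Ck_on.simps(2))

lemma smooth_on_differentiable:
  "smooth_on f U \<Longrightarrow> open U \<Longrightarrow> x \<in> U \<Longrightarrow> f differentiable (at x)"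
  unfolding smooth_on_def by (metis Ck_on.simps(2) differentiable_on_eq_differentiable_at)

section \<open>Symmetry of second derivatives\<close>

lemma second_difference:
  fixes f :: "complex \<Rightarrow> real"
  assumes f: "\<And>x. x \<in> ball z r \<Longrightarrow> f differentiable (at x)"
    and fX: "\<And>x. x \<in> ball z r \<Longrightarrow> (\<lambda>x. frechet_derivative f (at x) X) differentiable (at x)"
    and h: "0 < h" "2 * h < r" and X: "norm X = 1" and Y: "norm Y = 1"
  shows "\<exists>P \<in> cball z (2 * h). f (z + h *\<^sub>R X + h *\<^sub>R Y) - f (z + h *\<^sub>R X) - f (z + h *\<^sub>R Y) + f z
     = h\<^sup>2 * frechet_derivative (\<lambda>x. frechet_derivative f (at x) X) (at P) Y"
proof -
  have near: "dist z (z + u *\<^sub>R X + v *\<^sub>R Y) \<le> 2 * h" if "0 \<le> u" "u \<le> h" "0 \<le> v" "v \<le> h" for u v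
  proof -
    have "norm (u *\<^sub>R X + v *\<^sub>R Y) \<le> norm (u *\<^sub>R X) + norm (v *\<^sub>R Y)" by (rule norm_triangle_ineq)
    also have "\<dots> \<le> 2 * h" using that X Y by simp
    finally have "norm (u *\<^sub>R X + v *\<^sub>R Y) \<le> 2 * h" .
    then show ?thesis unfolding dist_norm
      by (subst norm_minus_commute) (simp only: add.assoc add_diff_cancel_left')
  qed
  have near': "z + u *\<^sub>R X + v *\<^sub>R Y \<in> ball z r" if "0 \<le> u" "u \<le> h" "0 \<le> v" "v \<le> h" for u v
    using near[OF that] h by simp
  have line: "((\<lambda>t. g (b + t *\<^sub>R Z)) has_real_derivative frechet_derivative g (at (b + t *\<^sub>R Z)) Z) (at t)"
    if "g differentiable (at (b + t *\<^sub>R Z))" for g :: "complex \<Rightarrow> real" and b Z t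
  proof -
    have g: "(g has_derivative frechet_derivative g (at (b + t *\<^sub>R Z))) (at (b + t *\<^sub>R Z))"
      using that by (simp add: frechet_derivative_works)
    have "((\<lambda>t. b + t *\<^sub>R Z) has_derivative (\<lambda>s. s *\<^sub>R Z)) (at t)"
      by (auto intro!: derivative_eq_intros)
    from has_derivative_compose[OF this g]
    show ?thesis
      using has_derivative_linear[OF g] by (simp add: has_field_derivative_def linear_cmul mult_commute_abs)
  qed
  define g where "g u = f (z + u *\<^sub>R X + h *\<^sub>R Y) - f (z + u *\<^sub>R X)" for u
  define fX where "fX = (\<lambda>x. frechet_derivative f (at x) X)"
  have g': "(g has_real_derivative fX (z + u *\<^sub>R X + h *\<^sub>R Y) - fX (z + u *\<^sub>R X)) (at u)"
    if u: "0 \<le> u" "u \<le> h" for u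
  proof -
    have 1: "f differentiable (at (z + u *\<^sub>R X + h *\<^sub>R Y))" "f differentiable (at (z + u *\<^sub>R X))"
      using f[OF near'[of u h]] f[OF near'[of u 0]] u h by auto
    show ?thesis
      unfolding g_def fX_def
      using DERIV_diff[OF line[of f "z + h *\<^sub>R Y" u X] line[of f z u X]] 1
      by (simp add: algebra_simps)
  qed
  \<comment> \<open>The mean value theorem in the direction \<open>X\<close> is applied to the
    increment \<open>g\<close> along \<open>Y\<close>; a second application, along \<open>Y\<close>,
    treats the resulting difference of \<open>X\<close>-derivatives.\<close>
  obtain \<xi> where \<xi>: "0 < \<xi>" "\<xi> < h" "g h - g 0 = (h - 0) * (fX (z + \<xi> *\<^sub>R X + h *\<^sub>R Y) - fX (z + \<xi> *\<^sub>R X))"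
    using MVT2[OF h(1) g'] by blast
  have "((\<lambda>v. fX (z + \<xi> *\<^sub>R X + v *\<^sub>R Y)) has_real_derivative
      frechet_derivative fX (at (z + \<xi> *\<^sub>R X + v *\<^sub>R Y)) Y) (at v)" if "0 \<le> v" "v \<le> h" for v
    using line[of fX "z + \<xi> *\<^sub>R X" v Y] fX[OF near'[of \<xi> v]] that \<xi> by (simp add: fX_def)
  from MVT2[OF h(1) this]
  obtain \<eta> where \<eta>: "0 < \<eta>" "\<eta> < h" "fX (z + \<xi> *\<^sub>R X + h *\<^sub>R Y) - fX (z + \<xi> *\<^sub>R X)
      = h * frechet_derivative fX (at (z + \<xi> *\<^sub>R X + \<eta> *\<^sub>R Y)) Y"
    by auto
  show ?thesis
  proof
    show "z + \<xi> *\<^sub>R X + \<eta> *\<^sub>R Y \<in> cball z (2 * h)" using near[of \<xi> \<eta>] \<xi> \<eta> by simp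
    show "f (z + h *\<^sub>R X + h *\<^sub>R Y) - f (z + h *\<^sub>R X) - f (z + h *\<^sub>R Y) + f z
      = h\<^sup>2 * frechet_derivative (\<lambda>x. frechet_derivative f (at x) X) (at (z + \<xi> *\<^sub>R X + \<eta> *\<^sub>R Y)) Y"
      using \<xi>(3) \<eta>(3) unfolding g_def fX_def by (simp add: power2_eq_square algebra_simps)
  qed
qed

text \<open>The second difference is symmetric in \<open>X\<close> and \<open>Y\<close>, so it
  equals h^2 times either mixed derivative, at two possibly different points near \<open>z\<close>.
  Continuity of both mixed derivatives excludes distinct values at \<open>z\<close>.\<close>

lemma symmetric_second_derivative_real:
  fixes f :: "complex \<Rightarrow> real"
  assumes U: "open U" "z \<in> U" and f: "smooth_on f U" and X: "norm X = 1" and Y: "norm Y = 1"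
  shows "frechet_derivative (\<lambda>x. frechet_derivative f (at x) X) (at z) Y =
    frechet_derivative (\<lambda>x. frechet_derivative f (at x) Y) (at z) X"
proof (rule ccontr)
  define A where "A = (\<lambda>p. frechet_derivative (\<lambda>x. frechet_derivative f (at x) X) (at p) Y)"
  define B where "B = (\<lambda>p. frechet_derivative (\<lambda>x. frechet_derivative f (at x) Y) (at p) X)"
  assume "\<not> ?thesis"
  then have "0 < dist (A z) (B z) / 2" by (simp add: A_def B_def)
  moreover have "isCont A z" "isCont B z"
    unfolding A_def B_def
    by (rule differentiable_imp_continuous_within,
        intro smooth_on_differentiable[OF _ U] smooth_on_deriv f)+
  ultimately obtain d1 d2 where d: "d1 > 0" "d2 > 0"
    "\<And>x. dist x z < d1 \<Longrightarrow> dist (A x) (A z) < dist (A z) (B z) / 2"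
    "\<And>x. dist x z < d2 \<Longrightarrow> dist (B x) (B z) < dist (A z) (B z) / 2"
    unfolding continuous_at_eps_delta by (metis (no_types, lifting))
  obtain r where r: "r > 0" "ball z r \<subseteq> U" using U open_contains_ball by blast
  \<comment> \<open>The intermediate points lie within 2 h of \<open>z\<close>, so 2 h has to stay
    below all three radii.\<close>
  define h where "h = min r (min d1 d2) / 4"
  have h: "0 < h" "2 * h < r" "2 * h < d1" "2 * h < d2" using r d by (auto simp: h_def)
  have "\<exists>P \<in> cball z (2 * h). f (z + h *\<^sub>R X + h *\<^sub>R Y) - f (z + h *\<^sub>R X) - f (z + h *\<^sub>R Y) + f z = h\<^sup>2 * A P"
    unfolding A_def using r
    by (intro second_difference[of z r] h X Y smooth_on_differentiable[OF _ U(1)] smooth_on_deriv f) auto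
  moreover have "\<exists>P \<in> cball z (2 * h). f (z + h *\<^sub>R Y + h *\<^sub>R X) - f (z + h *\<^sub>R Y) - f (z + h *\<^sub>R X) + f z = h\<^sup>2 * B P"
    unfolding B_def using r
    by (intro second_difference[of z r] h X Y smooth_on_differentiable[OF _ U(1)] smooth_on_deriv f) auto
  ultimately obtain P Q where PQ: "P \<in> cball z (2 * h)" "Q \<in> cball z (2 * h)" "h\<^sup>2 * A P = h\<^sup>2 * B Q"
    by (auto simp: algebra_simps)
  then have "A P = B Q" using h by simp
  moreover have "dist (A P) (A z) < dist (A z) (B z) / 2" "dist (B Q) (B z) < dist (A z) (B z) / 2"
    using d(3)[of P] d(4)[of Q] PQ h by (simp_all add: dist_commute)
  ultimately show False
    using dist_triangle_half_l by (metis dist_commute less_irrefl)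
qed

lemma symmetric_second_derivative:
  fixes f :: "complex \<Rightarrow> 'v::euclidean_space"
  assumes U: "open U" "z \<in> U" and f: "smooth_on f U" and X: "norm X = 1" and Y: "norm Y = 1"
  shows "frechet_derivative (\<lambda>x. frechet_derivative f (at x) X) (at z) Y =
    frechet_derivative (\<lambda>x. frechet_derivative f (at x) Y) (at z) X"
proof (rule euclidean_eqI)
  fix b :: 'v assume "b \<in> Basis"
  let ?h = "\<lambda>v. v \<bullet> b"
  have bl: "bounded_linear ?h" by (rule bounded_linear_inner_left)
  have d: "frechet_derivative (\<lambda>x. ?h (g x)) (at x) = (\<lambda>X. ?h (frechet_derivative g (at x) X))"
    if "smooth_on g U" "x \<in> U" for g x
    using frechet_derivative_at[OF bounded_linear.has_derivative[OF bl]]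
      smooth_on_differentiable[OF that(1) U(1) that(2)] unfolding frechet_derivative_works by metis
  have dd: "frechet_derivative (\<lambda>x. frechet_derivative (\<lambda>x. ?h (f x)) (at x) W) (at z) =
      (\<lambda>V. ?h (frechet_derivative (\<lambda>x. frechet_derivative f (at x) W) (at z) V))" for W
  proof -
    have "((\<lambda>x. ?h (frechet_derivative f (at x) W)) has_derivative
        (\<lambda>V. ?h (frechet_derivative (\<lambda>x. frechet_derivative f (at x) W) (at z) V))) (at z)"
      using smooth_on_differentiable[OF smooth_on_deriv[OF f] U]
      by (intro bounded_linear.has_derivative[OF bl]) (simp add: frechet_derivative_works)
    then have "((\<lambda>x. frechet_derivative (\<lambda>x. ?h (f x)) (at x) W) has_derivative
        (\<lambda>V. ?h (frechet_derivative (\<lambda>x. frechet_derivative f (at x) W) (at z) V))) (at z)"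
      by (rule has_derivative_transform_within_open[OF _ U]) (simp add: d[OF f])
    then show ?thesis using frechet_derivative_at by metis
  qed
  have "smooth_on (\<lambda>x. ?h (f x)) U"
    using f Ck_on_bounded_linear[OF U(1) bl] by (auto simp: smooth_on_def)
  from symmetric_second_derivative_real[OF U this X Y]
  show "?h (frechet_derivative (\<lambda>x. frechet_derivative f (at x) X) (at z) Y) =
    ?h (frechet_derivative (\<lambda>x. frechet_derivative f (at x) Y) (at z) X)"
    unfolding dd by simp
qed

section \<open>Complexified directional derivatives in a chart of the surface\<close>

definition pdw :: "complex \<times> complex \<Rightarrow> 'm chart \<Rightarrow> ('m \<Rightarrow> 'n::finite cvec) \<Rightarrow> 'm \<Rightarrow> 'n cvec" where
  "pdw w c f p = fst w *s pd c 1 f p + snd w *s pd c \<i> f p"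

text \<open>Smoothness near one point in one fixed chart: weaker than \<open>smooth_map\<close>, but
  closed under \<open>pd\<close> in that chart, so that derivatives of sections can be
  differentiated again.\<close>

definition smooth_near :: "'m chart \<Rightarrow> 'm \<Rightarrow> ('m \<Rightarrow> 'v::real_normed_vector) \<Rightarrow> bool" where
  "smooth_near c p f \<longleftrightarrow>
     (\<exists>V. open V \<and> snd c p \<in> V \<and> V \<subseteq> snd c ` cdom c \<and> smooth_on (in_chart c f) V)"

abbreviation dz :: "complex \<times> complex" where "dz \<equiv> (1/2, - (\<i>/2))"
abbreviation dzbar :: "complex \<times> complex" where "dzbar \<equiv> (1/2, \<i>/2)"

lemma pdz_eq_pdw: "pdz = pdw dz"
  by (intro ext) (simp add: pdz_def pdw_def vec_eq_iff algebra_simps)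

lemma pdzbar_eq_pdw: "pdzbar = pdw dzbar"
  by (intro ext) (simp add: pdzbar_def pdw_def vec_eq_iff algebra_simps)

lemma in_chart_apply: "is_chart c \<Longrightarrow> p \<in> cdom c \<Longrightarrow> in_chart c f (snd c p) = f p"
  by (simp add: in_chart_def is_chart_def inv_into_f_f)

lemma open_chart_image:
  assumes "is_chart c" "open U" shows "open (snd c ` (U \<inter> cdom c))"
proof -
  have "snd c ` (U \<inter> cdom c) = (snd c ` cdom c) \<inter> inv_into (cdom c) (snd c) -` U"
    using assms(1) by (auto simp: is_chart_def inv_into_f_f)
  then show ?thesis using assms
    by (metis continuous_on_open_vimage is_chart_def Int_commute)
qed

lemma eventually_in_chart:
  assumes "is_chart c" "p \<in> cdom c" "open U" "p \<in> U" "\<And>x. x \<in> U \<Longrightarrow> x \<in> cdom c \<Longrightarrow> P x"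
  shows "eventually (in_chart c P) (nhds (snd c p))"
proof -
  have "eventually (\<lambda>x. x \<in> snd c ` (U \<inter> cdom c)) (nhds (snd c p))"
    using open_chart_image[OF assms(1,3)] assms by (intro eventually_nhds_in_open) auto
  then show ?thesis
    by (rule eventually_mono) (use assms in \<open>auto simp: in_chart_apply\<close>)
qed

lemma pd_vdirder:
  assumes "is_chart c" "p \<in> cdom c" "smooth_near c p f"
  shows "vdirder w (in_chart c f) (pdw w c f p) (snd c p)"
proof -
  have D: "(in_chart c f has_derivative (\<lambda>X. pd c X f p)) (at (snd c p))"
    using assms(3) smooth_on_differentiable
    unfolding smooth_near_def pd_def by (metis frechet_derivative_works eta_contract_eq)
  have "((\<lambda>x. in_chart c f x $ i) has_derivative (\<lambda>X. pd c X f p $ i)) (at (snd c p))" for i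
    by (rule bounded_linear.has_derivative[OF bounded_linear_vec_nth D])
  then show ?thesis unfolding vdirder_def dirder_def pdw_def by fastforce
qed

lemma smooth_near_pd:
  assumes c: "is_chart c" and f: "smooth_near c p f"
  shows "smooth_near c p (pd c X f)"
proof -
  obtain V where V: "open V" "snd c p \<in> V" "V \<subseteq> snd c ` cdom c" "smooth_on (in_chart c f) V"
    using f unfolding smooth_near_def by blast
  have "in_chart c (pd c X f) x = frechet_derivative (in_chart c f) (at x) X" if xV: "x \<in> V" for x
  proof -
    obtain y where "x = snd c y" "y \<in> cdom c" using V(3) xV by blast
    then show ?thesis by (simp add: in_chart_apply[OF c] pd_def)
  qed
  note Ck_on_cong[OF V(1) this]
  then have "smooth_on (in_chart c (pd c X f)) V"
    using smooth_on_deriv[OF V(4), of X] unfolding smooth_on_def by simp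
  then show ?thesis using V unfolding smooth_near_def by blast
qed

lemma smooth_near_add:
  assumes "smooth_near c p f" "smooth_near c p g"
  shows "smooth_near c p (\<lambda>x. f x + g x)"
proof -
  obtain V W where V: "open V" "snd c p \<in> V" "V \<subseteq> snd c ` cdom c" "smooth_on (in_chart c f) V"
    and W: "open W" "snd c p \<in> W" "W \<subseteq> snd c ` cdom c" "smooth_on (in_chart c g) W"
    using assms unfolding smooth_near_def by blast
  have "smooth_on (in_chart c (\<lambda>x. f x + g x)) (V \<inter> W)"
    using V W unfolding smooth_on_def in_chart_def
    by (intro allI Ck_on_add) (auto intro: Ck_on_subset)
  then show ?thesis unfolding smooth_near_def using V W by (intro exI[of _ "V \<inter> W"]) auto
qed

lemma smooth_near_bounded_linear:
  assumes "bounded_linear h" "smooth_near c p f" shows "smooth_near c p (\<lambda>x. h (f x))"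
proof -
  obtain V where V: "open V" "snd c p \<in> V" "V \<subseteq> snd c ` cdom c" "smooth_on (in_chart c f) V"
    using assms unfolding smooth_near_def by blast
  then have "smooth_on (in_chart c (\<lambda>x. h (f x))) V"
    using Ck_on_bounded_linear[OF V(1) assms(1)] unfolding smooth_on_def in_chart_def by auto
  then show ?thesis unfolding smooth_near_def using V by blast
qed

lemma bounded_linear_smult: "bounded_linear (\<lambda>v::'n::finite cvec. k *s v)"
  by (rule linear_conv_bounded_linear[THEN iffD1], rule linearI) (auto simp: vec_eq_iff algebra_simps)

lemma smooth_near_pdw: "is_chart c \<Longrightarrow> smooth_near c p f \<Longrightarrow> smooth_near c p (pdw w c f)"
  unfolding pdw_def[abs_def]
  by (intro smooth_near_add smooth_near_bounded_linear[OF bounded_linear_smult] smooth_near_pd)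

lemma pd_commute:
  fixes f :: "'m::topological_space \<Rightarrow> 'v::euclidean_space"
  assumes c: "is_chart c" and f: "smooth_near c p f"
  shows "pd c 1 (pd c \<i> f) p = pd c \<i> (pd c 1 f) p"
proof -
  obtain V where V: "open V" "snd c p \<in> V" "V \<subseteq> snd c ` cdom c" "smooth_on (in_chart c f) V"
    using f unfolding smooth_near_def by blast
  have eq: "in_chart c (pd c X f) x = frechet_derivative (in_chart c f) (at x) X" if xV: "x \<in> V" for x X
  proof -
    obtain y where "x = snd c y" "y \<in> cdom c" using V(3) xV by blast
    then show ?thesis by (simp add: in_chart_apply[OF c] pd_def)
  qed
  have "pd c Y (pd c X f) p = frechet_derivative (\<lambda>x. frechet_derivative (in_chart c f) (at x) X) (at (snd c p)) Y" for X Y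
  proof -
    have "(g has_derivative D) (at (snd c p)) \<longleftrightarrow> (h has_derivative D) (at (snd c p))"
      if "\<And>x. x \<in> V \<Longrightarrow> g x = h x" for g h :: "complex \<Rightarrow> 'v" and D
      using has_derivative_transform_within_open[OF _ V(1,2), of g D UNIV h]
        has_derivative_transform_within_open[OF _ V(1,2), of h D UNIV g] that by auto
    from this[OF eq] show ?thesis by (simp add: pd_def[of c Y] frechet_derivative_def[of "in_chart c (pd c X f)"] frechet_derivative_def[of "\<lambda>x. frechet_derivative (in_chart c f) (at x) X"])
  qed
  then show ?thesis using symmetric_second_derivative[OF V(1,2,4), of 1 \<i>] by simp
qed

lemma smooth_map_near:
  assumes "smooth_map A U f" "c \<in> A" "is_chart c" "open U" "p \<in> U" "p \<in> cdom c"
  shows "smooth_near c p f"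
  unfolding smooth_near_def using assms open_chart_image[OF assms(3,4)]
  by (intro exI[of _ "snd c ` (U \<inter> cdom c)"]) (auto simp: smooth_map_def)

section \<open>The frame of a surface\<close>

lemma vcnj_nth [simp]: "vcnj v $ i = cnj (v $ i)"
  by (simp add: vcnj_def)

lemma vcnj_add: "vcnj (v + w) = vcnj v + vcnj w"
  by (simp add: vec_eq_iff)

lemma vcnj_smult: "vcnj (k *s v) = cnj k *s vcnj v"
  by (simp add: vec_eq_iff)

lemma mform_vcnj: "mform (vcnj v) (vcnj w) = cnj (mform v w)"
  by (simp add: mform_def if_distrib[of cnj] cong: if_cong)

lemma real_vecD: "real_vec v \<Longrightarrow> vcnj v = v"
  by (simp add: real_vec_def)

lemma real_vec_nth: "real_vec v \<Longrightarrow> v $ i \<in> \<real>"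
  by (metis Reals_cnj_iff real_vec_def vcnj_nth)

text \<open>On real vectors without timelike component the form is a sum of squares.\<close>

lemma real_null_vec_eq_0:
  assumes "real_vec v" "mform v v = 0" "v $ None = 0"
  shows "v = 0"
proof -
  have "(\<Sum>i\<in>UNIV. (Re (v $ i))\<^sup>2) = 0"
  proof -
    have "(Re (v $ i))\<^sup>2 = Re ((if i = None then - 1 else 1) * v $ i * v $ i)" for i
      using real_vec_nth[OF assms(1), of i] assms(3) by (auto elim!: Reals_cases simp: power2_eq_square)
    then have "(\<Sum>i\<in>UNIV. (Re (v $ i))\<^sup>2) = Re (mform v v)"
      unfolding mform_def Re_sum by (rule sum.cong[OF refl])
    then show ?thesis using assms(2) by simp
  qed
  then have "Re (v $ i) = 0" for i
    by (subst (asm) sum_nonneg_eq_0_iff) auto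
  then show ?thesis
    using real_vec_nth[OF assms(1)] by (auto simp: vec_eq_iff complex_eq_iff complex_is_Real_iff)
qed

text \<open>In Lorentzian signature orthogonal real null vectors are proportional: the combination
  \<open>u\<close> without timelike component is still real and null, hence zero.\<close>

lemma real_null_orthogonal_in_span:
  assumes "real_vec s" "s \<noteq> 0" "mform s s = 0" "real_vec v" "mform v v = 0" "mform v s = 0"
  shows "v \<in> vec.span {s}"
proof -
  have s0: "s $ None \<noteq> 0" using real_null_vec_eq_0 assms by blast
  define u where "u = s $ None *s v - v $ None *s s"
  have "u = 0"
  proof (rule real_null_vec_eq_0)
    have "cnj (s $ None) = s $ None" "cnj (v $ None) = v $ None"
      using real_vec_nth assms Reals_cnj_iff by blast+
    then show "real_vec u" using assms real_vecD[OF assms(1)] real_vecD[OF assms(4)]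
      by (simp add: real_vec_def u_def vec_eq_iff)
    show "mform u u = 0" using assms mform_commute[of s v] by (simp add: u_def mform_linear)
    show "u $ None = 0" by (simp add: u_def)
  qed
  then have "v = (v $ None / s $ None) *s s"
    using s0 by (auto simp: u_def vec_eq_iff field_simps)
  then show ?thesis by (metis vec.span_base vec.span_scale singletonI)
qed

text \<open>\<open>dirder\<close> asserts a full derivative of each component and not just a
  directional limit, so the components assemble into the derivative of the vector-valued map that
  \<open>pd\<close> refers to.\<close>

lemma vdirder_pd:
  assumes "vdirder (complex_of_real (Re X), complex_of_real (Im X)) (in_chart c f) v (snd c p)"
  shows "pd c X f p = (v :: 'n::finite cvec)"
proof -
  let ?z = "snd c p"
  have "\<forall>i. \<exists>D. ((\<lambda>x. in_chart c f x $ i) has_derivative D) (at ?z) \<and> v $ i = D X"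
  proof
    fix i
    obtain D where D: "((\<lambda>x. in_chart c f x $ i) has_derivative D) (at ?z)"
      "v $ i = of_real (Re X) * D 1 + of_real (Im X) * D \<i>"
      using assms unfolding vdirder_def dirder_def by (metis fst_conv snd_conv)
    have l: "linear D" using D(1) has_derivative_linear by blast
    have "D X = D (Re X *\<^sub>R 1 + Im X *\<^sub>R \<i>)"
      by (rule arg_cong[of _ _ D]) (simp add: complex_eq_iff)
    also have "\<dots> = v $ i"
      using D(2) by (simp only: linear_add[OF l] linear_scale[OF l]) (simp add: scaleR_conv_of_real)
    finally show "\<exists>D. ((\<lambda>x. in_chart c f x $ i) has_derivative D) (at ?z) \<and> v $ i = D X"
      using D(1) by metis
  qed
  then obtain D where D: "\<And>i. ((\<lambda>x. in_chart c f x $ i) has_derivative D i) (at ?z)" "\<And>i. v $ i = D i X"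
    by metis
  have bl: "bounded_linear (\<lambda>a. axis i a :: 'n cvec)" for i
    by (rule linear_conv_bounded_linear[THEN iffD1], rule linearI) (auto simp: vec_eq_iff axis_def)
  have "((\<lambda>x. \<Sum>i\<in>UNIV. axis i (in_chart c f x $ i)) has_derivative (\<lambda>h. \<Sum>i\<in>UNIV. axis i (D i h))) (at ?z)"
    by (intro has_derivative_sum bounded_linear.has_derivative[OF bl] D)
  moreover have "(\<Sum>i\<in>UNIV. axis i (u i)) = (\<chi> i. u i)" for u :: "'n option option \<Rightarrow> complex"
    by (simp add: vec_eq_iff axis_def)
  ultimately have "(in_chart c f has_derivative (\<lambda>h. \<chi> i. D i h)) (at ?z)" by simp
  from frechet_derivative_at[OF this] have "pd c X f p = (\<chi> i. D i X)"
    unfolding pd_def by metis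
  then show ?thesis using D(2) by (simp add: vec_eq_iff)
qed

lemma pdw_eqI:
  assumes "\<And>w. vdirder w (in_chart c f) (fst w *s a + snd w *s b) (snd c p)"
  shows "pdw w c f p = fst w *s a + snd w *s b"
proof -
  have "pd c 1 f p = a" "pd c \<i> f p = b"
    using vdirder_pd[of 1 c f a p] vdirder_pd[of \<i> c f b p] assms[of "(1,0)"] assms[of "(0,1)"]
    by (auto simp: vec_eq_iff)
  then show ?thesis by (simp add: pdw_def)
qed

lemma is_chart_in: "oriented_surface A \<Longrightarrow> c \<in> A \<Longrightarrow> is_chart c"
  by (simp add: oriented_surface_def)

lemma in_chart_eventually_eq:
  assumes "is_chart c" "p \<in> cdom c" "open U" "p \<in> U" "\<And>x. x \<in> U \<Longrightarrow> x \<in> cdom c \<Longrightarrow> f x = g x"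
  shows "eventually (\<lambda>x. in_chart c f x = in_chart c g x) (nhds (snd c p))"
  using eventually_in_chart[OF assms(1-4), of "\<lambda>x. f x = g x"] assms(5) by (simp add: in_chart_def)

lemma mform_deriv_zero:
  assumes c: "is_chart c" "p \<in> cdom c" and U: "open U" "p \<in> U"
    and f: "smooth_near c p f" and g: "smooth_near c p g"
    and 0: "\<And>x. x \<in> U \<Longrightarrow> x \<in> cdom c \<Longrightarrow> mform (f x) (g x) = 0"
  shows "mform (pdw w c f p) (g p) + mform (f p) (pdw w c g p) = 0"
proof -
  have "dirder w (\<lambda>x. mform (in_chart c f x) (in_chart c g x))
     (mform (pdw w c f p) (in_chart c g (snd c p)) + mform (in_chart c f (snd c p)) (pdw w c g p)) (snd c p)"
    by (intro dirder_mform pd_vdirder c f g)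
  moreover have "eventually (\<lambda>x. 0 = mform (in_chart c f x) (in_chart c g x)) (nhds (snd c p))"
    using in_chart_eventually_eq[OF c U, of "\<lambda>x. 0" "\<lambda>x. mform (f x) (g x)"] 0 by (simp add: in_chart_def)
  from dirder_cong[OF this dirder_const]
  have "dirder w (\<lambda>x. mform (in_chart c f x) (in_chart c g x)) 0 (snd c p)" .
  ultimately show ?thesis using dirder_unique by (fastforce simp: in_chart_apply[OF c])
qed

lemma vcnj_pdw:
  assumes c: "is_chart c" "p \<in> cdom c" and U: "open U" "p \<in> U"
    and f: "smooth_near c p f" and g: "smooth_near c p g"
    and eq: "\<And>x. x \<in> U \<Longrightarrow> x \<in> cdom c \<Longrightarrow> vcnj (f x) = g x"
  shows "vcnj (pdw w c f p) = pdw (cnj (fst w), cnj (snd w)) c g p"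
proof -
  have "vdirder (cnj (fst w), cnj (snd w)) (\<lambda>x. vcnj (in_chart c f x)) (vcnj (pdw w c f p)) (snd c p)"
    by (intro vdirder_vcnj pd_vdirder c f)
  moreover have "eventually (\<lambda>x. vcnj (in_chart c f x) = in_chart c g x) (nhds (snd c p))"
    using in_chart_eventually_eq[OF c U, of "\<lambda>x. vcnj (f x)" g] eq by (simp add: in_chart_def)
  ultimately have "vdirder (cnj (fst w), cnj (snd w)) (in_chart c g) (vcnj (pdw w c f p)) (snd c p)"
    by (rule vdirder_cong[rotated])
  then show ?thesis using vdirder_unique pd_vdirder[OF c g] by blast
qed

section \<open>The local frame \<open>\<sigma>\<close>, \<open>Z\<close>, \<open>B\<close>,
  \<open>T\<close> of an immersed surface\<close>

locale surf =
  fixes A :: "'m::{t2_space, second_countable_topology} chart set"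
    and \<Lambda> :: "'m \<Rightarrow> 'n::finite cvec set"
  assumes A: "oriented_surface A" and imm: "immerses A \<Lambda>"
begin

lemma local_real_section_exists: "\<exists>\<sigma>. local_real_section A \<Lambda> p \<sigma>"
proof -
  obtain U \<sigma> where "open U" "p \<in> U" "smooth_map A U \<sigma>"
    "\<forall>x\<in>U. real_vec (\<sigma> x) \<and> \<sigma> x \<noteq> 0 \<and> mform (\<sigma> x) (\<sigma> x) = 0 \<and> \<Lambda> x = vec.span {\<sigma> x}"
    using imm unfolding immerses_def real_null_line_bundle_def by blast
  then show ?thesis unfolding local_real_section_def
    by (intro exI[of _ \<sigma>] exI[of _ U]) (auto simp: vec.span_base)
qed

lemma line_fibre:
  assumes "v \<in> \<Lambda> x" "v \<noteq> 0"
  shows "mform v v = 0" "\<Lambda> x = vec.span {v}"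
proof -
  obtain s where s: "mform s s = 0" "\<Lambda> x = vec.span {s}"
    using imm unfolding immerses_def real_null_line_bundle_def by blast
  obtain k where k: "v = k *s s" using assms(1) unfolding s(2) vec.span_singleton by auto
  then have "k \<noteq> 0" using assms(2) by auto
  then have "s = (1/k) *s v" using k by (simp add: vec_eq_iff)
  then have sv: "s \<in> vec.span {v}" by (metis vec.span_base vec.span_scale singletonI)
  have "v \<in> vec.span {s}" using assms(1) s(2) by simp
  then have "vec.span {v} = vec.span {s}" using sv by (simp add: vec.span_eq)
  then show "\<Lambda> x = vec.span {v}" by (simp add: s(2))
  show "mform v v = 0" unfolding k by (simp add: mform_linear s(1))
qed

end

locale surf_frame = surf A \<Lambda>
  for A :: "'m::{t2_space, second_countable_topology} chart set" and \<Lambda> :: "'m \<Rightarrow> 'n::finite cvec set" +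
  fixes c :: "'m chart" and U :: "'m set" and \<sigma> :: "'m \<Rightarrow> 'n cvec"
  assumes hol: "holomorphic_chart A \<Lambda> c" and U: "open U" and smooth: "smooth_map A U \<sigma>"
    and sec: "\<And>x. x \<in> U \<Longrightarrow> \<sigma> x \<in> \<Lambda> x \<and> \<sigma> x \<noteq> 0 \<and> real_vec (\<sigma> x)"
begin

lemma cA: "c \<in> A" using hol by (simp add: holomorphic_chart_def)

lemma c: "is_chart c" using A cA by (rule is_chart_in)

abbreviation "chart_dom \<equiv> U \<inter> cdom c"
abbreviation "Z \<equiv> pdz c \<sigma>"
abbreviation "B \<equiv> pdzbar c \<sigma>"
abbreviation "T \<equiv> pdz c (pdzbar c \<sigma>)"
abbreviation "h x \<equiv> mform (Z x) (B x)"

lemma section_at: "x \<in> U \<Longrightarrow> local_real_section A \<Lambda> x \<sigma>"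
  unfolding local_real_section_def using U smooth sec by blast

lemma near: "x \<in> chart_dom \<Longrightarrow> smooth_near c x \<sigma>"
  by (rule smooth_map_near[OF smooth cA c U]) auto

lemma near': "x \<in> chart_dom \<Longrightarrow> smooth_near c x (pdw w c \<sigma>)"
  by (intro smooth_near_pdw c near)

lemma near'': "x \<in> chart_dom \<Longrightarrow> smooth_near c x (pdw w' c (pdw w c \<sigma>))"
  by (intro smooth_near_pdw c near')

lemma null: "x \<in> U \<Longrightarrow> mform (\<sigma> x) (\<sigma> x) = 0"
  using line_fibre(1) sec by blast

lemma fibre: "x \<in> U \<Longrightarrow> \<Lambda> x = vec.span {\<sigma> x}"
  using line_fibre(2) sec by blast

lemma orth_deriv: "x \<in> chart_dom \<Longrightarrow> mform (\<sigma> x) (pdw w c \<sigma> x) = 0"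
  using mform_deriv_zero[OF c _ U, of x \<sigma> \<sigma> w] near null mform_commute[of "pdw w c \<sigma> x" "\<sigma> x"] by simp

lemma vcnj_pdw1: "x \<in> chart_dom \<Longrightarrow> vcnj (pdw w c \<sigma> x) = pdw (cnj (fst w), cnj (snd w)) c \<sigma> x"
  by (rule vcnj_pdw[OF c _ U]) (use near sec real_vecD in auto)

lemma pd_eq_pdw: "pd c 1 f x = pdw (1, 0) c f x" "pd c \<i> f x = pdw (0, 1) c f x"
  by (simp_all add: pdw_def)

lemma metric:
  assumes x: "x \<in> chart_dom"
  shows "mform (pd c \<i> \<sigma> x) (pd c \<i> \<sigma> x) = mform (pd c 1 \<sigma> x) (pd c 1 \<sigma> x)"
    and "mform (pd c 1 \<sigma> x) (pd c \<i> \<sigma> x) = 0"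
    and "mform (pd c 1 \<sigma> x) (pd c 1 \<sigma> x) \<noteq> 0"
proof -
  have g: "mform (pd c (\<i> * X) \<sigma> x) (pd c (\<i> * X) \<sigma> x) = mform (pd c X \<sigma> x) (pd c X \<sigma> x)" for X
    using hol x section_at unfolding holomorphic_chart_def induced_metric_def by blast
  have pd: "pd c X \<sigma> x = of_real (Re X) *s pd c 1 \<sigma> x + of_real (Im X) *s pd c \<i> \<sigma> x" for X
    by (rule vdirder_pd) (use pd_vdirder[OF c _ near[OF x]] x in \<open>auto simp: pdw_def dest: meta_spec\<close>)
  show 1: "mform (pd c \<i> \<sigma> x) (pd c \<i> \<sigma> x) = mform (pd c 1 \<sigma> x) (pd c 1 \<sigma> x)"
    using g[of 1] by simp
  \<comment> \<open>Polarisation: rotating 1 + \<i> gives -1 + \<i>, and the two squared lengths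
    differ by four times the mixed product.\<close>
  show "mform (pd c 1 \<sigma> x) (pd c \<i> \<sigma> x) = 0"
    using g[of "1 + \<i>"] 1 mform_commute[of "pd c \<i> \<sigma> x" "pd c 1 \<sigma> x"]
    by (simp add: pd[of "1 + \<i>"] pd[of "\<i> * (1 + \<i>)"] mform_linear)
  \<comment> \<open>A null derivative would be a real null vector orthogonal to \<sigma>, hence in
    \<Lambda>, against the immersion property.\<close>
  show "mform (pd c 1 \<sigma> x) (pd c 1 \<sigma> x) \<noteq> 0"
  proof
    assume "mform (pd c 1 \<sigma> x) (pd c 1 \<sigma> x) = 0"
    moreover have "real_vec (pd c 1 \<sigma> x)"
      using vcnj_pdw1[OF x, of "(1, 0)"] by (simp add: pd_eq_pdw real_vec_def)
    moreover have "mform (pd c 1 \<sigma> x) (\<sigma> x) = 0"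
      using orth_deriv[OF x, of "(1, 0)"] by (simp add: pd_eq_pdw mform_commute)
    ultimately have "pd c 1 \<sigma> x \<in> \<Lambda> x"
      using real_null_orthogonal_in_span[of "\<sigma> x" "pd c 1 \<sigma> x"] sec null fibre x by auto
    then show False using imm cA x section_at unfolding immerses_def by fastforce
  qed
qed

lemma h_eq: "x \<in> chart_dom \<Longrightarrow> h x = mform (pd c 1 \<sigma> x) (pd c 1 \<sigma> x) / 2"
  using metric(1,2)[of x] mform_commute[of "pd c \<i> \<sigma> x" "pd c 1 \<sigma> x"]
  by (simp add: pdz_def pdzbar_def mform_linear)

lemma h_nonzero: "x \<in> chart_dom \<Longrightarrow> h x \<noteq> 0"
  using h_eq[of x] metric(3)[of x] by auto

lemma T_eq: "x \<in> chart_dom \<Longrightarrow> T x = pdzbar c (pdz c \<sigma>) x"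
proof -
  assume x: "x \<in> chart_dom"
  have d: "pdw w c (pdw w' c \<sigma>) x = fst w *s (fst w' *s pd c 1 (pd c 1 \<sigma>) x + snd w' *s pd c 1 (pd c \<i> \<sigma>) x)
     + snd w *s (fst w' *s pd c \<i> (pd c 1 \<sigma>) x + snd w' *s pd c \<i> (pd c \<i> \<sigma>) x)" for w w'
  proof (rule pdw_eqI)
    fix v
    have "vdirder v (\<lambda>y. fst w' *s in_chart c (pd c 1 \<sigma>) y + snd w' *s in_chart c (pd c \<i> \<sigma>) y)
       (fst w' *s pdw v c (pd c 1 \<sigma>) x + snd w' *s pdw v c (pd c \<i> \<sigma>) x) (snd c x)"
      by (intro vdirder_add vdirder_csmult pd_vdirder c smooth_near_pd near) (use x in auto)
    then show "vdirder v (in_chart c (pdw w' c \<sigma>))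
      (fst v *s (fst w' *s pd c 1 (pd c 1 \<sigma>) x + snd w' *s pd c 1 (pd c \<i> \<sigma>) x)
     + snd v *s (fst w' *s pd c \<i> (pd c 1 \<sigma>) x + snd w' *s pd c \<i> (pd c \<i> \<sigma>) x)) (snd c x)"
      by (rule back_subst) (auto simp: vec_eq_iff pdw_def in_chart_def algebra_simps intro!: arg_cong2[of _ _ _ _ "\<lambda>a b. vdirder v a b _"])
  qed
  show ?thesis
    unfolding pdz_eq_pdw pdzbar_eq_pdw d using pd_commute[OF c near[OF x]]
    by (simp add: vec_eq_iff algebra_simps)
qed

text \<open>Conformality makes \<open>Z\<close> and \<open>B\<close> null; the products with
  \<open>T\<close> arise by differentiating (\<sigma>, B) = 0 and (B, B) = 0 along
  \<open>dz\<close>, and (Z, Z) = 0 along \<open>dzbar\<close>.\<close>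

lemma frame_products:
  assumes x: "x \<in> chart_dom"
  shows "mform (\<sigma> x) (Z x) = 0" "mform (\<sigma> x) (B x) = 0" "mform (Z x) (Z x) = 0" "mform (B x) (B x) = 0"
    "mform (\<sigma> x) (T x) = - h x" "mform (B x) (T x) = 0" "mform (Z x) (T x) = 0"
proof -
  have *: "mform (Z y) (Z y) = 0" "mform (B y) (B y) = 0" if "y \<in> chart_dom" for y
    using metric(1,2)[OF that] mform_commute[of "pd c \<i> \<sigma> y" "pd c 1 \<sigma> y"]
    by (simp_all add: pdz_def pdzbar_def mform_linear)
  show "mform (\<sigma> x) (Z x) = 0" "mform (\<sigma> x) (B x) = 0" "mform (Z x) (Z x) = 0" "mform (B x) (B x) = 0"
    using * x orth_deriv[OF x] by (auto simp: pdz_eq_pdw pdzbar_eq_pdw)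
  show "mform (\<sigma> x) (T x) = - h x"
    using mform_deriv_zero[OF c _ U _ near[OF x] near'[OF x], where w = dz] x orth_deriv
    by (auto simp: pdz_eq_pdw pdzbar_eq_pdw eq_neg_iff_add_eq_0 add.commute)
  show "mform (B x) (T x) = 0"
    using mform_deriv_zero[OF c _ U _ near'[OF x] near'[OF x], of dzbar dzbar dz] x *(2)
      mform_commute[of "B x" "T x"]
    by (auto simp: pdz_eq_pdw pdzbar_eq_pdw)
  show "mform (Z x) (T x) = 0"
    using mform_deriv_zero[OF c _ U _ near'[OF x] near'[OF x], of dz dz dzbar] x *(1)
      mform_commute[of "Z x" "T x"] T_eq[OF x]
    by (auto simp: pdz_eq_pdw pdzbar_eq_pdw)
qed

lemma vcnj_frame:
  assumes x: "x \<in> chart_dom"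
  shows "vcnj (\<sigma> x) = \<sigma> x" "vcnj (Z x) = B x" "vcnj (B x) = Z x" "vcnj (T x) = T x"
proof -
  show "vcnj (\<sigma> x) = \<sigma> x" using sec x real_vecD by blast
  have ZB: "vcnj (Z y) = B y" "vcnj (B y) = Z y" if "y \<in> chart_dom" for y
    using vcnj_pdw1[OF that] by (simp_all add: pdz_eq_pdw pdzbar_eq_pdw)
  show "vcnj (Z x) = B x" "vcnj (B x) = Z x" using ZB x by auto
  have "vcnj (pdw dz c B x) = pdw (cnj (fst dz), cnj (snd dz)) c Z x"
    by (rule vcnj_pdw[OF c _ U]) (use x ZB near' in \<open>auto simp: pdz_eq_pdw pdzbar_eq_pdw\<close>)
  then show "vcnj (T x) = T x"
    using T_eq[OF x] by (simp add: pdz_eq_pdw pdzbar_eq_pdw)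
qed

end

section \<open>Independence of chart and section\<close>

lemma dirder_eventually_ne:
  assumes "dirder w f f' z" "f z \<noteq> k" shows "eventually (\<lambda>x. f x \<noteq> k) (nhds z)"
proof -
  have "isCont f z" using assms(1) has_derivative_continuous unfolding dirder_def by blast
  then have "(f \<longlongrightarrow> f z) (nhds z)" by (simp add: isCont_def tendsto_at_iff_tendsto_nhds)
  then show ?thesis by (rule tendsto_imp_eventually_ne) (rule assms(2))
qed

lemma vdirder_component: "vdirder w f f' z \<Longrightarrow> dirder w (\<lambda>x. f x $ i) (f' $ i) z"
  by (simp add: vdirder_def)

lemma span_Union_eq:
  assumes "\<And>Y. Y \<in> \<Y> \<Longrightarrow> Y \<subseteq> vec.span X" "X \<in> \<Y>"
  shows "vec.span (\<Union>\<Y>) = vec.span (X :: 'n::finite cvec set)"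
proof (rule antisym)
  show "vec.span (\<Union>\<Y>) \<subseteq> vec.span X"
    by (rule vec.span_minimal) (use assms(1) in auto)
  show "vec.span X \<subseteq> vec.span (\<Union>\<Y>)"
    by (rule vec.span_mono) (use assms(2) in auto)
qed

context surf_frame
begin

lemma change_section:
  assumes p: "p \<in> chart_dom" and \<sigma>': "local_real_section A \<Lambda> p \<sigma>'"
  obtains f where "\<sigma>' p = f *s \<sigma> p" "\<And>w. \<exists>a. pdw w c \<sigma>' p = a *s \<sigma> p + f *s pdw w c \<sigma> p"
    "\<And>w w'. \<exists>a b d. pdw w' c (pdw w c \<sigma>') p =
       a *s \<sigma> p + b *s pdw w' c \<sigma> p + d *s pdw w c \<sigma> p + f *s pdw w' c (pdw w c \<sigma>) p"
proof -
  obtain U' where U': "open U'" "p \<in> U'" "smooth_map A U' \<sigma>'"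
    "\<And>x. x \<in> U' \<Longrightarrow> \<sigma>' x \<in> \<Lambda> x \<and> \<sigma>' x \<noteq> 0 \<and> real_vec (\<sigma>' x)"
    using \<sigma>' unfolding local_real_section_def by blast
  interpret F: surf_frame A \<Lambda> c U' \<sigma>'
    by unfold_locales (use hol U' in auto)
  \<comment> \<open>A coordinate that does not vanish at \<open>p\<close> turns the factor between
    the two sections into an explicit quotient.\<close>
  obtain i where i: "\<sigma> p $ i \<noteq> 0" using sec p by (auto simp: vec_eq_iff)
  define f where "f x = \<sigma>' x $ i * (1 / \<sigma> x $ i)" for x
  \<comment> \<open>The quotient rule, with the squared denominator written as a product of
    reciprocals so that the rules for products and reciprocals apply once more.\<close>
  define f1 where "f1 w x = pdw w c \<sigma>' x $ i * (1 / \<sigma> x $ i)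
      + \<sigma>' x $ i * (- (pdw w c \<sigma> x $ i) * ((1 / \<sigma> x $ i) * (1 / \<sigma> x $ i)))" for w x
  have propor: "\<sigma>' x = f x *s \<sigma> x" if "x \<in> U \<inter> U'" "\<sigma> x $ i \<noteq> 0" for x
  proof -
    have "\<sigma>' x \<in> vec.span {\<sigma> x}" using U'(4)[of x] fibre[of x] that by auto
    then obtain k where "\<sigma>' x = k *s \<sigma> x" by (auto simp: vec.span_singleton)
    then show ?thesis using that by (simp add: f_def)
  qed
  have near_dm: "eventually (\<lambda>x. in_chart c (\<lambda>x. x \<in> U \<inter> U' \<and> x \<in> cdom c) x) (nhds (snd c y))"
    if "y \<in> chart_dom \<inter> U'" for y
    by (rule eventually_in_chart[OF c _ open_Int[OF U U'(1)]]) (use that in auto)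
  have ne: "eventually (\<lambda>x. in_chart c (\<lambda>x. \<sigma> x $ i \<noteq> 0) x) (nhds (snd c y))"
    if "y \<in> chart_dom" "\<sigma> y $ i \<noteq> 0" for y
    using dirder_eventually_ne[OF vdirder_component[OF pd_vdirder[OF c _ near[OF that(1)]], where i = i], where k = 0] that
    by (simp add: in_chart_apply[OF c]) (simp add: in_chart_def)
  have df: "dirder w (in_chart c f) (f1 w y) (snd c y)" if y: "y \<in> chart_dom \<inter> U'" "\<sigma> y $ i \<noteq> 0" for y w
  proof -
    have "dirder w (\<lambda>x. in_chart c \<sigma>' x $ i * (1 / in_chart c \<sigma> x $ i))
      (pdw w c \<sigma>' y $ i * (1 / in_chart c \<sigma> (snd c y) $ i)
        + in_chart c \<sigma>' (snd c y) $ i * (- (pdw w c \<sigma> y $ i) / (in_chart c \<sigma> (snd c y) $ i)\<^sup>2)) (snd c y)"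
      by (intro dirder_mult dirder_inverse vdirder_component pd_vdirder c near F.near)
        (use y in \<open>auto simp: in_chart_apply[OF c]\<close>)
    moreover have "in_chart c f = (\<lambda>x. in_chart c \<sigma>' x $ i * (1 / in_chart c \<sigma> x $ i))"
      by (simp add: in_chart_def f_def fun_eq_iff)
    ultimately show ?thesis using y by (simp add: in_chart_apply[OF c] f1_def power2_eq_square)
  qed
  have step1: "pdw w c \<sigma>' y = f1 w y *s \<sigma> y + f y *s pdw w c \<sigma> y"
    if y: "y \<in> chart_dom \<inter> U'" "\<sigma> y $ i \<noteq> 0" for y w
  proof -
    have "vdirder w (\<lambda>x. in_chart c f x *s in_chart c \<sigma> x)
       (f1 w y *s in_chart c \<sigma> (snd c y) + in_chart c f (snd c y) *s pdw w c \<sigma> y) (snd c y)"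
      by (intro vdirder_smult df y pd_vdirder c near) (use y in auto)
    moreover have "eventually (\<lambda>x. in_chart c f x *s in_chart c \<sigma> x = in_chart c \<sigma>' x) (nhds (snd c y))"
    proof (rule eventually_elim2[OF near_dm[OF y(1)] ne[OF _ y(2)]])
      show "y \<in> chart_dom" using y by simp
    qed (simp add: in_chart_def propor)
    ultimately have "vdirder w (in_chart c \<sigma>')
        (f1 w y *s in_chart c \<sigma> (snd c y) + in_chart c f (snd c y) *s pdw w c \<sigma> y) (snd c y)"
      by (rule vdirder_cong[rotated])
    then have "vdirder w (in_chart c \<sigma>') (f1 w y *s \<sigma> y + f y *s pdw w c \<sigma> y) (snd c y)"
      using y by (simp add: in_chart_apply[OF c])
    then show ?thesis using vdirder_unique[OF pd_vdirder[OF c _ F.near]] y by blast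
  qed
  have step2: "\<exists>a b d. pdw w' c (pdw w c \<sigma>') p =
       a *s \<sigma> p + b *s pdw w' c \<sigma> p + d *s pdw w c \<sigma> p + f p *s pdw w' c (pdw w c \<sigma>) p" for w w'
  proof -
    have p': "p \<in> chart_dom \<inter> U'" using p U' by simp
    have f1: "in_chart c (f1 w) = (\<lambda>x. in_chart c (pdw w c \<sigma>') x $ i * (1 / in_chart c \<sigma> x $ i)
      + in_chart c \<sigma>' x $ i * (- (in_chart c (pdw w c \<sigma>) x $ i)
          * ((1 / in_chart c \<sigma> x $ i) * (1 / in_chart c \<sigma> x $ i))))"
      by (simp add: in_chart_def f1_def fun_eq_iff)
    note comp = vdirder_component[OF pd_vdirder[OF c, of p], where i = i and w = w']
    have d: "dirder w' (\<lambda>x. in_chart c \<sigma> x $ i) (pdw w' c \<sigma> p $ i) (snd c p)"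
      "dirder w' (\<lambda>x. in_chart c \<sigma>' x $ i) (pdw w' c \<sigma>' p $ i) (snd c p)"
      "dirder w' (\<lambda>x. in_chart c (pdw w c \<sigma>) x $ i) (pdw w' c (pdw w c \<sigma>) p $ i) (snd c p)"
      "dirder w' (\<lambda>x. in_chart c (pdw w c \<sigma>') x $ i) (pdw w' c (pdw w c \<sigma>') p $ i) (snd c p)"
      by (intro comp near F.near near' F.near'; use p' in simp)+
    have inv: "dirder w' (\<lambda>x. 1 / in_chart c \<sigma> x $ i)
        (- (pdw w' c \<sigma> p $ i) / (in_chart c \<sigma> (snd c p) $ i)\<^sup>2) (snd c p)"
      by (rule dirder_inverse[OF d(1)]) (use p' i in \<open>simp add: in_chart_apply[OF c]\<close>)
    have "\<exists>a. dirder w' (in_chart c (f1 w)) a (snd c p)"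
      unfolding f1
      by (rule exI, rule dirder_add[OF dirder_mult[OF d(4) inv]
            dirder_mult[OF d(2) dirder_mult[OF dirder_minus[OF d(3)] dirder_mult[OF inv inv]]]])
    then obtain a where a: "dirder w' (in_chart c (f1 w)) a (snd c p)" by blast
    have "vdirder w' (\<lambda>x. in_chart c (f1 w) x *s in_chart c \<sigma> x + in_chart c f x *s in_chart c (pdw w c \<sigma>) x)
      ((a *s in_chart c \<sigma> (snd c p) + in_chart c (f1 w) (snd c p) *s pdw w' c \<sigma> p)
       + (f1 w' p *s in_chart c (pdw w c \<sigma>) (snd c p) + in_chart c f (snd c p) *s pdw w' c (pdw w c \<sigma>) p)) (snd c p)"
      by (intro vdirder_add vdirder_smult df p' i a pd_vdirder c near near') (use p in auto)
    moreover have "eventually (\<lambda>x. in_chart c (f1 w) x *s in_chart c \<sigma> x + in_chart c f x *s in_chart c (pdw w c \<sigma>) x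
        = in_chart c (pdw w c \<sigma>') x) (nhds (snd c p))"
      by (rule eventually_elim2[OF near_dm[OF p'] ne[OF p i]]) (simp add: in_chart_def step1)
    ultimately have "vdirder w' (in_chart c (pdw w c \<sigma>'))
      ((a *s in_chart c \<sigma> (snd c p) + in_chart c (f1 w) (snd c p) *s pdw w' c \<sigma> p)
       + (f1 w' p *s in_chart c (pdw w c \<sigma>) (snd c p) + in_chart c f (snd c p) *s pdw w' c (pdw w c \<sigma>) p)) (snd c p)"
      by (rule vdirder_cong[rotated])
    then have "pdw w' c (pdw w c \<sigma>') p = (a *s \<sigma> p + f1 w p *s pdw w' c \<sigma> p)
       + (f1 w' p *s pdw w c \<sigma> p + f p *s pdw w' c (pdw w c \<sigma>) p)"
      using vdirder_unique[OF pd_vdirder[OF c _ F.near']] p' by (simp add: in_chart_apply[OF c])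
    then show ?thesis by (metis (no_types, opaque_lifting) add.assoc)
  qed
  show thesis
    by (rule that[of "f p"]) (use propor[of p] step1[of p] step2 p U' i in auto)
qed

text \<open>The transition map between holomorphic charts is holomorphic with derivative
  \<open>m\<close>. Since cnj m is annihilated by the new \<partial>_z, the mixed second derivative
  scales by m * cnj m without first-order terms.\<close>

lemma change_chart:
  assumes hol': "holomorphic_chart A \<Lambda> c'" and p: "p \<in> chart_dom" "p \<in> cdom c'"
  obtains m where "m \<noteq> 0" "pdz c' \<sigma> p = m *s Z p" "pdzbar c' \<sigma> p = cnj m *s B p"
    "pdz c' (pdzbar c' \<sigma>) p = (m * cnj m) *s T p"
proof -
  interpret F: surf_frame A \<Lambda> c' U \<sigma>
    by unfold_locales (use hol' U smooth sec in auto)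
  define w where "w = in_chart c' (snd c)"
  define W where "W = snd c' ` (cdom c \<inter> cdom c')"
  have comp: "compatible c' c" using A cA F.cA by (auto simp: oriented_surface_def)
  have W: "open W" unfolding W_def by (rule open_chart_image[OF F.c]) (use c in \<open>simp add: is_chart_def\<close>)
  have w: "(w has_derivative (\<lambda>X. pd c' X (snd c) x)) (at (snd c' x))" if "x \<in> cdom c \<inter> cdom c'" for x
  proof -
    have "smooth_on w W" using comp by (simp add: compatible_def w_def W_def Int_commute)
    then have "w differentiable (at (snd c' x))"
      using smooth_on_differentiable[OF _ W] that by (auto simp: W_def)
    then show ?thesis unfolding pd_def w_def by (metis frechet_derivative_works eta_contract_eq)
  qed
  have wx: "w (snd c' x) = snd c x" if "x \<in> cdom c'" for x
    using that by (simp add: w_def in_chart_apply[OF F.c])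
  define G where "G X f x = of_real (Re (pd c' X (snd c) x)) *s pd c 1 f x + of_real (Im (pd c' X (snd c) x)) *s pd c \<i> f x"
    for X x and f :: "'m \<Rightarrow> 'n cvec"
  have chain: "vdirder v (in_chart c' f) (fst v *s G 1 f x + snd v *s G \<i> f x) (snd c' x)"
    if x: "x \<in> cdom c \<inter> cdom c'" and f: "smooth_near c x f" for f x v
    unfolding vdirder_def
  proof
    fix i
    have pd: "vdirder u (in_chart c f) (pdw u c f x) (snd c x)" for u
      using pd_vdirder[OF c _ f] x by blast
    obtain D where D: "((\<lambda>y. in_chart c f y $ i) has_derivative D) (at (snd c x))"
      and D1: "pd c 1 f x $ i = D 1"
      using vdirder_component[OF pd[of "(1,0)"], of i] unfolding dirder_def by (auto simp: pdw_def)
    have Di: "pd c \<i> f x $ i = D \<i>"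
      using vdirder_component[OF pd[of "(0,1)"], of i] has_derivative_unique[OF D] unfolding dirder_def
      by (auto simp: pdw_def)
    have l: "linear D" using D has_derivative_linear by blast
    have DX: "D X = of_real (Re X) * D 1 + of_real (Im X) * D \<i>" for X
    proof -
      have "D X = D (Re X *\<^sub>R 1 + Im X *\<^sub>R \<i>)"
        by (rule arg_cong[of _ _ D]) (simp add: complex_eq_iff)
      then show ?thesis by (simp only: linear_add[OF l] linear_scale[OF l]) (simp add: scaleR_conv_of_real)
    qed
    have "((\<lambda>y. in_chart c f (w y) $ i) has_derivative (\<lambda>X. D (pd c' X (snd c) x))) (at (snd c' x))"
      by (rule has_derivative_compose[OF w[OF x]]) (use D wx x in simp)
    then have "((\<lambda>y. in_chart c' f y $ i) has_derivative (\<lambda>X. D (pd c' X (snd c) x))) (at (snd c' x))"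
      by (rule has_derivative_transform_within_open[OF _ W])
        (use x in \<open>auto simp: W_def wx in_chart_apply[OF c] in_chart_apply[OF F.c]\<close>)
    then show "dirder v (\<lambda>y. in_chart c' f y $ i) ((fst v *s G 1 f x + snd v *s G \<i> f x) $ i) (snd c' x)"
      unfolding dirder_def
      by (intro exI[of _ "\<lambda>X. D (pd c' X (snd c) x)"] conjI)
        (auto simp: G_def D1 Di DX[of "pd _ _ _ _"] algebra_simps)
  qed
  have pdw': "pdw v c' f x = fst v *s G 1 f x + snd v *s G \<i> f x"
    if "x \<in> cdom c \<inter> cdom c'" "smooth_near c x f" for f x v
    by (rule pdw_eqI[OF chain[OF that]])
  define \<mu> where "\<mu> = pd c' 1 (snd c)"
  have CR: "pd c' \<i> (snd c) x = \<i> * \<mu> x \<and> \<mu> x \<noteq> 0" if x: "x \<in> chart_dom" "x \<in> cdom c'" for x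
  proof -
    define a b u v where "a = Re (\<mu> x)" and "b = Im (\<mu> x)"
      and "u = Re (pd c' \<i> (snd c) x)" and "v = Im (pd c' \<i> (snd c) x)"
    define g where "g = mform (pd c 1 \<sigma> x) (pd c 1 \<sigma> x)"
    have g: "g \<noteq> 0" "mform (pd c \<i> \<sigma> x) (pd c \<i> \<sigma> x) = g" "mform (pd c 1 \<sigma> x) (pd c \<i> \<sigma> x) = 0"
      "mform (pd c \<i> \<sigma> x) (pd c 1 \<sigma> x) = 0"
      using metric[OF x(1)] mform_commute[of "pd c 1 \<sigma> x" "pd c \<i> \<sigma> x"] by (simp_all add: g_def)
    have d1: "pd c' 1 \<sigma> x = of_real a *s pd c 1 \<sigma> x + of_real b *s pd c \<i> \<sigma> x"
      and d2: "pd c' \<i> \<sigma> x = of_real u *s pd c 1 \<sigma> x + of_real v *s pd c \<i> \<sigma> x"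
      using pdw'[of x \<sigma> "(1,0)"] pdw'[of x \<sigma> "(0,1)"] x near
      by (simp_all add: pdw_def G_def a_def b_def u_def v_def \<mu>_def)
    have "g * of_real (a\<^sup>2 + b\<^sup>2) = g * of_real (u\<^sup>2 + v\<^sup>2)" "g * of_real (a * u + b * v) = 0"
      using F.metric(1,2)[of x] x unfolding d1 d2
      by (simp_all add: mform_linear g g_def[symmetric] power2_eq_square algebra_simps)
    then have 1: "a\<^sup>2 + b\<^sup>2 = u\<^sup>2 + v\<^sup>2" and 2: "a * u + b * v = 0"
      using g(1) by (simp_all only: mult_cancel_left of_real_eq_iff mult_eq_0_iff of_real_eq_0_iff) auto
    have 3: "a * v - b * u > 0"
      using comp x by (auto simp: compatible_def a_def b_def u_def v_def \<mu>_def algebra_simps)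
    \<comment> \<open>Lagrange's identity: (a^2 + b^2) (u^2 + v^2) = (a u + b v)^2 + (a v - b u)^2.
      Orientation then selects the positive root, and the Cauchy-Riemann equations follow.\<close>
    have "(a * v - b * u)\<^sup>2 = (a\<^sup>2 + b\<^sup>2)\<^sup>2" using 1 2 by algebra
    then have 4: "a * v - b * u = a\<^sup>2 + b\<^sup>2"
      using 3 by (metis less_imp_le power2_eq_iff_nonneg sum_power2_ge_zero)
    have "(u + b)\<^sup>2 + (v - a)\<^sup>2 = 0" using 1 4 by (simp add: power2_eq_square algebra_simps)
    then have "u = - b" "v = a" by (simp_all add: sum_power2_eq_zero_iff)
    moreover have "\<mu> x \<noteq> 0" using 3 by (auto simp: a_def b_def)
    ultimately show ?thesis by (auto simp: complex_eq_iff a_def b_def u_def v_def)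
  qed
  have dz': "pdw dz c' f x = \<mu> x *s pdw dz c f x" "pdw dzbar c' f x = cnj (\<mu> x) *s pdw dzbar c f x"
    if x: "x \<in> chart_dom" "x \<in> cdom c'" and f: "smooth_near c x f" for f :: "'m \<Rightarrow> 'n cvec" and x
  proof -
    define a b where "a = Re (\<mu> x)" and "b = Im (\<mu> x)"
    have m: "\<mu> x = of_real a + \<i> * of_real b" "cnj (\<mu> x) = of_real a - \<i> * of_real b"
      by (simp_all add: complex_eq_iff a_def b_def)
    have G1: "G 1 f x = of_real a *s pd c 1 f x + of_real b *s pd c \<i> f x"
      by (simp add: G_def \<mu>_def a_def b_def)
    have G2: "G \<i> f x = of_real (- b) *s pd c 1 f x + of_real a *s pd c \<i> f x"
      using CR[OF x] by (simp add: G_def a_def b_def)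
    have "x \<in> cdom c \<inter> cdom c'" using x by blast
    note pd1 = pdw'[OF this f]
    show "pdw dz c' f x = \<mu> x *s pdw dz c f x" "pdw dzbar c' f x = cnj (\<mu> x) *s pdw dzbar c f x"
      by (simp_all only: pd1 G1 G2 m) (simp_all add: vec_eq_iff pdw_def algebra_simps)
  qed
  define W' where "W' = snd c' ` ((U \<inter> cdom c) \<inter> cdom c')"
  have W': "open W'" unfolding W'_def
    by (rule open_chart_image[OF F.c]) (use c U in \<open>simp add: is_chart_def open_Int\<close>)
  have field: "(w has_field_derivative \<mu> x) (at (snd c' x))" if x: "x \<in> chart_dom" "x \<in> cdom c'" for x
  proof -
    have d: "(w has_derivative (\<lambda>X. pd c' X (snd c) x)) (at (snd c' x))" by (rule w) (use x in auto)
    have l: "linear (\<lambda>X. pd c' X (snd c) x)" using d has_derivative_linear by blast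
    have "pd c' X (snd c) x = \<mu> x * X" for X
    proof -
      have "pd c' X (snd c) x = pd c' (Re X *\<^sub>R 1 + Im X *\<^sub>R \<i>) (snd c) x"
        by (rule arg_cong[of _ _ "\<lambda>X. pd c' X (snd c) x"]) (simp add: complex_eq_iff)
      also have "\<dots> = Re X *\<^sub>R \<mu> x + Im X *\<^sub>R (\<i> * \<mu> x)"
        using CR[OF x] by (simp only: linear_add[OF l] linear_scale[OF l]) (simp add: \<mu>_def)
      finally show ?thesis by (simp add: complex_eq_iff algebra_simps)
    qed
    then show ?thesis using d by (simp add: has_field_derivative_def)
  qed
  \<comment> \<open>Holomorphy makes the derivative of \<open>w\<close>, that is
    \<open>\<mu>\<close>, complex differentiable in turn; its conjugate then has vanishing
    \<partial>_z.\<close>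
  have "w holomorphic_on W'"
    unfolding holomorphic_on_open[OF W'] using field by (auto simp: W'_def)
  then have "deriv w holomorphic_on W'" by (rule holomorphic_deriv[OF _ W'])
  then obtain m2 where m2: "(deriv w has_field_derivative m2) (at (snd c' p))"
    using p unfolding holomorphic_on_open[OF W'] by (auto simp: W'_def)
  have "dirder dz (\<lambda>y. cnj (deriv w y)) 0 (snd c' p)"
    unfolding dirder_def
    using has_derivative_cnj[OF m2[unfolded has_field_derivative_def]]
    by (intro exI[of _ "\<lambda>h. cnj (m2 * h)"]) (simp add: mult.commute[of _ \<i>])
  moreover have "eventually (\<lambda>y. cnj (deriv w y) = in_chart c' (\<lambda>x. cnj (\<mu> x)) y) (nhds (snd c' p))"
  proof (rule eventually_mono)
    show "eventually (\<lambda>y. y \<in> W') (nhds (snd c' p))"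
      using W' p by (intro eventually_nhds_in_open) (auto simp: W'_def)
    show "cnj (deriv w y) = in_chart c' (\<lambda>x. cnj (\<mu> x)) y" if "y \<in> W'" for y
      using that field by (auto simp: W'_def in_chart_apply[OF F.c] DERIV_imp_deriv)
  qed
  ultimately have d\<mu>: "dirder dz (in_chart c' (\<lambda>x. cnj (\<mu> x))) 0 (snd c' p)"
    by (rule dirder_cong[rotated])
  have vd: "vdirder v (in_chart c' B) (pdw v c' B p) (snd c' p)" for v
    using chain[of p B v] pdw'[of p B v] p near'[of p dzbar] by (simp add: pdzbar_eq_pdw)
  have "vdirder dz (\<lambda>y. in_chart c' (\<lambda>x. cnj (\<mu> x)) y *s in_chart c' B y)
     (0 *s in_chart c' B (snd c' p) + in_chart c' (\<lambda>x. cnj (\<mu> x)) (snd c' p) *s pdw dz c' B p) (snd c' p)"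
    by (intro vdirder_smult d\<mu> vd)
  moreover have "eventually (\<lambda>y. in_chart c' (\<lambda>x. cnj (\<mu> x)) y *s in_chart c' B y
      = in_chart c' (pdzbar c' \<sigma>) y) (nhds (snd c' p))"
  proof (rule eventually_mono)
    show "eventually (\<lambda>y. y \<in> W') (nhds (snd c' p))"
      using W' p by (intro eventually_nhds_in_open) (auto simp: W'_def)
    show "in_chart c' (\<lambda>x. cnj (\<mu> x)) y *s in_chart c' B y = in_chart c' (pdzbar c' \<sigma>) y" if "y \<in> W'" for y
      using that dz'(2)[OF _ _ near] by (auto simp: W'_def in_chart_apply[OF F.c] pdzbar_eq_pdw)
  qed
  ultimately have "vdirder dz (in_chart c' (pdzbar c' \<sigma>))
     (0 *s in_chart c' B (snd c' p) + in_chart c' (\<lambda>x. cnj (\<mu> x)) (snd c' p) *s pdw dz c' B p) (snd c' p)"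
    by (rule vdirder_cong[rotated])
  then have "pdw dz c' (pdzbar c' \<sigma>) p = cnj (\<mu> p) *s pdw dz c' B p"
    using vdirder_unique[OF pd_vdirder[OF F.c p(2)], of "pdzbar c' \<sigma>"] F.near'[of p dzbar] p
    by (auto simp: in_chart_apply[OF F.c] pdzbar_eq_pdw)
  also have "pdw dz c' B p = \<mu> p *s pdw dz c B p"
    using dz'(1)[of p B] near'[of p dzbar] p by (simp add: pdzbar_eq_pdw)
  finally have T': "pdz c' (pdzbar c' \<sigma>) p = (\<mu> p * cnj (\<mu> p)) *s T p"
    by (simp add: pdz_eq_pdw mult.commute)
  show thesis
    by (rule that[of "\<mu> p"]) (use CR[of p] T' dz'[of p \<sigma>] near p in \<open>auto simp: pdz_eq_pdw pdzbar_eq_pdw\<close>)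
qed

lemma generators_in_span:
  assumes p: "p \<in> chart_dom" and hol': "holomorphic_chart A \<Lambda> c'" "p \<in> cdom c'"
    and \<sigma>': "local_real_section A \<Lambda> p \<sigma>'"
  shows "\<sigma>' p \<in> vec.span {\<sigma> p}" "pdz c' \<sigma>' p \<in> vec.span {\<sigma> p, Z p}"
    "pdzbar c' \<sigma>' p \<in> vec.span {\<sigma> p, B p}"
    "pdz c' (pdzbar c' \<sigma>') p \<in> vec.span {\<sigma> p, Z p, B p, T p}"
proof -
  interpret F: surf_frame A \<Lambda> c' U \<sigma>
    by unfold_locales (use hol' U smooth sec in auto)
  obtain m where m: "pdz c' \<sigma> p = m *s Z p" "pdzbar c' \<sigma> p = cnj m *s B p"
    "pdz c' (pdzbar c' \<sigma>) p = (m * cnj m) *s T p"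
    using change_chart[OF hol'(1) p hol'(2)] by metis
  obtain f where f: "\<sigma>' p = f *s \<sigma> p"
    "\<And>w. \<exists>a. pdw w c' \<sigma>' p = a *s \<sigma> p + f *s pdw w c' \<sigma> p"
    "\<And>w w'. \<exists>a b d. pdw w' c' (pdw w c' \<sigma>') p =
       a *s \<sigma> p + b *s pdw w' c' \<sigma> p + d *s pdw w c' \<sigma> p + f *s pdw w' c' (pdw w c' \<sigma>) p"
    using F.change_section[of p \<sigma>'] p hol'(2) \<sigma>' by blast
  obtain a1 a2 a b d where "pdw dz c' \<sigma>' p = a1 *s \<sigma> p + f *s pdw dz c' \<sigma> p"
    "pdw dzbar c' \<sigma>' p = a2 *s \<sigma> p + f *s pdw dzbar c' \<sigma> p"
    "pdw dz c' (pdw dzbar c' \<sigma>') p = a *s \<sigma> p + b *s pdw dz c' \<sigma> p + d *s pdw dzbar c' \<sigma> p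
       + f *s pdw dz c' (pdw dzbar c' \<sigma>) p"
    using f(2)[of dz] f(2)[of dzbar] f(3)[where w = dzbar and w' = dz] by blast
  then have e:
    "pdz c' \<sigma>' p = a1 *s \<sigma> p + f *s (m *s Z p)" "pdzbar c' \<sigma>' p = a2 *s \<sigma> p + f *s (cnj m *s B p)"
    "pdz c' (pdzbar c' \<sigma>') p = a *s \<sigma> p + b *s (m *s Z p) + d *s (cnj m *s B p) + f *s ((m * cnj m) *s T p)"
    using m by (simp_all add: pdz_eq_pdw pdzbar_eq_pdw)
  show "\<sigma>' p \<in> vec.span {\<sigma> p}" "pdz c' \<sigma>' p \<in> vec.span {\<sigma> p, Z p}"
    "pdzbar c' \<sigma>' p \<in> vec.span {\<sigma> p, B p}"
    "pdz c' (pdzbar c' \<sigma>') p \<in> vec.span {\<sigma> p, Z p, B p, T p}"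
    unfolding f(1) e by (intro vec.span_add vec.span_scale vec.span_base; simp)+
qed

text \<open>The generators for any other chart and section lie in the span of those for this one, so
  the spans over all choices collapse.\<close>

lemma bundles:
  assumes p: "p \<in> chart_dom"
  shows "Lam10 A \<Lambda> p = vec.span {\<sigma> p, Z p}" "Lam01 A \<Lambda> p = vec.span {\<sigma> p, B p}"
    "central_sphere A \<Lambda> p = vec.span {\<sigma> p, Z p, B p, T p}"
    "Lam1 A \<Lambda> p = vec.span {\<sigma> p, Z p, B p}"
proof -
  have s: "local_real_section A \<Lambda> p \<sigma>" using p section_at by blast
  note g = generators_in_span[OF p]
  have mono: "x \<in> vec.span X \<Longrightarrow> X \<subseteq> Y \<Longrightarrow> x \<in> vec.span Y" for x :: "'n cvec" and X Y
    using vec.span_mono by blast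
  show 1: "Lam10 A \<Lambda> p = vec.span {\<sigma> p, Z p}"
    unfolding Lam10_def
    apply (rule span_Union_eq)
    subgoal by (auto intro: g(2) mono[OF g(1)])
    subgoal using hol p s by blast
    done
  show 2: "Lam01 A \<Lambda> p = vec.span {\<sigma> p, B p}"
    unfolding Lam01_def
    apply (rule span_Union_eq)
    subgoal by (auto intro: g(3) mono[OF g(1)])
    subgoal using hol p s by blast
    done
  show "central_sphere A \<Lambda> p = vec.span {\<sigma> p, Z p, B p, T p}"
    unfolding central_sphere_def
    apply (rule span_Union_eq)
    subgoal by (auto intro: g(4) mono[OF g(1)] mono[OF g(2)] mono[OF g(3)])
    subgoal using hol p s by blast
    done
  show "Lam1 A \<Lambda> p = vec.span {\<sigma> p, Z p, B p}"
    unfolding Lam1_def 1 2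
  proof (rule antisym; rule vec.span_minimal[OF _ vec.subspace_span])
    show "vec.span {\<sigma> p, Z p} \<union> vec.span {\<sigma> p, B p} \<subseteq> vec.span {\<sigma> p, Z p, B p}"
      by (intro Un_least vec.span_mono) auto
    show "{\<sigma> p, Z p, B p} \<subseteq> vec.span (vec.span {\<sigma> p, Z p} \<union> vec.span {\<sigma> p, B p})"
      by (auto intro!: vec.span_base)
  qed
qed

end

section \<open>The central sphere congruence\<close>

text \<open>The decomposition of x into P x and x - P x determines any competing matrix, so the
  definite description is justified.\<close>

lemma proj_along_eq:
  assumes "\<And>v. v \<in> W \<Longrightarrow> P *v v = v" "\<And>v. v \<in> W' \<Longrightarrow> P *v v = 0"
    "\<And>x. P *v x \<in> W" "\<And>x. x - P *v x \<in> W'"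
  shows "proj_along W W' = P"
  unfolding proj_along_def
proof (rule the_equality)
  show "(\<forall>v\<in>W. P *v v = v) \<and> (\<forall>v\<in>W'. P *v v = 0)" using assms by blast
  fix R assume R: "(\<forall>v\<in>W. R *v v = v) \<and> (\<forall>v\<in>W'. R *v v = 0)"
  have "R *v x = P *v x" for x
  proof -
    have "R *v x = R *v (P *v x) + R *v (x - P *v x)"
      by (simp add: matrix_vector_mult_diff_distrib)
    then show ?thesis using R assms(3,4) by simp
  qed
  then show "R = P" by (simp add: matrix_eq)
qed

text \<open>Both hypotheses refer to the Frechet derivative of the same entry; its uniqueness lets
  the two values be combined.\<close>

lemma mdirder_linear:
  assumes "mdirder (1, 0) F a z" "mdirder (0, 1) F b z"
  shows "mdirder w F (mscale (fst w) a + mscale (snd w) b) z"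
  unfolding mdirder_def
proof safe
  fix i j
  obtain D where D: "((\<lambda>x. F x $ i $ j) has_derivative D) (at z)" "a $ i $ j = D 1"
    using assms(1) unfolding mdirder_def dirder_def by fastforce
  obtain E where E: "((\<lambda>x. F x $ i $ j) has_derivative E) (at z)" "b $ i $ j = E \<i>"
    using assms(2) unfolding mdirder_def dirder_def by fastforce
  have "D = E" using D E has_derivative_unique by blast
  then show "dirder w (\<lambda>x. F x $ i $ j) ((mscale (fst w) a + mscale (snd w) b) $ i $ j) z"
    unfolding dirder_def using D E by (intro exI[of _ D]) simp
qed

lemma mdirder_cong:
  assumes "eventually (\<lambda>x. f x = g x) (nhds z)" "mdirder w f a z" shows "mdirder w g a z"
  unfolding mdirder_def
proof safe
  fix i j
  show "dirder w (\<lambda>x. g x $ i $ j) (a $ i $ j) z"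
    by (rule dirder_cong[of "\<lambda>x. f x $ i $ j"])
      (use assms in \<open>auto simp: mdirder_def elim: eventually_mono\<close>)
qed

lemma orth_span: "v \<in> orth (vec.span X) \<longleftrightarrow> (\<forall>x\<in>X. mform v x = 0)"
proof
  assume "\<forall>x\<in>X. mform v x = 0"
  then have "vec.span X \<subseteq> {w. mform v w = 0}"
    by (intro vec.span_minimal) (auto simp: vec.subspace_def mform_linear)
  then show "v \<in> orth (vec.span X)" by (auto simp: orth_def)
qed (auto simp: orth_def vec.span_base)

context surf_frame
begin

text \<open>Adding this multiple of \<open>\<sigma>\<close> to \<open>T\<close> makes it null, and so completes \<open>\<sigma>, Z, B\<close> to a null frame.\<close>

definition null_vec :: "'m \<Rightarrow> 'n cvec" where
  "null_vec x = T x + (mform (T x) (T x) * (1 / (2 * h x))) *s \<sigma> x"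

text \<open>In the null frame \<open>Z\<close> is dual to \<open>B\<close> with product h, and
  \<sigma> is dual to \<open>null_vec\<close> with product -h; this accounts for the signs. The
  explicit formula can be differentiated entry by entry.\<close>

definition sphere_proj :: "'m \<Rightarrow> 'n cmat" where
  "sphere_proj x = mscale (1 / h x) (outer (Z x) (B x) + outer (B x) (Z x)
     - outer (\<sigma> x) (null_vec x) - outer (null_vec x) (\<sigma> x))"

abbreviation "S \<equiv> central_sphere A \<Lambda>"

lemma sphere_proj_apply:
  "sphere_proj x *v v = (1 / h x) *s (mform v (B x) *s Z x + mform v (Z x) *s B x
     - mform v (null_vec x) *s \<sigma> x - mform v (\<sigma> x) *s null_vec x)"
  by (simp add: sphere_proj_def mat_apply outer_apply)

lemma frame_products':
  assumes "x \<in> chart_dom"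
  shows "mform (Z x) (\<sigma> x) = 0" "mform (B x) (\<sigma> x) = 0" "mform (T x) (\<sigma> x) = - h x"
    "mform (T x) (B x) = 0" "mform (T x) (Z x) = 0" "mform (B x) (Z x) = h x"
  using frame_products[OF assms] by (simp_all add: mform_commute)

lemma sphere_proj_frame:
  assumes x: "x \<in> chart_dom"
  shows "sphere_proj x *v \<sigma> x = \<sigma> x" "sphere_proj x *v Z x = Z x" "sphere_proj x *v B x = B x"
    "sphere_proj x *v T x = T x"
  using h_nonzero[OF x] frame_products[OF x] frame_products'[OF x] null[of x] x
  by (simp_all add: sphere_proj_apply null_vec_def mform_linear vec_eq_iff field_simps)

lemma sphere_proj_sym: "mform (sphere_proj x *v u) v = mform u (sphere_proj x *v v)"
  using mform_commute[of u v]
  by (simp add: sphere_proj_apply mform_linear mform_commute[of _ v] algebra_simps)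

lemma sphere_proj_S:
  assumes x: "x \<in> chart_dom" and v: "v \<in> S x" shows "sphere_proj x *v v = v"
proof -
  have "vec.span {\<sigma> x, Z x, B x, T x} \<subseteq> {v. sphere_proj x *v v = v}"
    by (rule vec.span_minimal) (auto simp: sphere_proj_frame[OF x] vec.subspace_def vec_linear)
  then show ?thesis using v bundles(3)[OF x] by auto
qed

lemma sphere_proj_in_S:
  assumes x: "x \<in> chart_dom" shows "sphere_proj x *v v \<in> S x"
  unfolding bundles(3)[OF x] sphere_proj_apply null_vec_def
  by (intro vec.span_scale vec.span_add vec.span_diff vec.span_base) auto

lemma sphere_proj_orth:
  assumes x: "x \<in> chart_dom" and v: "v \<in> orth (S x)" shows "sphere_proj x *v v = 0"
  using v unfolding bundles(3)[OF x] orth_span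
  by (simp add: sphere_proj_apply null_vec_def mform_linear)

lemma sphere_proj_compl:
  assumes x: "x \<in> chart_dom" shows "v - sphere_proj x *v v \<in> orth (S x)"
  unfolding orth_def using sphere_proj_S[OF x] by (auto simp: mform_linear sphere_proj_sym)

lemma piS_eq: "x \<in> chart_dom \<Longrightarrow> piS (S x) = sphere_proj x"
  unfolding piS_def
  by (rule proj_along_eq) (simp_all add: sphere_proj_S sphere_proj_in_S sphere_proj_orth sphere_proj_compl)

lemma piSperp_eq: "x \<in> chart_dom \<Longrightarrow> piSperp (S x) = mat 1 - sphere_proj x"
  unfolding piSperp_def
  by (rule proj_along_eq)
    (simp_all add: mat_apply sphere_proj_S sphere_proj_in_S sphere_proj_orth sphere_proj_compl)

lemma sphere_proj_idem: "x \<in> chart_dom \<Longrightarrow> sphere_proj x *v (sphere_proj x *v v) = sphere_proj x *v v"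
  by (intro sphere_proj_S sphere_proj_in_S)

lemma vcnj_sphere_proj:
  assumes x: "x \<in> chart_dom" shows "vcnj (sphere_proj x *v v) = sphere_proj x *v vcnj v"
proof -
  have hc: "cnj (h x) = h x"
    using mform_vcnj[of "Z x" "B x"] vcnj_frame[OF x] mform_commute[of "B x" "Z x"] by simp
  have c: "cnj (mform v (Z x)) = mform (vcnj v) (B x)" "cnj (mform v (B x)) = mform (vcnj v) (Z x)"
    "cnj (mform v (T x)) = mform (vcnj v) (T x)" "cnj (mform v (\<sigma> x)) = mform (vcnj v) (\<sigma> x)"
    "cnj (mform (T x) (T x)) = mform (T x) (T x)"
    using vcnj_frame[OF x] by (simp_all flip: mform_vcnj)
  have n: "vcnj (null_vec x) = null_vec x"
    unfolding null_vec_def by (simp add: vcnj_add vcnj_smult vcnj_frame[OF x] hc c)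
  have nv: "cnj (mform v (null_vec x)) = mform (vcnj v) (null_vec x)"
    using n by (simp flip: mform_vcnj)
  have "vcnj (a - b) = vcnj a - vcnj b" for a b :: "'n cvec" by (simp add: vec_eq_iff)
  then show ?thesis
    unfolding sphere_proj_apply
    by (simp add: vcnj_add vcnj_smult vcnj_frame[OF x] hc c n nv add.commute)
qed

section \<open>The derivative of the projection onto S and the form \<N>\<close>

definition dsphere :: "complex \<times> complex \<Rightarrow> 'm \<Rightarrow> 'n cmat" where
  "dsphere w p = (THE M. mdirder w (in_chart c sphere_proj) M (snd c p))"

lemma mdirder_sphere_ex:
  assumes p: "p \<in> chart_dom" shows "\<exists>M. mdirder w (in_chart c sphere_proj) M (snd c p)"
proof -
  have p': "p \<in> cdom c" using p by simp
  note vd = pd_vdirder[OF c p']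
  have s: "vdirder w (in_chart c \<sigma>) (pdw w c \<sigma> p) (snd c p)"
    and z: "vdirder w (in_chart c Z) (pdw w c Z p) (snd c p)"
    and b: "vdirder w (in_chart c B) (pdw w c B p) (snd c p)"
    and t: "vdirder w (in_chart c T) (pdw w c T p) (snd c p)"
    unfolding pdz_eq_pdw pdzbar_eq_pdw by (intro vd near near' near'' p)+
  note hh = dirder_mform[OF z b]
  have h0: "mform (in_chart c Z (snd c p)) (in_chart c B (snd c p)) \<noteq> 0"
    using h_nonzero[OF p] p' by (simp add: in_chart_apply[OF c])
  note hi = dirder_inverse[OF hh h0]
  have h20: "2 * mform (in_chart c Z (snd c p)) (in_chart c B (snd c p)) \<noteq> 0" using h0 by simp
  note h2i = dirder_inverse[OF dirder_cmult[OF hh, of 2] h20]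
  note nv = vdirder_add[OF t vdirder_smult[OF dirder_mult[OF dirder_mform[OF t t] h2i] s]]
  note sp = mdirder_mscale[OF hi mdirder_diff[OF mdirder_diff[OF mdirder_add[OF mdirder_outer[OF z b]
      mdirder_outer[OF b z]] mdirder_outer[OF s nv]] mdirder_outer[OF nv s]]]
  show ?thesis using sp unfolding in_chart_def sphere_proj_def null_vec_def by blast
qed

lemma mdirder_sphere: "p \<in> chart_dom \<Longrightarrow> mdirder w (in_chart c sphere_proj) (dsphere w p) (snd c p)"
  unfolding dsphere_def by (rule theI', rule ex_ex1I[OF mdirder_sphere_ex mdirder_unique])

lemma dsphere_linear: "p \<in> chart_dom \<Longrightarrow> dsphere w p = mscale (fst w) (dsphere (1, 0) p) + mscale (snd w) (dsphere (0, 1) p)"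
  by (rule mdirder_unique[OF mdirder_sphere mdirder_linear[OF mdirder_sphere mdirder_sphere]])

lemma dsphere_idem:
  assumes p: "p \<in> chart_dom"
  shows "dsphere w p *v v = dsphere w p *v (sphere_proj p *v v) + sphere_proj p *v (dsphere w p *v v)"
proof -
  have "mdirder w (\<lambda>x. in_chart c sphere_proj x ** in_chart c sphere_proj x)
     (dsphere w p ** in_chart c sphere_proj (snd c p) + in_chart c sphere_proj (snd c p) ** dsphere w p) (snd c p)"
    by (intro mdirder_mult mdirder_sphere p)
  moreover have "eventually (\<lambda>x. in_chart c sphere_proj x ** in_chart c sphere_proj x = in_chart c sphere_proj x) (nhds (snd c p))"
    using in_chart_eventually_eq[OF c _ U, of p "\<lambda>x. sphere_proj x ** sphere_proj x" sphere_proj] p sphere_proj_idem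
    by (simp add: in_chart_def matrix_eq matrix_vector_mul_assoc[symmetric])
  ultimately have "mdirder w (in_chart c sphere_proj)
     (dsphere w p ** in_chart c sphere_proj (snd c p) + in_chart c sphere_proj (snd c p) ** dsphere w p) (snd c p)"
    by (rule mdirder_cong[rotated])
  note mdirder_unique[OF mdirder_sphere[OF p] this]
  moreover have "in_chart c sphere_proj (snd c p) = sphere_proj p" using p by (simp add: in_chart_apply[OF c])
  ultimately have "dsphere w p = dsphere w p ** sphere_proj p + sphere_proj p ** dsphere w p"
    by (simp only:)
  then have "dsphere w p *v v = (dsphere w p ** sphere_proj p + sphere_proj p ** dsphere w p) *v v"
    by (rule arg_cong)
  then show ?thesis by (simp only: mat_apply)
qed

lemma dsphere_sym:
  assumes p: "p \<in> chart_dom" shows "mform (dsphere w p *v u) v = mform u (dsphere w p *v v)"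
proof -
  have 1: "dirder w (\<lambda>x. mform (in_chart c sphere_proj x *v u) v) (mform (dsphere w p *v u) v) (snd c p)"
    using dirder_mform[OF vdirder_mult_const[OF mdirder_sphere[OF p]] vdirder_const] by simp
  have 2: "dirder w (\<lambda>x. mform u (in_chart c sphere_proj x *v v)) (mform u (dsphere w p *v v)) (snd c p)"
    using dirder_mform[OF vdirder_const vdirder_mult_const[OF mdirder_sphere[OF p]]] by simp
  have "mform (in_chart c sphere_proj x *v u) v = mform u (in_chart c sphere_proj x *v v)" for x
    by (simp add: in_chart_def sphere_proj_sym)
  then show ?thesis using dirder_unique[OF 1] 2 by simp
qed

lemma vcnj_dsphere:
  assumes p: "p \<in> chart_dom"
  shows "vcnj (dsphere w p *v v) = dsphere (cnj (fst w), cnj (snd w)) p *v vcnj v"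
proof -
  have "vdirder (cnj (fst w), cnj (snd w)) (\<lambda>x. vcnj (in_chart c sphere_proj x *v v)) (vcnj (dsphere w p *v v)) (snd c p)"
    by (intro vdirder_vcnj vdirder_mult_const mdirder_sphere p)
  moreover have "eventually (\<lambda>x. vcnj (in_chart c sphere_proj x *v v) = in_chart c sphere_proj x *v vcnj v) (nhds (snd c p))"
    using in_chart_eventually_eq[OF c _ U, of p "\<lambda>x. vcnj (sphere_proj x *v v)" "\<lambda>x. sphere_proj x *v vcnj v"] p vcnj_sphere_proj
    by (simp add: in_chart_def)
  ultimately have "vdirder (cnj (fst w), cnj (snd w)) (\<lambda>x. in_chart c sphere_proj x *v vcnj v) (vcnj (dsphere w p *v v)) (snd c p)"
    by (rule vdirder_cong[rotated])
  then show ?thesis using vdirder_unique vdirder_mult_const[OF mdirder_sphere[OF p]] by blast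
qed

definition refl :: "'m \<Rightarrow> 'n cmat" where
  "refl x = mscale 2 (sphere_proj x) - mat 1"

text \<open>On constant sections \<D> acts as \<rho> composed with the derivative of the projection
  onto S, and d acts as zero; hence \<N> = d - \<D> is the negative of that product.\<close>

definition Ncoef :: "complex \<times> complex \<Rightarrow> 'm \<Rightarrow> 'n cmat" where
  "Ncoef w p = - (refl p ** dsphere w p)"

lemma rho_eq: "x \<in> chart_dom \<Longrightarrow> rho (S x) = refl x"
  by (simp add: rho_def piS_eq piSperp_eq refl_def vec_eq_iff)

lemma refl_apply: "refl x *v v = 2 *s (sphere_proj x *v v) - v"
  by (simp add: refl_def mat_apply)

lemma refl_refl: "x \<in> chart_dom \<Longrightarrow> refl x *v (refl x *v v) = v"
  by (simp add: refl_apply vec_linear sphere_proj_idem vec_eq_iff)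

lemma refl_sym: "mform (refl x *v u) v = mform u (refl x *v v)"
  by (simp add: refl_apply mform_linear sphere_proj_sym)

lemma refl_dsphere: "p \<in> chart_dom \<Longrightarrow> refl p *v (dsphere w p *v v) = - (dsphere w p *v (refl p *v v))"
  using dsphere_idem[of p w v] by (simp add: refl_apply vec_linear vec_eq_iff algebra_simps)

lemma Ncoef_apply: "Ncoef w p *v v = - (refl p *v (dsphere w p *v v))"
  by (simp add: Ncoef_def mat_apply)

lemma skew_Ncoef: "p \<in> chart_dom \<Longrightarrow> skew (Ncoef w p)"
  unfolding skew_def Ncoef_apply
  by (simp add: mform_linear refl_sym dsphere_sym) (simp add: refl_dsphere mform_linear)

lemma refl_Ncoef: "p \<in> chart_dom \<Longrightarrow> refl p *v (Ncoef w p *v v) = - (Ncoef w p *v (refl p *v v))"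
  unfolding Ncoef_apply by (simp add: vec_linear refl_dsphere)

lemma dsphere_eq: "p \<in> chart_dom \<Longrightarrow> dsphere w p *v v = Ncoef w p *v (refl p *v v)"
  unfolding Ncoef_apply by (simp add: refl_dsphere vec_linear refl_refl)

lemma Ncoef_linear: "p \<in> chart_dom \<Longrightarrow> Ncoef w p *v v = fst w *s (Ncoef (1, 0) p *v v) + snd w *s (Ncoef (0, 1) p *v v)"
  unfolding Ncoef_apply by (subst dsphere_linear) (simp_all add: mat_apply vec_linear)

lemma vcnj_Ncoef:
  "p \<in> chart_dom \<Longrightarrow> vcnj (Ncoef w p *v v) = Ncoef (cnj (fst w), cnj (snd w)) p *v vcnj v"
proof -
  assume p: "p \<in> chart_dom"
  have "vcnj (- a) = - vcnj a" "vcnj (a - b) = vcnj a - vcnj b" for a b :: "'n cvec" by (simp_all add: vec_eq_iff)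
  then show ?thesis
    unfolding Ncoef_apply refl_apply using p by (simp add: vcnj_smult vcnj_sphere_proj vcnj_dsphere)
qed

text \<open>On sections of S, \<N> is the second fundamental form: the normal part of the
  derivative.\<close>

lemma Ncoef_section:
  assumes p: "p \<in> chart_dom" and v: "smooth_near c p v" and S: "\<And>x. x \<in> chart_dom \<Longrightarrow> v x \<in> S x"
  shows "Ncoef w p *v v p = pdw w c v p - sphere_proj p *v pdw w c v p"
proof -
  have "vdirder w (\<lambda>x. in_chart c sphere_proj x *v in_chart c v x)
    (dsphere w p *v in_chart c v (snd c p) + in_chart c sphere_proj (snd c p) *v pdw w c v p) (snd c p)"
    by (intro vdirder_mult_vec mdirder_sphere p pd_vdirder c v) (use p in auto)
  moreover have "eventually (\<lambda>x. in_chart c sphere_proj x *v in_chart c v x = in_chart c v x) (nhds (snd c p))"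
    using in_chart_eventually_eq[OF c _ U, of p "\<lambda>x. sphere_proj x *v v x" v] p sphere_proj_S S
    by (simp add: in_chart_def)
  ultimately have "vdirder w (in_chart c v)
    (dsphere w p *v in_chart c v (snd c p) + in_chart c sphere_proj (snd c p) *v pdw w c v p) (snd c p)"
    by (rule vdirder_cong[rotated])
  note vdirder_unique[OF pd_vdirder[OF c _ v] this]
  moreover have "in_chart c sphere_proj (snd c p) = sphere_proj p" "in_chart c v (snd c p) = v p" "p \<in> cdom c"
    using p by (simp_all add: in_chart_apply[OF c])
  ultimately have "pdw w c v p = dsphere w p *v v p + sphere_proj p *v pdw w c v p"
    by (simp only:)
  then have "dsphere w p *v v p = pdw w c v p - sphere_proj p *v pdw w c v p"
    by (metis add_diff_cancel_right')
  then show ?thesis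
    unfolding Ncoef_apply refl_apply using p by (simp add: vec_linear sphere_proj_idem)
qed

lemma in_S:
  assumes "p \<in> chart_dom" shows "\<sigma> p \<in> S p" "Z p \<in> S p" "B p \<in> S p" "T p \<in> S p"
  using bundles(3)[OF assms] by (auto intro: vec.span_base)

text \<open>The z-derivatives of \<sigma> and \<sigma>_zbar are \<open>Z\<close> and
  \<open>T\<close>, which belong to the central sphere, so their normal parts vanish.\<close>

lemma Ncoef_dz:
  assumes p: "p \<in> chart_dom" shows "Ncoef dz p *v \<sigma> p = 0" "Ncoef dz p *v B p = 0"
  using Ncoef_section[OF p near[OF p] in_S(1), of dz]
    Ncoef_section[OF p near'[OF p, of dzbar, folded pdzbar_eq_pdw] in_S(3), of dz]
    sphere_proj_frame[OF p] by (simp_all flip: pdz_eq_pdw)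

lemma Dconn_eq:
  assumes p: "p \<in> chart_dom" and f: "\<And>w. vdirder w (in_chart c f) (f' w) (snd c p)"
  shows "Dconn S c X f p = f' (of_real (Re X), of_real (Im X)) - Ncoef (of_real (Re X), of_real (Im X)) p *v f p"
proof -
  let ?w = "(complex_of_real (Re X), complex_of_real (Im X))"
  have p': "p \<in> cdom c" using p by simp
  have "vdirder ?w (\<lambda>x. in_chart c sphere_proj x *v in_chart c f x)
    (dsphere ?w p *v in_chart c f (snd c p) + in_chart c sphere_proj (snd c p) *v f' ?w) (snd c p)"
    by (intro vdirder_mult_vec mdirder_sphere p f)
  then have v: "vdirder ?w (\<lambda>x. in_chart c sphere_proj x *v in_chart c f x)
    (dsphere ?w p *v f p + sphere_proj p *v f' ?w) (snd c p)" using p' by (simp add: in_chart_apply[OF c])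
  have 1: "pd c X (\<lambda>x. piS (S x) *v f x) p = dsphere ?w p *v f p + sphere_proj p *v f' ?w"
    by (rule vdirder_pd, rule vdirder_cong[OF _ v])
      (use in_chart_eventually_eq[OF c p' U, of "\<lambda>x. sphere_proj x *v f x" "\<lambda>x. piS (S x) *v f x"] p piS_eq
        in \<open>simp add: in_chart_def\<close>)
  have 2: "pd c X (\<lambda>x. piSperp (S x) *v f x) p = f' ?w - (dsphere ?w p *v f p + sphere_proj p *v f' ?w)"
    by (rule vdirder_pd, rule vdirder_cong[OF _ vdirder_diff[OF f v]])
      (use in_chart_eventually_eq[OF c p' U, of "\<lambda>x. f x - sphere_proj x *v f x" "\<lambda>x. piSperp (S x) *v f x"] p piSperp_eq
        in \<open>simp add: in_chart_def mat_apply\<close>)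
  show ?thesis
    unfolding Dconn_def 1 2 piS_eq[OF p] piSperp_eq[OF p] Ncoef_apply refl_apply
    using p by (simp add: mat_apply vec_linear sphere_proj_idem vec_eq_iff algebra_simps)
qed

lemma Nform_eq:
  assumes p: "p \<in> chart_dom" shows "Nform S c p X = Ncoef (of_real (Re X), of_real (Im X)) p"
proof -
  have "pd c X (\<lambda>x. v) p - Dconn S c X (\<lambda>x. v) p = Ncoef (of_real (Re X), of_real (Im X)) p *v v" for v :: "'n cvec"
  proof -
    have 0: "vdirder w (in_chart c (\<lambda>x. v)) 0 (snd c p)" for w
      by (simp add: in_chart_def vdirder_const)
    show ?thesis using Dconn_eq[OF p 0, of X] vdirder_pd[OF 0, of X] by simp
  qed
  then show ?thesis unfolding Nform_def by simp
qed

end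

section \<open>Multipliers\<close>

lemma wedge_add: "wedge s (u + v) = wedge s u + wedge s v"
  by (simp add: matrix_eq wedge_apply mat_apply mform_linear vec_eq_iff algebra_simps)

lemma wedge_smult: "wedge s (k *s u) = mscale k (wedge s u)"
  by (simp add: matrix_eq wedge_apply mat_apply mform_linear vec_eq_iff algebra_simps)

lemma skew_wedge: "skew (wedge u v)"
  by (simp add: skew_def wedge_apply mform_linear mform_commute)

text \<open>The first factor is a line and wedges of \<open>s\<close> with itself vanish, so these
  elements already form a subspace. As the span is real, closure under real scalars is what has to
  be checked.\<close>

lemma wedge_space_form:
  assumes "M \<in> wedge_space (vec.span {s}) (vec.span {s, z, b})"
  shows "\<exists>x y. M = wedge s (x *s z + y *s b)"
proof -
  have "span {wedge v w | v w. v \<in> vec.span {s} \<and> w \<in> vec.span {s, z, b}}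
    \<subseteq> {M. \<exists>x y. M = wedge s (x *s z + y *s b)}"
  proof (rule span_minimal, safe)
    fix v w assume v: "v \<in> vec.span {s}" and w: "w \<in> vec.span {s, z, b}"
    obtain k where k: "v = k *s s" using v by (auto simp: vec.span_singleton)
    obtain l x y where w: "w = l *s s + x *s z + y *s b"
    proof -
      obtain l where "w - l *s s \<in> vec.span {z, b}" using w by (auto simp: vec.span_insert)
      moreover from this obtain x where "w - l *s s - x *s z \<in> vec.span {b}" by (auto simp: vec.span_insert)
      moreover from this obtain y where "w - l *s s - x *s z = y *s b" by (auto simp: vec.span_singleton)
      ultimately show thesis using that[of l x y] by (simp add: algebra_simps)
    qed
    show "\<exists>x y. wedge v w = wedge s (x *s z + y *s b)"
      by (intro exI[of _ "k * x"] exI[of _ "k * y"])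
        (simp add: k w matrix_eq wedge_apply mform_linear vec_eq_iff algebra_simps)
  next
    show "subspace {M. \<exists>x y. M = wedge s (x *s z + y *s b)}"
      unfolding subspace_def
    proof (intro conjI ballI allI)
      show "0 \<in> {M. \<exists>x y. M = wedge s (x *s z + y *s b)}"
        by (auto intro!: exI[of _ 0] simp: matrix_eq wedge_apply)
    next
      fix M M' assume "M \<in> {M. \<exists>x y. M = wedge s (x *s z + y *s b)}" "M' \<in> {M. \<exists>x y. M = wedge s (x *s z + y *s b)}"
      then obtain x1 y1 x2 y2 where M: "M = wedge s (x1 *s z + y1 *s b)" "M' = wedge s (x2 *s z + y2 *s b)"
        by blast
      have "M + M' = wedge s ((x1 + x2) *s z + (y1 + y2) *s b)"
        unfolding M by (simp add: matrix_eq wedge_apply mat_apply mform_linear vec_eq_iff algebra_simps)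
      then show "M + M' \<in> {M. \<exists>x y. M = wedge s (x *s z + y *s b)}" by blast
    next
      fix r M assume "M \<in> {M. \<exists>x y. M = wedge s (x *s z + y *s b)}"
      then obtain x1 y1 where M: "M = wedge s (x1 *s z + y1 *s b)" by blast
      have "r *\<^sub>R M = mscale (of_real r) M"
        unfolding vec_eq_iff mscale_nth vector_scaleR_component by (simp add: scaleR_conv_of_real)
      then have "r *\<^sub>R M = wedge s ((of_real r * x1) *s z + (of_real r * y1) *s b)"
        by (simp add: M wedge_add wedge_smult vec_eq_iff algebra_simps)
      then show "r *\<^sub>R M \<in> {M. \<exists>x y. M = wedge s (x *s z + y *s b)}" by blast
    qed
  qed
  then show ?thesis using assms unfolding wedge_space_def by blast
qed

section \<open>The multiplier in a local frame\<close>

locale cw_frame = surf_frame A \<Lambda> c U \<sigma>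
  for A :: "'m::{t2_space, second_countable_topology} chart set" and \<Lambda> :: "'m \<Rightarrow> 'n::finite cvec set"
    and c U \<sigma> +
  fixes q :: "('m, 'n) form1"
  assumes cw: "constrained_willmore A \<Lambda> q"
begin

definition qcoef :: "complex \<times> complex \<Rightarrow> 'm \<Rightarrow> 'n cmat" where
  "qcoef w p = mscale (fst w) (q c p 1) + mscale (snd w) (q c p \<i>)"

lemma q_form: "one_form A q" using cw by (simp add: constrained_willmore_def)

lemma q_fibre: "p \<in> chart_dom \<Longrightarrow> real_mat (q c p X) \<and> q c p X \<in> wedge_space (\<Lambda> p) (Lam1 A \<Lambda> p)"
  using cw cA unfolding constrained_willmore_def by blast

lemma closed_q: "p \<in> chart_dom \<Longrightarrow> extD S q c p X Y = 0"
  using cw hol unfolding constrained_willmore_def Let_def by blast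

lemma q_eq: "p \<in> chart_dom \<Longrightarrow> q c p X = qcoef (of_real (Re X), of_real (Im X)) p"
proof -
  assume p: "p \<in> chart_dom"
  have l: "linear (q c p)" using q_form cA p unfolding one_form_def by blast
  have "q c p X = q c p (Re X *\<^sub>R 1 + Im X *\<^sub>R \<i>)"
    by (rule arg_cong[of _ _ "q c p"]) (simp add: complex_eq_iff)
  also have "\<dots> = Re X *\<^sub>R q c p 1 + Im X *\<^sub>R q c p \<i>"
    by (simp only: linear_add[OF l] linear_scale[OF l])
  also have "\<dots> = qcoef (of_real (Re X), of_real (Im X)) p"
    unfolding qcoef_def vec_eq_iff vector_add_component mscale_nth vector_scaleR_component
    by (simp add: scaleR_conv_of_real)
  finally show ?thesis .
qed

lemma qcoef_form:
  assumes p: "p \<in> chart_dom" obtains x y where "qcoef w p = wedge (\<sigma> p) (x *s Z p + y *s B p)"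
proof -
  have "\<exists>x y. q c p X = wedge (\<sigma> p) (x *s Z p + y *s B p)" for X
    using q_fibre[OF p, of X] fibre[of p] bundles(4)[OF p] p by (intro wedge_space_form) simp
  then obtain x1 y1 x2 y2 where "q c p 1 = wedge (\<sigma> p) (x1 *s Z p + y1 *s B p)"
    "q c p \<i> = wedge (\<sigma> p) (x2 *s Z p + y2 *s B p)" by metis
  then have "qcoef w p = wedge (\<sigma> p) ((fst w * x1 + snd w * x2) *s Z p + (fst w * y1 + snd w * y2) *s B p)"
    by (simp add: qcoef_def wedge_add wedge_smult vec_eq_iff algebra_simps)
  then show thesis by (rule that)
qed

lemma skew_qcoef: "p \<in> chart_dom \<Longrightarrow> skew (qcoef w p)"
  using qcoef_form skew_wedge by metis

lemma qcoef_\<sigma>: "p \<in> chart_dom \<Longrightarrow> qcoef w p *v \<sigma> p = 0"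
proof -
  assume p: "p \<in> chart_dom"
  obtain x y where "qcoef w p = wedge (\<sigma> p) (x *s Z p + y *s B p)" using qcoef_form[OF p] .
  then show ?thesis using null[of p] p frame_products[OF p] by (simp add: wedge_apply mform_linear)
qed

lemma qcoef_orth: "p \<in> chart_dom \<Longrightarrow> v \<in> orth (S p) \<Longrightarrow> qcoef w p *v v = 0"
proof -
  assume p: "p \<in> chart_dom" and v: "v \<in> orth (S p)"
  obtain x y where "qcoef w p = wedge (\<sigma> p) (x *s Z p + y *s B p)" using qcoef_form[OF p] .
  then show ?thesis using v unfolding bundles(3)[OF p] orth_span by (simp add: wedge_apply mform_linear)
qed

text \<open>A wedge of \<sigma> with another vector sends everything orthogonal to \<sigma> into the
  line of \<sigma>, and derivatives of \<sigma> are orthogonal to it.\<close>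

lemma qcoef_deriv:
  assumes p: "p \<in> chart_dom" shows "\<exists>k. qcoef w p *v pdw w' c \<sigma> p = k *s \<sigma> p"
proof -
  obtain x y where "qcoef w p = wedge (\<sigma> p) (x *s Z p + y *s B p)" using qcoef_form[OF p] .
  then show ?thesis using orth_deriv[OF p, of w'] mform_commute[of "\<sigma> p" "pdw w' c \<sigma> p"]
    by (intro exI[of _ "- mform (pdw w' c \<sigma> p) (x *s Z p + y *s B p)"]) (simp add: wedge_apply)
qed

lemma qcoef_sphere: "p \<in> chart_dom \<Longrightarrow> qcoef w p *v (sphere_proj p *v v) = qcoef w p *v v"
  using qcoef_orth[OF _ sphere_proj_compl[of p v], of w] by (simp add: vec_linear)

lemma sphere_qcoef:
  assumes "p \<in> chart_dom" shows "sphere_proj p *v (qcoef w p *v v) = qcoef w p *v v"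
proof (rule mform_nondegenerate[of "_ - _", simplified])
  show "mform (sphere_proj p *v (qcoef w p *v v) - qcoef w p *v v) y = 0" for y
    by (simp add: mform_linear sphere_proj_sym skewD[OF skew_qcoef[OF assms]] qcoef_sphere[OF assms])
qed

lemma refl_qcoef: "p \<in> chart_dom \<Longrightarrow> refl p *v (qcoef w p *v v) = qcoef w p *v (refl p *v v)"
  by (simp add: refl_apply vec_linear qcoef_sphere sphere_qcoef)

lemma vcnj_qcoef:
  assumes p: "p \<in> chart_dom" shows "vcnj (qcoef w p *v v) = qcoef (cnj (fst w), cnj (snd w)) p *v vcnj v"
proof -
  have "cnj (q c p X $ i $ j) = q c p X $ i $ j" for X i j
    using q_fibre[OF p, of X] Reals_cnj_iff unfolding real_mat_def by blast
  then show ?thesis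
    by (simp add: vec_eq_iff qcoef_def matrix_vector_mult_def)
qed

lemma mdirder_q:
  assumes p: "p \<in> chart_dom" shows "\<exists>M. \<forall>w. mdirder w (in_chart c (\<lambda>x. q c x X)) (M w) (snd c p)"
proof -
  have o: "open (snd c ` cdom c)" "snd c p \<in> snd c ` cdom c" using c p by (auto simp: is_chart_def)
  have "smooth_on (in_chart c (\<lambda>x. q c x X)) (snd c ` cdom c)"
    using q_form cA unfolding one_form_def by blast
  from smooth_on_differentiable[OF this o]
  obtain D where D: "(in_chart c (\<lambda>x. q c x X) has_derivative D) (at (snd c p))"
    unfolding differentiable_def by blast
  have "((\<lambda>x. in_chart c (\<lambda>x. q c x X) x $ i $ j) has_derivative (\<lambda>h. D h $ i $ j)) (at (snd c p))" for i j
    by (intro bounded_linear.has_derivative[OF bounded_linear_vec_nth] D)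
  then have "mdirder w (in_chart c (\<lambda>x. q c x X)) (mscale (fst w) (D 1) + mscale (snd w) (D \<i>)) (snd c p)" for w
    unfolding mdirder_def dirder_def by fastforce
  then show ?thesis by (intro exI[of _ "\<lambda>w. mscale (fst w) (D 1) + mscale (snd w) (D \<i>)"]) simp
qed

lemma DEnd_eq:
  assumes p: "p \<in> chart_dom" and M: "\<And>w. mdirder w (in_chart c F) (M w) (snd c p)"
  shows "DEnd S c X F p *v v = M (of_real (Re X), of_real (Im X)) *v v
    - Ncoef (of_real (Re X), of_real (Im X)) p *v (F p *v v)
    + F p *v (Ncoef (of_real (Re X), of_real (Im X)) p *v v)"
proof -
  let ?w = "(complex_of_real (Re X), complex_of_real (Im X))"
  have p': "p \<in> cdom c" using p by simp
  have "Dconn S c X (\<lambda>x. F x *v v) p - F p *v Dconn S c X (\<lambda>x. v) p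
    = (M ?w - Ncoef ?w p ** F p + F p ** Ncoef ?w p) *v v" for v
  proof -
    have 0: "vdirder w (in_chart c (\<lambda>x. v)) 0 (snd c p)" for w
      by (simp add: in_chart_def vdirder_const)
    have 1: "vdirder w (in_chart c (\<lambda>x. F x *v v)) (M w *v v) (snd c p)" for w
      using vdirder_mult_const[OF M, of w v] by (simp add: in_chart_def)
    show ?thesis using Dconn_eq[OF p 0, of X] Dconn_eq[OF p 1, of X]
      by (simp add: mat_apply vec_linear)
  qed
  then have "DEnd S c X F p = M ?w - Ncoef ?w p ** F p + F p ** Ncoef ?w p"
    unfolding DEnd_def by (simp only: matrix_of_matrix_vector_mul)
  then show ?thesis by (simp add: mat_apply)
qed

lemma Ncoef_compl:
  assumes p: "p \<in> chart_dom" and v: "v \<in> S p" shows "sphere_proj p *v (Ncoef w p *v v) = 0"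
proof -
  have "refl p *v v = v" using sphere_proj_S[OF p v] by (simp add: refl_apply vec_eq_iff)
  then have "refl p *v (Ncoef w p *v v) = - (Ncoef w p *v v)" using refl_Ncoef[OF p, of w v] by simp
  then show ?thesis by (simp add: refl_apply vec_eq_iff)
qed

text \<open>\<N> maps S into its complement, while q preserves S and kills the complement. Both
  correction terms of \<D> therefore vanish between vectors of S.\<close>

lemma DEnd_pair:
  assumes p: "p \<in> chart_dom" and M: "\<And>w. mdirder w (in_chart c (\<lambda>x. q c x Y)) (M w) (snd c p)"
    and u: "u \<in> S p" and v: "v \<in> S p"
  shows "mform (DEnd S c X (\<lambda>x. q c x Y) p *v u) v = mform (M (of_real (Re X), of_real (Im X)) *v u) v"
proof -
  let ?w = "(complex_of_real (Re X), complex_of_real (Im X))"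
  have 1: "mform (sphere_proj p *v x) v = mform x v" for x
    using sphere_proj_S[OF p v] by (simp add: sphere_proj_sym)
  have "q c p Y *v u \<in> S p"
    using sphere_qcoef[OF p] sphere_proj_in_S[OF p] q_eq[OF p] by metis
  then have "mform (Ncoef ?w p *v (q c p Y *v u)) v = 0"
    using 1[of "Ncoef ?w p *v (q c p Y *v u)"] Ncoef_compl[OF p] by simp
  moreover have "q c p Y *v (Ncoef ?w p *v u) = 0"
    using qcoef_sphere[OF p, of _ "Ncoef ?w p *v u"] Ncoef_compl[OF p u] q_eq[OF p, of Y] by simp
  ultimately show ?thesis by (simp add: DEnd_eq[OF p M] mform_linear)
qed

lemma extD_q: "p \<in> chart_dom \<Longrightarrow> DEnd S c 1 (\<lambda>x. q c x \<i>) p = DEnd S c \<i> (\<lambda>x. q c x 1) p"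
  using closed_q[of p 1 \<i>] by (simp add: extD_def)

lemma q_mult: "p \<in> chart_dom \<Longrightarrow> q c p 1 = qcoef (1, 0) p" "p \<in> chart_dom \<Longrightarrow> q c p \<i> = qcoef (0, 1) p"
  using q_eq[of p 1] q_eq[of p \<i>] by simp_all

text \<open>Write k_ij \<sigma> for the value of q in the real direction i on the derivative of
  \<sigma> in the direction j. Then q_z B is (k11 + k22 + \<i> (k12 - k21)) \<sigma> / 4, and it
  suffices to extract k12 = k21 and k11 = - k22 from two entries of the closedness equation.\<close>

lemma closed_form_q:
  assumes p: "p \<in> chart_dom" shows "qcoef dz p *v B p = 0"
proof -
  have p': "p \<in> cdom c" using p by simp
  obtain M where M: "\<And>X w. mdirder w (in_chart c (\<lambda>x. q c x X)) (M X w) (snd c p)"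
    using mdirder_q[OF p] by metis
  have inS: "pdw w c \<sigma> p \<in> S p" for w
  proof -
    have "pdw w c \<sigma> p = (fst w - \<i> * snd w) *s B p + (fst w + \<i> * snd w) *s Z p"
      by (simp add: pdw_def pdz_def pdzbar_def vec_eq_iff field_simps)
    then show ?thesis unfolding bundles(3)[OF p]
      by (simp only:) (intro vec.span_add vec.span_scale vec.span_base; simp)
  qed
  have prod: "vdirder w (in_chart c (\<lambda>x. q c x Y *v u x)) (M Y w *v u p + q c p Y *v pdw w c u p) (snd c p)"
    if "smooth_near c p u" for u Y w
    using vdirder_mult_vec[OF M pd_vdirder[OF c p' that], of w Y] p'
    by (simp add: in_chart_apply[OF c]) (simp add: in_chart_def)
  define \<sigma>1 \<sigma>2 where "\<sigma>1 = pdw (1, 0) c \<sigma>" and "\<sigma>2 = pdw (0, 1) c \<sigma>"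
  obtain k11 where k11: "q c p 1 *v \<sigma>1 p = k11 *s \<sigma> p" using qcoef_deriv[OF p] q_mult[OF p] unfolding \<sigma>1_def by metis
  obtain k12 where k12: "q c p 1 *v \<sigma>2 p = k12 *s \<sigma> p" using qcoef_deriv[OF p] q_mult[OF p] unfolding \<sigma>2_def by metis
  obtain k21 where k21: "q c p \<i> *v \<sigma>1 p = k21 *s \<sigma> p" using qcoef_deriv[OF p] q_mult[OF p] unfolding \<sigma>1_def by metis
  obtain k22 where k22: "q c p \<i> *v \<sigma>2 p = k22 *s \<sigma> p" using qcoef_deriv[OF p] q_mult[OF p] unfolding \<sigma>2_def by metis
  \<comment> \<open>Differentiate q \<sigma> = 0.\<close>
  have M\<sigma>: "M Y w *v \<sigma> p = - (q c p Y *v pdw w c \<sigma> p)" for Y w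
  proof -
    have "eventually (\<lambda>x. 0 = in_chart c (\<lambda>x. q c x Y *v \<sigma> x) x) (nhds (snd c p))"
      using in_chart_eventually_eq[OF c p' U, of "\<lambda>x. 0" "\<lambda>x. q c x Y *v \<sigma> x"] p q_eq qcoef_\<sigma>
      by (simp add: in_chart_def)
    from vdirder_unique[OF prod[OF near[OF p]] vdirder_cong[OF this vdirder_const]]
    show ?thesis by (simp only: eq_neg_iff_add_eq_0)
  qed
  \<comment> \<open>Pairing with \<open>T\<close> detects the coefficient of \<sigma>, since
    (\<sigma>, T) = - h is nonzero.\<close>
  have "mform (DEnd S c 1 (\<lambda>x. q c x \<i>) p *v \<sigma> p) (T p) = mform (DEnd S c \<i> (\<lambda>x. q c x 1) p *v \<sigma> p) (T p)"
    by (simp add: extD_q[OF p])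
  then have "k21 * mform (\<sigma> p) (T p) = k12 * mform (\<sigma> p) (T p)"
    using k21 k12 unfolding DEnd_pair[OF p M in_S(1,4)[OF p]] \<sigma>1_def \<sigma>2_def
    by (simp add: M\<sigma> mform_linear)
  then have k: "k21 = k12" using frame_products(5)[OF p] h_nonzero[OF p] by simp
  have deriv2: "mform (\<sigma> p) (pdw w c (pdw w' c \<sigma>) p) = - mform (pdw w c \<sigma> p) (pdw w' c \<sigma> p)" for w w'
    using mform_deriv_zero[OF c p' U _ near[OF p] near'[OF p], of w' w] p orth_deriv
    by (simp add: eq_neg_iff_add_eq_0 add.commute)
  \<comment> \<open>Differentiate (q \<sigma>1, \<sigma>2) = 0, which holds because q \<sigma>1 is a
    multiple of \<sigma> and \<sigma>2 is orthogonal to it.\<close>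
  have Mpair: "mform (M Y w *v \<sigma>1 p) (\<sigma>2 p) = mform (pdw w c \<sigma>1 p) (q c p Y *v \<sigma>2 p)
      - mform (q c p Y *v \<sigma>1 p) (pdw w c \<sigma>2 p)" for Y w
  proof -
    have "dirder w (\<lambda>x. mform (in_chart c (\<lambda>x. q c x Y *v \<sigma>1 x) x) (in_chart c \<sigma>2 x))
      (mform (M Y w *v \<sigma>1 p + q c p Y *v pdw w c \<sigma>1 p) (in_chart c \<sigma>2 (snd c p))
        + mform (in_chart c (\<lambda>x. q c x Y *v \<sigma>1 x) (snd c p)) (pdw w c \<sigma>2 p)) (snd c p)"
      unfolding \<sigma>1_def \<sigma>2_def by (intro dirder_mform prod pd_vdirder c near' p p')
    moreover have "eventually (\<lambda>x. 0 = mform (in_chart c (\<lambda>x. q c x Y *v \<sigma>1 x) x) (in_chart c \<sigma>2 x)) (nhds (snd c p))"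
    proof -
      have "mform (q c x Y *v \<sigma>1 x) (\<sigma>2 x) = 0" if x: "x \<in> chart_dom" for x
      proof -
        obtain k where "q c x Y *v \<sigma>1 x = k *s \<sigma> x"
          using qcoef_deriv[OF x] q_eq[OF x] unfolding \<sigma>1_def by metis
        then show ?thesis using orth_deriv[OF x] by (simp add: \<sigma>2_def mform_linear)
      qed
      then show ?thesis
        using in_chart_eventually_eq[OF c p' U, of "\<lambda>x. 0" "\<lambda>x. mform (q c x Y *v \<sigma>1 x) (\<sigma>2 x)"] p
        by (simp add: in_chart_def)
    qed
    from dirder_cong[OF this dirder_const]
    have "dirder w (\<lambda>x. mform (in_chart c (\<lambda>x. q c x Y *v \<sigma>1 x) x) (in_chart c \<sigma>2 x)) 0 (snd c p)" .
    ultimately have "mform (M Y w *v \<sigma>1 p + q c p Y *v pdw w c \<sigma>1 p) (in_chart c \<sigma>2 (snd c p))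
        + mform (in_chart c (\<lambda>x. q c x Y *v \<sigma>1 x) (snd c p)) (pdw w c \<sigma>2 p) = 0"
      by (rule dirder_unique)
    moreover have "mform (q c p Y *v x) y = - mform x (q c p Y *v y)" for x y
      using skewD[OF skew_qcoef[OF p]] q_eq[OF p, of Y] by simp
    ultimately show ?thesis using p'
      by (simp add: in_chart_apply[OF c] mform_linear algebra_simps)
  qed
  define g where "g = mform (\<sigma>1 p) (\<sigma>1 p)"
  have g: "g \<noteq> 0" "mform (\<sigma>2 p) (\<sigma>2 p) = g" "mform (\<sigma>1 p) (\<sigma>2 p) = 0" "mform (\<sigma>2 p) (\<sigma>1 p) = 0"
    using metric[OF p] mform_commute[of "\<sigma>1 p" "\<sigma>2 p"]
    by (simp_all add: g_def \<sigma>1_def \<sigma>2_def pdw_def)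
  have "mform (DEnd S c 1 (\<lambda>x. q c x \<i>) p *v \<sigma>1 p) (\<sigma>2 p) = mform (DEnd S c \<i> (\<lambda>x. q c x 1) p *v \<sigma>1 p) (\<sigma>2 p)"
    by (simp add: extD_q[OF p])
  then have Meq: "mform (M \<i> (1, 0) *v \<sigma>1 p) (\<sigma>2 p) = mform (M 1 (0, 1) *v \<sigma>1 p) (\<sigma>2 p)"
    unfolding \<sigma>1_def \<sigma>2_def DEnd_pair[OF p M inS inS] by simp
  have e: "mform (pdw w c (pdw w' c \<sigma>) p) (\<sigma> p) = - mform (pdw w c \<sigma> p) (pdw w' c \<sigma> p)" for w w'
    using deriv2[of w w'] by (subst mform_commute)
  have "mform (pdw w c \<sigma>1 p) (\<sigma> p) = - mform (pdw w c \<sigma> p) (\<sigma>1 p)"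
    "mform (\<sigma> p) (pdw w c \<sigma>2 p) = - mform (pdw w c \<sigma> p) (\<sigma>2 p)"
    "mform (pdw w c \<sigma>2 p) (\<sigma> p) = - mform (pdw w c \<sigma> p) (\<sigma>2 p)" for w
    using e deriv2 by (simp_all add: \<sigma>1_def \<sigma>2_def)
  note d = this
  have "mform (M \<i> (1, 0) *v \<sigma>1 p) (\<sigma>2 p) = - (k22 * g)"
    unfolding Mpair k22 k21 mform_linear d using g g_def by (simp add: \<sigma>1_def \<sigma>2_def)
  moreover have "mform (M 1 (0, 1) *v \<sigma>1 p) (\<sigma>2 p) = k11 * g"
    unfolding Mpair k11 k12 mform_linear d using g by (simp add: \<sigma>1_def \<sigma>2_def)
  ultimately have "- (k22 * g) = k11 * g" using Meq by simp
  then have "g * (k11 + k22) = 0" by algebra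
  then have k': "k22 = - k11" using g(1) by (simp add: eq_neg_iff_add_eq_0 add.commute)
  have Bp: "B p = (1/2) *s (\<sigma>1 p + \<i> *s \<sigma>2 p)"
    by (simp add: pdzbar_def \<sigma>1_def \<sigma>2_def pdw_def)
  have "qcoef dz p *v B p = (1/4) *s (k11 *s \<sigma> p + k22 *s \<sigma> p + \<i> *s (k12 *s \<sigma> p - k21 *s \<sigma> p))"
    unfolding k11[symmetric] k12[symmetric] k21[symmetric] k22[symmetric] Bp
    by (simp add: qcoef_def mat_apply vec_linear vec_eq_iff algebra_simps)
  then show ?thesis by (simp add: k k')
qed

lemma at_dz_q: "at_dz q c p = qcoef dz p"
  by (simp add: at_dz_def qcoef_def vec_eq_iff right_diff_distrib)

text \<open>Applying q_z to \<open>B\<close> isolates its \<open>Z\<close>-coefficient times h, and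
  \<open>closed_form_q\<close> makes this zero.\<close>

lemma qcoef_dz_form:
  assumes p: "p \<in> chart_dom" obtains y where "qcoef dz p = wedge (\<sigma> p) (y *s B p)"
proof -
  obtain x y where xy: "qcoef dz p = wedge (\<sigma> p) (x *s Z p + y *s B p)" using qcoef_form[OF p] .
  have "x * h p *s \<sigma> p = 0"
    using closed_form_q[OF p] frame_products[OF p] frame_products'[OF p]
    by (simp add: xy wedge_apply mform_linear)
  then have "x = 0" using h_nonzero[OF p] sec[of p] p by auto
  then show thesis using that xy by simp
qed

end

section \<open>The simple factors\<close>

lemma skew_dressing:
  assumes "skew D" shows "mform (dressing s D t *v x) y = mform x (dressing s D (- t) *v y)"
  by (simp add: dressing_def mat_apply mform_linear skewD[OF assms])

text \<open>One fibre of the situation: \<open>R\<close> is an explicit matrix for \<rho>, an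
  involution that is symmetric, hence orthogonal, for the form.\<close>

locale reflection =
  fixes S :: "'n::finite cvec set" and R :: "'n cmat"
  assumes rho: "rho S = R" and RR: "R *v (R *v x) = x"
    and R_sym: "mform (R *v u) v = mform u (R *v v)"
begin

lemma rhoL_span: "rhoL S (vec.span {l}) = vec.span {R *v l}"
  unfolding rhoL_def rho by (auto simp: vec.span_singleton mult_vec_smult image_iff)

lemma orth_pair:
  "v \<in> orth (vec.span {l} \<union> rhoL S (vec.span {l})) \<longleftrightarrow> mform v l = 0 \<and> mform v (R *v l) = 0"
proof -
  have "orth (X \<union> Y) = orth X \<inter> orth Y" for X Y :: "'n cvec set" by (auto simp: orth_def)
  then show ?thesis unfolding rhoL_span by (simp add: orth_span)
qed

text \<open>If \<open>l\<close> and \<open>R *v l\<close> were orthogonal, the latter would be a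
  nonzero element of the intersection assumed trivial.\<close>

lemma null_pairI:
  assumes "mform l l = 0" "l \<noteq> 0" "rhoL S (vec.span {l}) \<inter> orth (vec.span {l}) = {0}"
  shows "null_pair l (R *v l)"
proof
  show "mform l l = 0" by fact
  show "mform (R *v l) (R *v l) = 0" using assms(1) by (simp add: R_sym RR)
  show "mform l (R *v l) \<noteq> 0"
  proof
    assume "mform l (R *v l) = 0"
    then have "R *v l \<in> rhoL S (vec.span {l}) \<inter> orth (vec.span {l})"
      unfolding rhoL_span using mform_commute[of l "R *v l"] by (simp add: orth_span vec.span_base)
    then have "R *v l = 0" using assms(3) by blast
    then show False using RR[of l] assms(2) by simp
  qed
qed

text \<open>\<open>R\<close> exchanges the two vectors, and exchanging the arguments of
  \<open>line_rot\<close> changes its sign.\<close>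

lemma line_rot_R: "R *v (line_rot l (R *v l) *v x) = - (line_rot l (R *v l) *v (R *v x))"
  by (simp add: line_rot_apply vec_linear RR R_sym vec_eq_iff algebra_simps)

lemma dressing_R:
  assumes "\<And>x. R *v (D *v x) = - (D *v (R *v x))"
  shows "R *v (dressing s D t *v x) = dressing s D (- t) *v (R *v x)"
  by (simp add: dressing_def mat_apply vec_linear assms)

end

locale reflection_pair = reflection S R for S :: "'n::finite cvec set" and R +
  fixes l :: "'n cvec"
  assumes np: "null_pair l (R *v l)"
begin

sublocale null_pair l "R *v l" by (rule np)

definition Pl :: "'n cmat" where "Pl = mscale (1 / mform l (R *v l)) (outer l (R *v l))"
definition Pk :: "'n cmat" where "Pk = mscale (1 / mform l (R *v l)) (outer (R *v l) l)"

lemma Pl_apply: "Pl *v x = (mform x (R *v l) / mform l (R *v l)) *s l"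
  by (simp add: Pl_def mat_apply outer_apply)

lemma Pk_apply: "Pk *v x = (mform x l / mform l (R *v l)) *s (R *v l)"
  by (simp add: Pk_def mat_apply outer_apply)

lemma kl: "mform (R *v l) l = mform l (R *v l)" by (rule mform_commute)

lemma orth_rest: "x - Pl *v x - Pk *v x \<in> orth (vec.span {l} \<union> rhoL S (vec.span {l}))"
  unfolding orth_pair using lk ll kk by (simp add: Pl_apply Pk_apply mform_linear kl)

lemma Pl_in: "Pl *v x \<in> vec.span {l}" and Pk_in: "Pk *v x \<in> rhoL S (vec.span {l})"
  unfolding rhoL_span Pl_apply Pk_apply by (intro vec.span_scale vec.span_base; simp)+

lemma Pl_l: "v \<in> vec.span {l} \<Longrightarrow> Pl *v v = v" "v \<in> vec.span {l} \<Longrightarrow> Pk *v v = 0"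
  using lk ll by (auto simp: Pl_apply Pk_apply vec.span_singleton mform_linear)

lemma Pk_k: "v \<in> rhoL S (vec.span {l}) \<Longrightarrow> Pk *v v = v" "v \<in> rhoL S (vec.span {l}) \<Longrightarrow> Pl *v v = 0"
  unfolding rhoL_span using lk kk
  by (auto simp: Pl_apply Pk_apply vec.span_singleton mform_linear kl)

lemma P_orth: "v \<in> orth (vec.span {l} \<union> rhoL S (vec.span {l})) \<Longrightarrow> Pl *v v = 0 \<and> Pk *v v = 0"
  unfolding orth_pair by (simp add: Pl_apply Pk_apply)

lemma kernel_span:
  fixes P :: "'n cmat"
  assumes "\<And>v. v \<in> X \<Longrightarrow> P *v v = 0" "v \<in> vec.span X" shows "P *v v = 0"
proof -
  have "vec.span X \<subseteq> {v. P *v v = 0}"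
    by (rule vec.span_minimal) (use assms(1) in \<open>auto simp: vec.subspace_def vec_linear\<close>)
  then show ?thesis using assms(2) by blast
qed

lemma pi_L_eq: "pi_L S (vec.span {l}) = Pl"
  unfolding pi_L_def
proof (rule proj_along_eq)
  fix x
  have "x - Pl *v x = Pk *v x + (x - Pl *v x - Pk *v x)" by simp
  then show "x - Pl *v x \<in> vec.span (rhoL S (vec.span {l}) \<union> orth (vec.span {l} \<union> rhoL S (vec.span {l})))"
    using orth_rest[of x] Pk_in[of x] by (metis UnI1 UnI2 vec.span_add vec.span_base)
next
  show "v \<in> vec.span (rhoL S (vec.span {l}) \<union> orth (vec.span {l} \<union> rhoL S (vec.span {l}))) \<Longrightarrow> Pl *v v = 0" for v
    by (erule kernel_span[rotated]) (use Pk_k P_orth in blast)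
qed (auto simp: Pl_in Pl_l)

lemma pi_rhoL_eq: "pi_rhoL S (vec.span {l}) = Pk"
  unfolding pi_rhoL_def
proof (rule proj_along_eq)
  fix x
  have "x - Pk *v x = Pl *v x + (x - Pl *v x - Pk *v x)" by simp
  then show "x - Pk *v x \<in> vec.span (vec.span {l} \<union> orth (vec.span {l} \<union> rhoL S (vec.span {l})))"
    using orth_rest[of x] Pl_in[of x] by (metis UnI1 UnI2 vec.span_add vec.span_base)
next
  show "v \<in> vec.span (vec.span {l} \<union> orth (vec.span {l} \<union> rhoL S (vec.span {l}))) \<Longrightarrow> Pk *v v = 0" for v
    by (erule kernel_span[rotated]) (use Pl_l P_orth in blast)
qed (auto simp: Pk_in Pk_k)

lemma pi_perp_eq: "pi_perp S (vec.span {l}) = mat 1 - Pl - Pk"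
  unfolding pi_perp_def
proof (rule proj_along_eq)
  fix x
  have "x - (mat 1 - Pl - Pk) *v x = Pl *v x + Pk *v x" by (simp add: mat_apply)
  then show "x - (mat 1 - Pl - Pk) *v x \<in> vec.span (vec.span {l} \<union> rhoL S (vec.span {l}))"
    using Pk_in[of x] Pl_in[of x] by (metis UnI1 UnI2 vec.span_add vec.span_base)
next
  show "v \<in> vec.span (vec.span {l} \<union> rhoL S (vec.span {l})) \<Longrightarrow> (mat 1 - Pl - Pk) *v v = 0" for v
    by (erule kernel_span[rotated]) (use Pl_l Pk_k in \<open>auto simp: mat_apply\<close>)
qed (use orth_rest P_orth in \<open>auto simp: mat_apply\<close>)

lemma rot_P: "\<Delta> *v x = Pl *v x - Pk *v x"
  unfolding line_rot_apply Pl_apply Pk_apply by (simp add: vec_eq_iff algebra_simps)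

lemma PP: "Pl *v (Pl *v y) = Pl *v y" "Pk *v (Pk *v y) = Pk *v y" "Pl *v (Pk *v y) = 0" "Pk *v (Pl *v y) = 0"
  using Pl_l[OF Pl_in] Pk_k[OF Pk_in] by auto

lemma dress_p_0: "a \<noteq> 0 \<Longrightarrow> dress_p S a (vec.span {l}) (Fin 0) = mat 1"
  by (simp add: pi_L_eq pi_perp_eq pi_rhoL_eq matrix_eq mat_apply)

lemma dress_p_eq:
  assumes "a \<noteq> 0" "x \<noteq> 0" "x \<noteq> a" "x \<noteq> - a"
  shows "dress_p S a (vec.span {l}) (Fin x) = dressing (1 / a) \<Delta> (1 / x)"
proof -
  have n: "a + x \<noteq> 0" "a - x \<noteq> 0" "a\<^sup>2 - x\<^sup>2 \<noteq> 0"
    using assms by (auto simp: power2_eq_iff eq_neg_iff_add_eq_0 add.commute)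
  define e where "e = 1 / ((1 / x)\<^sup>2 - (1 / a)\<^sup>2)"
  have e: "e = a\<^sup>2 * x\<^sup>2 / (a\<^sup>2 - x\<^sup>2)" using assms n(3) by (simp add: e_def field_simps)
  have 1: "(a - x) / (a + x) = 1 + e * (- (2 * (1 / a) * (1 / x)) + 2 * (1 / a)\<^sup>2)"
  proof -
    have "a\<^sup>2 - x\<^sup>2 = (a + x) * (a - x)" by (simp add: power2_eq_square algebra_simps)
    then show ?thesis using assms n unfolding e by (simp add: divide_simps) (simp add: power2_eq_square algebra_simps)
  qed
  have 2: "(a + x) / (a - x) = 1 + e * (2 * (1 / a) * (1 / x) + 2 * (1 / a)\<^sup>2)"
  proof -
    have "a\<^sup>2 - x\<^sup>2 = (a + x) * (a - x)" by (simp add: power2_eq_square algebra_simps)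
    then show ?thesis using assms n unfolding e by (simp add: divide_simps) (simp add: power2_eq_square algebra_simps)
  qed
  show ?thesis
    unfolding dress_p.simps pi_L_eq pi_perp_eq pi_rhoL_eq 1 2 dressing_def e_def[symmetric]
    by (simp add: matrix_eq mat_apply rot_P vec_linear PP vec_eq_iff algebra_simps)
qed

text \<open>The value of the factor p at infinity: -1 on both lines and 1 on their orthogonal
  complement. On the lines the coefficients of q at finite parameters are the negatives of those of
  p, so \<open>q0\<close> accounts for the difference.\<close>

definition q0 :: "'n cmat" where "q0 = mat 1 - mscale 2 (\<Delta> ** \<Delta>)"

lemma q0_apply: "q0 *v x = x - 2 *s (\<Delta> *v (\<Delta> *v x))"
  by (simp add: q0_def mat_apply)

lemma q0_q0: "q0 *v (q0 *v x) = x"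
  by (simp add: q0_apply vec_linear rot3 vec_eq_iff)

lemma q0_sym: "mform (q0 *v x) y = mform x (q0 *v y)"
  by (simp add: q0_apply mform_linear skewD[OF skew_rot])

lemma q0_R: "R *v (q0 *v x) = q0 *v (R *v x)"
  by (simp add: q0_apply vec_linear line_rot_R)

lemma dress_q_eq:
  "dress_q S a (vec.span {l}) (Fin x) = q0 ** dress_p S a (vec.span {l}) (Fin x)"
proof -
  have "x - a = - (a - x)" "x + a = a + x" by simp_all
  then have m: "(x - a) / (x + a) = - ((a - x) / (a + x))" "(x + a) / (x - a) = - ((a + x) / (a - x))"
    by (simp_all only: minus_divide_left[symmetric] minus_divide_right[symmetric])
  show ?thesis
    unfolding dress_q.simps dress_p.simps m pi_L_eq pi_perp_eq pi_rhoL_eq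
    by (simp add: matrix_eq mat_apply q0_apply rot_P vec_linear PP vec_eq_iff algebra_simps)
qed

end

context reflection
begin

text \<open>With p1, p2 the factors of \<open>D1\<close>, \<open>D2\<close>: the tilde line is
  \<open>q0\<close> applied to the dressed line \<open>l2\<close>, so its simple factor is q0 p2 q0,
  and r* at 1 is (q0 p2 q0) (q0 p1) = q0 p2 p1. At 0 both factors of type p are the identity, which
  leaves \<open>q0\<close>.\<close>

lemma r_star_factors:
  assumes \<alpha>: "\<alpha> \<noteq> 0" "cmod \<alpha> \<noteq> 1" and l: "mform l l = 0" "l \<noteq> 0"
    and np1: "null_pair (vcnj l) (R *v vcnj l)"
    and cond: "rhoL S (L_tilde S \<alpha> (vec.span {l})) \<inter> orth (L_tilde S \<alpha> (vec.span {l})) = {0}"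
  defines "D1 \<equiv> line_rot (vcnj l) (R *v vcnj l)"
  defines "l2 \<equiv> dressing (cnj \<alpha>) D1 (1 / \<alpha>) *v l"
    and "k2 \<equiv> dressing (cnj \<alpha>) D1 (- (1 / \<alpha>)) *v (R *v l)"
  defines "D2 \<equiv> line_rot l2 k2"
  shows "null_pair l2 k2" "R *v l2 = k2"
    and "\<exists>Q. Q ** Q = mat 1 \<and> r_star S \<alpha> (vec.span {l}) (Fin 0) = Q \<and>
      r_star S \<alpha> (vec.span {l}) (Fin 1) = Q ** (dressing (1 / \<alpha>) D2 1 ** dressing (cnj \<alpha>) D1 1)"
    and "(\<alpha>\<^sup>2 * (cnj \<alpha>)\<^sup>2 \<noteq> 1)" "\<alpha>\<^sup>2 \<noteq> 1"
proof -
  interpret a: reflection_pair S R "vcnj l"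
    by (intro reflection_pair.intro reflection_axioms reflection_pair_axioms.intro np1)
  \<comment> \<open>The pole of the first factor; its reciprocal cnj \<alpha> is the parameter s of
    the first dressing, as 1 / \<alpha> is that of the second.\<close>
  define a where "a = inverse (cnj \<alpha>)"
  have ca: "cmod a = inverse (cmod \<alpha>)" by (simp add: a_def norm_inverse)
  have a0: "a \<noteq> 0" "1 / a = cnj \<alpha>" using \<alpha> by (simp_all add: a_def inverse_eq_divide)
  have one: "(1::complex) \<noteq> a" "(1::complex) \<noteq> - a" "(1::complex) \<noteq> \<alpha>" "(1::complex) \<noteq> - \<alpha>"
    using ca \<alpha>(2) by (metis inverse_1 inverse_inverse_eq norm_minus_cancel norm_one)+
  have cm: "cmod \<alpha> \<noteq> cmod a"
  proof
    assume "cmod \<alpha> = cmod a"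
    then have "(cmod \<alpha>)\<^sup>2 = 1" using ca \<alpha>(1) by (simp add: power2_eq_square field_simps)
    then show False using \<alpha>(2) norm_ge_zero[of \<alpha>] by (auto simp: power2_eq_1_iff simp del: norm_ge_zero)
  qed
  then have aa: "\<alpha> \<noteq> a" "\<alpha> \<noteq> - a" by auto
  have vc: "vcnj ` vec.span {l} = vec.span {vcnj l}"
  proof -
    have "vcnj (k *s l) = cnj k *s vcnj l" for k by (simp add: vec_eq_iff)
    then show ?thesis by (auto simp: vec.span_singleton image_iff) (metis complex_cnj_cnj)
  qed
  have p\<alpha>: "dress_p S a (vec.span {vcnj l}) (Fin \<alpha>) = dressing (cnj \<alpha>) D1 (1 / \<alpha>)"
    using a.dress_p_eq[OF a0(1) \<alpha>(1) aa] a0(2) by (simp add: D1_def)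
  have p1: "dress_p S a (vec.span {vcnj l}) (Fin 1) = dressing (cnj \<alpha>) D1 1"
    using a.dress_p_eq[OF a0(1) _ one(1,2)] a0(2) by (simp add: D1_def)
  define lt where "lt = a.q0 *v l2"
  have Lt: "L_tilde S \<alpha> (vec.span {l}) = vec.span {lt}"
    unfolding L_tilde_def vc a_def[symmetric] a.dress_q_eq p\<alpha>
    by (auto simp: vec.span_singleton image_iff lt_def l2_def mat_apply vec_linear)
  have n1: "1 / \<alpha>\<^sup>2 \<noteq> (cnj \<alpha>)\<^sup>2"
  proof
    assume "1 / \<alpha>\<^sup>2 = (cnj \<alpha>)\<^sup>2"
    then have "\<alpha>\<^sup>2 = a\<^sup>2" using \<alpha>(1) by (simp add: a_def field_simps)
    then show False using aa by (simp add: power2_eq_iff)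
  qed
  then show "\<alpha>\<^sup>2 * (cnj \<alpha>)\<^sup>2 \<noteq> 1" using \<alpha>(1) by (auto simp: field_simps)
  show "\<alpha>\<^sup>2 \<noteq> 1" using one by (auto simp: power2_eq_1_iff)
  have inv: "dressing (cnj \<alpha>) D1 (- (1 / \<alpha>)) *v (dressing (cnj \<alpha>) D1 (1 / \<alpha>) *v x) = x" for x
    using dressing_inverse[of D1 "- (1 / \<alpha>)" "cnj \<alpha>"] a.rot3 n1
    by (simp add: D1_def matrix_vector_mul_assoc power_divide)
  have l20: "l2 \<noteq> 0" using inv[of l] l(2) by (auto simp: l2_def)
  have null2: "mform l2 l2 = 0"
    using inv l(1) unfolding l2_def by (simp add: skew_dressing[OF a.skew_rot] D1_def)
  show k2: "R *v l2 = k2"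
    unfolding l2_def k2_def by (rule dressing_R) (simp add: D1_def line_rot_R)
  have np2: "null_pair lt (R *v lt)"
  proof (rule null_pairI)
    show "mform lt lt = 0" using null2 by (simp add: lt_def a.q0_sym a.q0_q0)
    show "lt \<noteq> 0" using l20 a.q0_q0[of l2] by (auto simp: lt_def)
    show "rhoL S (vec.span {lt}) \<inter> orth (vec.span {lt}) = {0}" using cond by (simp add: Lt)
  qed
  interpret b: reflection_pair S R lt
    by (intro reflection_pair.intro reflection_axioms reflection_pair_axioms.intro np2)
  have Rlt: "R *v lt = a.q0 *v k2" by (simp add: lt_def a.q0_R k2)
  have mlt: "mform lt (R *v lt) = mform l2 k2"
    unfolding Rlt unfolding lt_def by (simp add: a.q0_sym a.q0_q0)
  show "null_pair l2 k2"
    using null2 b.lk mlt by unfold_locales (auto simp: R_sym RR simp flip: k2)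
  \<comment> \<open>Conjugation by \<open>q0\<close> carries \<open>l2\<close>, \<open>k2\<close> to
    the pair attached to the tilde line and preserves the form.\<close>
  have rot: "b.\<Delta> *v x = a.q0 *v (D2 *v (a.q0 *v x))" for x
    unfolding D2_def line_rot_apply mlt
    unfolding Rlt unfolding lt_def by (simp add: vec_linear flip: a.q0_sym)
  have dr: "dressing s b.\<Delta> t *v x = a.q0 *v (dressing s D2 t *v (a.q0 *v x))" for s t x
    unfolding dressing_def by (simp add: mat_apply rot vec_linear a.q0_q0)
  have "r_star S \<alpha> (vec.span {l}) (Fin 0) = a.q0"
    unfolding r_star_def Lt vc a_def[symmetric] a.dress_q_eq a.dress_p_0[OF a0(1)] b.dress_p_0[OF \<alpha>(1)]
    by simp
  moreover have "r_star S \<alpha> (vec.span {l}) (Fin 1) = a.q0 ** (dressing (1 / \<alpha>) D2 1 ** dressing (cnj \<alpha>) D1 1)"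
    unfolding r_star_def Lt vc a_def[symmetric] a.dress_q_eq p1
    using b.dress_p_eq[OF \<alpha>(1) _ one(3,4)]
    by (simp add: matrix_eq mat_apply dr a.q0_q0)
  moreover have "a.q0 ** a.q0 = mat 1" by (simp add: matrix_eq mat_apply a.q0_q0)
  ultimately show "\<exists>Q. Q ** Q = mat 1 \<and> r_star S \<alpha> (vec.span {l}) (Fin 0) = Q \<and>
      r_star S \<alpha> (vec.span {l}) (Fin 1) = Q ** (dressing (1 / \<alpha>) D2 1 ** dressing (cnj \<alpha>) D1 1)" by blast
qed

end

section \<open>The transformed multiplier\<close>

lemma matrix_inv_eqI:
  fixes P :: "'n::finite cmat"
  assumes "P ** Q = mat 1" shows "matrix_inv P = Q"
proof -
  have QP: "Q ** P = mat 1" using assms matrix_left_right_inverse by blast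
  have "P ** matrix_inv P = mat 1 \<and> matrix_inv P ** P = mat 1"
    unfolding matrix_inv_def by (rule someI[of _ Q]) (use assms QP in simp)
  then show ?thesis using assms by (metis matrix_mul_assoc matrix_mul_lid matrix_mul_rid)
qed

lemma part_dz:
  assumes \<omega>: "\<And>X. \<omega> c p X = C (of_real (Re X), of_real (Im X))"
    and C: "\<And>w v. C w *v v = fst w *s (C (1, 0) *v v) + snd w *s (C (0, 1) *v (v :: 'n::finite cvec))"
  shows "part10 \<omega> c p 1 *v v = C dz *v v" "part10 \<omega> c p \<i> *v v = \<i> *s (C dz *v v)"
    "part01 \<omega> c p 1 *v v = C dzbar *v v" "part01 \<omega> c p \<i> *v v = (- \<i>) *s (C dzbar *v v)"
  unfolding part10_def part01_def \<omega>
  by (simp_all add: mat_apply C[of dz v] C[of dzbar v] C[of "(-1, 0)" v] vec_eq_iff algebra_simps)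

context cw_frame
begin

lemma qcoef_linear: "qcoef w p *v v = fst w *s (qcoef (1, 0) p *v v) + snd w *s (qcoef (0, 1) p *v v)"
  by (simp add: qcoef_def mat_apply)

text \<open>Replacing \<D> by d - \<N> lowers the coefficients of \<N> by one. The first identity
  describes L at t = 1 / \<alpha>; the conjugate of the second will describe cnj L at t = cnj
  \<alpha>.\<close>

lemma spectral_dz:
  fixes \<alpha> :: complex
  assumes p: "p \<in> chart_dom" and l: "smooth_near c p l"
  defines "D \<equiv> \<lambda>X. spectral_connection S q \<alpha> c X l p"
  shows "(1/2) *s (D 1 - \<i> *s D \<i>) = pdw dz c l p + (1 / \<alpha> - 1) *s (Ncoef dz p *v l p)
      + ((1 / \<alpha>)\<^sup>2 - 1) *s (qcoef dz p *v l p)"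
    and "(1/2) *s (D 1 + \<i> *s D \<i>) = pdw dzbar c l p + (\<alpha> - 1) *s (Ncoef dzbar p *v l p)
      + (\<alpha>\<^sup>2 - 1) *s (qcoef dzbar p *v l p)"
proof -
  have p': "p \<in> cdom c" using p by simp
  note N = part_dz[of "Nform S" c p "\<lambda>w. Ncoef w p", OF Nform_eq[OF p] Ncoef_linear[OF p]]
  note Q = part_dz[of q c p "\<lambda>w. qcoef w p", OF q_eq[OF p] qcoef_linear]
  note D = Dconn_eq[OF p pd_vdirder[OF c p' l]]
  have N1: "Ncoef (1, 0) p *v v = Ncoef dz p *v v + Ncoef dzbar p *v v"
    "Ncoef (0, 1) p *v v = \<i> *s (Ncoef dz p *v v - Ncoef dzbar p *v v)" for v
    by (simp_all add: Ncoef_linear[OF p, of dz v] Ncoef_linear[OF p, of dzbar v])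
      (simp_all add: vec_eq_iff algebra_simps)
  have P: "pdw (1, 0) c l p = pdw dz c l p + pdw dzbar c l p"
    "pdw (0, 1) c l p = \<i> *s (pdw dz c l p - pdw dzbar c l p)"
    by (simp_all add: pdw_def vec_eq_iff algebra_simps)
  show "(1/2) *s (D 1 - \<i> *s D \<i>) = pdw dz c l p + (1 / \<alpha> - 1) *s (Ncoef dz p *v l p)
      + ((1 / \<alpha>)\<^sup>2 - 1) *s (qcoef dz p *v l p)"
    unfolding D_def spectral_connection_def N Q D
    by (simp add: N1 P vec_eq_iff power_divide algebra_simps)
  show "(1/2) *s (D 1 + \<i> *s D \<i>) = pdw dzbar c l p + (\<alpha> - 1) *s (Ncoef dzbar p *v l p)
      + (\<alpha>\<^sup>2 - 1) *s (qcoef dzbar p *v l p)"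
    unfolding D_def spectral_connection_def N Q D
    by (simp add: N1 P vec_eq_iff algebra_simps)
qed

lemma reflection_at: "x \<in> chart_dom \<Longrightarrow> reflection (S x) (refl x)"
  by unfold_locales (simp_all add: rho_eq refl_refl refl_sym)

text \<open>The derivative of \<rho> is 2 N \<rho>. As \<rho> anticommutes with \<open>N\<close>,
  this extra term turns the coefficient t - 1 of \<open>N\<close> into - t - 1; the coefficient t^2
  - 1 of q is unchanged.\<close>

lemma refl_parallel:
  assumes p: "p \<in> chart_dom"
    and u: "vdirder dz u (b *s u (snd c p) - pencil (qcoef dz p) (Ncoef dz p) (- qcoef dz p - Ncoef dz p) t *v u (snd c p)) (snd c p)"
  defines "v \<equiv> \<lambda>y. in_chart c refl y *v u y"
  shows "vdirder dz v (b *s v (snd c p) - pencil (qcoef dz p) (Ncoef dz p) (- qcoef dz p - Ncoef dz p) (- t) *v v (snd c p)) (snd c p)"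
proof -
  have r: "in_chart c refl (snd c p) = refl p" using p by (simp add: in_chart_apply[OF c])
  have "mdirder dz (in_chart c refl) (mscale 2 (dsphere dz p)) (snd c p)"
    using mdirder_diff[OF mdirder_cmscale[OF mdirder_sphere[OF p]] mdirder_const]
    by (simp add: refl_def[abs_def] in_chart_def)
  note vdirder_mult_vec[OF this u]
  then show ?thesis
    unfolding v_def r
    by (rule back_subst[of "\<lambda>a. vdirder dz _ a _"])
      (simp add: pencil_apply mat_apply vec_linear dsphere_eq[OF p] refl_Ncoef[OF p] refl_qcoef[OF p] vec_eq_iff algebra_simps)
qed

lemma Lam01_products:
  assumes x: "x \<in> chart_dom" and v: "v \<in> Lam01 A \<Lambda> x"
  shows "mform v (\<sigma> x) = 0" "mform v (B x) = 0" "\<exists>a b. v = a *s \<sigma> x + b *s B x"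
proof -
  have "\<exists>a. v - a *s \<sigma> x \<in> vec.span {B x}"
    using v by (simp add: bundles(2)[OF x] vec.span_insert)
  then obtain a b where ab: "v = a *s \<sigma> x + b *s B x"
    by (auto simp: vec.span_singleton algebra_simps)
  then show "\<exists>a b. v = a *s \<sigma> x + b *s B x" by blast
  show "mform v (\<sigma> x) = 0" "mform v (B x) = 0"
    using null[of x] x frame_products[OF x] frame_products'[OF x] by (simp_all add: ab mform_linear)
qed

text \<open>An operator anticommuting with \<rho> moves S into its orthogonal complement, on which q
  vanishes.\<close>

lemma odd_orth:
  assumes x: "x \<in> chart_dom" and v: "v \<in> S x" and D: "\<And>y. refl x *v (D *v y) = - (D *v (refl x *v y))"
  shows "qcoef w x *v (D *v v) = 0"
proof -
  have "refl x *v v = v" using sphere_proj_S[OF x v] by (simp add: refl_apply vec_eq_iff)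
  then have "refl x *v (D *v v) = - (D *v v)" using D by simp
  then have "sphere_proj x *v (D *v v) = 0" by (simp add: refl_apply vec_eq_iff)
  then show ?thesis using qcoef_sphere[OF x, of w "D *v v"] by simp
qed

text \<open>The involution \<open>Q\<close> cancels in r*(1)^(-1) r*(0), leaving the inverse of
  \<open>V\<close>, and a form of type (0,1) is zero on the direction \<open>dz\<close>.\<close>

lemma at_dz_backlund_multiplier:
  assumes r0: "r_star (S p) \<alpha> (L p) (Fin 0) = Q" and QQ: "Q ** Q = mat 1"
    and r1: "r_star (S p) \<alpha> (L p) (Fin 1) = Q ** V" and V: "V ** V' = mat 1" and p: "p \<in> chart_dom"
  shows "at_dz (backlund_multiplier A \<Lambda> q \<alpha> L) c p *v y = V' *v (qcoef dz p *v (V *v y))"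
proof -
  define r where "r = r_star (S p) \<alpha> (L p) Infty"
  have Qi: "matrix_inv Q = Q" by (rule matrix_inv_eqI[OF QQ])
  have "Q ** V ** (V' ** Q) = Q ** (V ** V') ** Q" by (simp only: matrix_mul_assoc)
  then have e: "Q ** V ** (V' ** Q) = mat 1" by (simp add: V QQ)
  then have e': "V' ** Q ** (Q ** V) = mat 1" using matrix_left_right_inverse by blast
  have inv: "matrix_inv (Q ** V) = V' ** Q" "matrix_inv (V' ** Q) = Q ** V"
    by (rule matrix_inv_eqI[OF e], rule matrix_inv_eqI[OF e'])
  have QQv: "Q *v (Q *v x) = x" for x by (simp add: matrix_vector_mul_assoc QQ)
  note P = part_dz[of q c p "\<lambda>w. qcoef w p", OF q_eq[OF p] qcoef_linear]
  show ?thesis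
    unfolding at_dz_def backlund_multiplier_def Let_def Ad_def r0 r1 inv Qi r_def[symmetric]
    by (simp add: mat_apply vec_linear P QQv vec_eq_iff algebra_simps)
qed

lemma backlund_section:
  assumes bp: "backlund_parameters A \<Lambda> q \<alpha> L"
    and p: "p \<in> chart_dom" and s: "local_real_section A (backlund_transform A \<Lambda> \<alpha> L) p s"
    and k: "qcoef dz p *v Z p = k *s \<sigma> p"
  shows "at_dz (backlund_multiplier A \<Lambda> q \<alpha> L) c p *v pdz c s p = k *s s p"
proof -
  define z where "z = snd c p"
  have p': "p \<in> cdom c" using p by simp
  have \<alpha>: "\<alpha> \<noteq> 0" "cmod \<alpha> \<noteq> 1" using bp by (simp_all add: backlund_parameters_def)
  obtain U1 ls where U1: "open U1" "p \<in> U1" "smooth_map A U1 ls"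
    "\<And>x. x \<in> U1 \<Longrightarrow> ls x \<noteq> 0 \<and> mform (ls x) (ls x) = 0 \<and> L x = vec.span {ls x}"
    using bp unfolding backlund_parameters_def null_line_bundle_def by blast
  obtain U2 where U2: "open U2" "p \<in> U2" "smooth_map A U2 s"
    "\<And>x. x \<in> U2 \<Longrightarrow> s x \<in> backlund_transform A \<Lambda> \<alpha> L x"
    using s unfolding local_real_section_def by blast
  define V where "V = U \<inter> U1 \<inter> U2"
  have V: "open V" "p \<in> V" using U U1 U2 p by (auto simp: V_def)
  have ln: "smooth_near c p ls" by (rule smooth_map_near[OF U1(3) cA c U1(1,2) p'])
  have sn: "smooth_near c p s" by (rule smooth_map_near[OF U2(3) cA c U2(1,2) p'])
  define Q N C where "Q = qcoef dz p" and "N = Ncoef dz p" and "C = - Q - N"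
  define l where "l = in_chart c ls"
  define k0 where "k0 = (\<lambda>y. in_chart c refl y *v l y)"
  define l1 where "l1 = (\<lambda>y. vcnj (l y))"
  define k1 where "k1 = (\<lambda>y. in_chart c refl y *v l1 y)"
  define D1 where "D1 = (\<lambda>y. line_rot (l1 y) (k1 y))"
  define l2 where "l2 = (\<lambda>y. dressing (cnj \<alpha>) (D1 y) (1 / \<alpha>) *v l y)"
  define k2 where "k2 = (\<lambda>y. dressing (cnj \<alpha>) (D1 y) (- (1 / \<alpha>)) *v k0 y)"
  define D2 where "D2 = (\<lambda>y. line_rot (l2 y) (k2 y))"
  define F where "F = (\<lambda>y. dressing (1 / \<alpha>) (D2 y) 1 ** dressing (cnj \<alpha>) (D1 y) 1)"
  define F' where "F' = (\<lambda>y. dressing (cnj \<alpha>) (D1 y) (- 1) ** dressing (1 / \<alpha>) (D2 y) (- 1))"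
  \<comment> \<open>Established at all points near \<open>p\<close> and not only at
    \<open>p\<close>, because identities between the sections built from these factors are
    differentiated below.\<close>
  have pw: "null_pair (l1 y) (k1 y) \<and> null_pair (l2 y) (k2 y) \<and> refl x *v l2 y = k2 y \<and> refl x *v l1 y = k1 y
    \<and> F y ** F' y = mat 1 \<and>
    (\<exists>Q. Q ** Q = mat 1 \<and> r_star (S x) \<alpha> (L x) (Fin 0) = Q \<and> r_star (S x) \<alpha> (L x) (Fin 1) = Q ** F y)
    \<and> \<alpha>\<^sup>2 * (cnj \<alpha>)\<^sup>2 \<noteq> 1 \<and> \<alpha>\<^sup>2 \<noteq> 1"
    if x: "x \<in> V" "x \<in> cdom c" and y: "y = snd c x" for x y
  proof -
    have xd: "x \<in> chart_dom" using x by (simp add: V_def)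
    interpret reflection "S x" "refl x" by (rule reflection_at[OF xd])
    have ly: "l y = ls x" "in_chart c refl y = refl x" using x y by (simp_all add: l_def in_chart_apply[OF c])
    have ls: "ls x \<noteq> 0" "mform (ls x) (ls x) = 0" "L x = vec.span {ls x}" using U1(4) x by (auto simp: V_def)
    have "rhoL (S x) (L x) \<inter> orth (L x) = {0}"
      and cond: "rhoL (S x) (L_tilde (S x) \<alpha> (L x)) \<inter> orth (L_tilde (S x) \<alpha> (L x)) = {0}"
      using bp by (simp_all add: backlund_parameters_def Let_def)
    then interpret lp: null_pair "ls x" "refl x *v ls x"
      using null_pairI[OF ls(2,1)] ls(3) by simp
    have vr: "vcnj (refl x *v v) = refl x *v vcnj v" for v
    proof -
      have "vcnj (a - b) = vcnj a - vcnj b" for a b :: "'n cvec" by (simp add: vec_eq_iff)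
      then show ?thesis using xd by (simp add: refl_apply vcnj_smult vcnj_sphere_proj)
    qed
    have np1: "null_pair (vcnj (ls x)) (refl x *v vcnj (ls x))"
      using lp.ll lp.kk lp.lk by unfold_locales (simp_all add: mform_vcnj flip: vr)
    note rs = r_star_factors[OF \<alpha> ls(2,1) np1 cond[unfolded ls(3)]]
    have e: "l1 y = vcnj (ls x)" "k1 y = refl x *v vcnj (ls x)" "k0 y = refl x *v ls x"
      by (simp_all add: l1_def k1_def k0_def ly)
    interpret n1: null_pair "l1 y" "k1 y" using np1 by (simp add: e)
    have np2: "null_pair (l2 y) (k2 y)"
      using rs(1) by (simp only: l2_def k2_def D1_def e ly)
    interpret n2: null_pair "l2 y" "k2 y" by (rule np2)
    have a1: "(cnj \<alpha>)\<^sup>2 \<noteq> 1" "(1 / \<alpha>)\<^sup>2 \<noteq> 1"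
    proof -
      show "(cnj \<alpha>)\<^sup>2 \<noteq> 1" using rs(5) by (metis complex_cnj_cnj complex_cnj_one complex_cnj_power)
      show "(1 / \<alpha>)\<^sup>2 \<noteq> 1" using rs(5) \<alpha> by (simp add: power_divide)
    qed
    have i1: "dressing (cnj \<alpha>) (D1 y) 1 ** dressing (cnj \<alpha>) (D1 y) (- 1) = mat 1"
      using dressing_inverse[of "D1 y" 1 "cnj \<alpha>"] n1.rot3 a1 by (simp add: D1_def)
    have i2: "dressing (1 / \<alpha>) (D2 y) 1 ** dressing (1 / \<alpha>) (D2 y) (- 1) = mat 1"
      using dressing_inverse[of "D2 y" 1 "1 / \<alpha>"] n2.rot3 a1 by (simp add: D2_def)
    have FF: "F y ** F' y = mat 1"
    proof -
      have "F y ** F' y = dressing (1 / \<alpha>) (D2 y) 1 **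
          (dressing (cnj \<alpha>) (D1 y) 1 ** dressing (cnj \<alpha>) (D1 y) (- 1)) ** dressing (1 / \<alpha>) (D2 y) (- 1)"
        unfolding F_def F'_def by (simp only: matrix_mul_assoc)
      then show ?thesis by (simp add: i1 i2)
    qed
    show ?thesis
      using n1.null_pair_axioms np2 rs(2-5) FF
      by (simp add: ls(3) l2_def k2_def D1_def D2_def F_def e ly)
  qed
  have zz: "l z = ls p" "in_chart c refl z = refl p" "in_chart c s z = s p"
    using p' by (simp_all add: z_def l_def in_chart_apply[OF c])
  note pwp = pw[OF V(2) p' z_def]
  have sub: "\<exists>k. v = k *s ls p" if "v \<in> L p" for v
    using that U1(4)[OF U1(2)] by (auto simp: vec.span_singleton)
  have spec: "spectral_connection S q \<alpha> c X ls p \<in> L p" for X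
  proof -
    have "local_section A L p ls" unfolding local_section_def
      using U1 by (intro exI[of _ U1]) (auto simp: vec.span_base)
    then show ?thesis using bp hol p' unfolding backlund_parameters_def Let_def by blast
  qed
  have Lsub: "a *s v + b *s w \<in> L p" if "v \<in> L p" "w \<in> L p" for a b v w
    using that U1(4)[OF U1(2)] by (auto intro: vec.span_add vec.span_scale)
  have "(1/2) *s (a - \<i> *s b) = (1/2) *s a + (- (\<i>/2)) *s b" "(1/2) *s (a + \<i> *s b) = (1/2) *s a + (\<i>/2) *s b"
    for a b :: "'n cvec" by (simp_all add: vec_eq_iff algebra_simps)
  then have Lsub': "(1/2) *s (D 1 - \<i> *s D \<i>) \<in> L p" "(1/2) *s (D 1 + \<i> *s D \<i>) \<in> L p"
    if "D = (\<lambda>X. spectral_connection S q \<alpha> c X ls p)" for D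
    using Lsub[OF spec spec] that by (simp_all only:)
  obtain b where b: "pdw dz c ls p + (1 / \<alpha> - 1) *s (N *v ls p) + ((1 / \<alpha>)\<^sup>2 - 1) *s (Q *v ls p) = b *s ls p"
    using sub[OF Lsub'(1)[OF refl]] unfolding spectral_dz(1)[OF p ln] N_def Q_def by blast
  obtain b' where b': "pdw dzbar c ls p + (\<alpha> - 1) *s (Ncoef dzbar p *v ls p)
      + (\<alpha>\<^sup>2 - 1) *s (qcoef dzbar p *v ls p) = b' *s ls p"
    using sub[OF Lsub'(2)[OF refl]] unfolding spectral_dz(2)[OF p ln] by blast
  have pen: "pencil Q N C t *v x = (t - 1) *s (N *v x) + (t\<^sup>2 - 1) *s (Q *v x)" for t x
    by (simp add: pencil_apply C_def mat_apply vec_eq_iff algebra_simps)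
  have dl: "vdirder dz l (b *s l z - pencil Q N C (1 / \<alpha>) *v l z) z"
  proof -
    have "pdw dz c ls p = b *s l z - pencil Q N C (1 / \<alpha>) *v l z"
      unfolding zz pen b[symmetric] by (simp add: vec_eq_iff)
    then show ?thesis using pd_vdirder[OF c p' ln, of dz] by (simp add: l_def z_def)
  qed
  \<comment> \<open>The (0,1)-part of the parallelism of L, conjugated: \<open>Ncoef\<close> and
    \<open>qcoef\<close> change type, and \<alpha> becomes cnj \<alpha>.\<close>
  have dl1: "vdirder dz l1 (cnj b' *s l1 z - pencil Q N C (cnj \<alpha>) *v l1 z) z"
  proof -
    have "pdw dzbar c ls p = b' *s ls p - ((\<alpha> - 1) *s (Ncoef dzbar p *v ls p)
      + (\<alpha>\<^sup>2 - 1) *s (qcoef dzbar p *v ls p))"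
      unfolding b'[symmetric] by (simp add: vec_eq_iff)
    moreover have "vcnj (a - b) = vcnj a - vcnj b" for a b :: "'n cvec" by (simp add: vec_eq_iff)
    ultimately have "vcnj (pdw dzbar c ls p) = cnj b' *s l1 z - pencil Q N C (cnj \<alpha>) *v l1 z"
      unfolding pen unfolding l1_def zz N_def Q_def
      by (simp add: vcnj_add vcnj_smult vcnj_Ncoef[OF p] vcnj_qcoef[OF p])
    then show ?thesis
      using vdirder_vcnj[OF pd_vdirder[OF c p' ln, of dzbar]] by (simp add: l1_def l_def z_def)
  qed
  have dk: "vdirder dz k0 (b *s k0 z - pencil Q N C (- (1 / \<alpha>)) *v k0 z) z"
    using refl_parallel[OF p, of l b "1 / \<alpha>"] dl unfolding k0_def Q_def N_def C_def z_def by simp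
  have dk1: "vdirder dz k1 (cnj b' *s k1 z - pencil Q N C (- cnj \<alpha>) *v k1 z) z"
    using refl_parallel[OF p, of l1 "cnj b'" "cnj \<alpha>"] dl1 unfolding k1_def Q_def N_def C_def z_def by simp
  have dist: "(1 / \<alpha>)\<^sup>2 \<noteq> (cnj \<alpha>)\<^sup>2" "(cnj \<alpha>)\<^sup>2 \<noteq> 1" "(1 / \<alpha>)\<^sup>2 \<noteq> 1"
  proof -
    show "(1 / \<alpha>)\<^sup>2 \<noteq> (cnj \<alpha>)\<^sup>2" using pwp \<alpha> by (auto simp: power_divide field_simps)
    show "(cnj \<alpha>)\<^sup>2 \<noteq> 1" using pwp by (metis complex_cnj_cnj complex_cnj_one complex_cnj_power)
    show "(1 / \<alpha>)\<^sup>2 \<noteq> 1" using pwp \<alpha> by (simp add: power_divide)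
  qed
  obtain y0 where y0: "Q = wedge (\<sigma> p) (y0 *s B p)" using qcoef_dz_form[OF p] by (auto simp: Q_def)
  interpret reflection "S p" "refl p" by (rule reflection_at[OF p])
  have oddD: "refl p *v (D1 z *v v) = - (D1 z *v (refl p *v v))" "refl p *v (D2 z *v v) = - (D2 z *v (refl p *v v))" for v
    using line_rot_R[of "l1 z"] line_rot_R[of "l2 z"] pwp by (simp_all add: D1_def D2_def)
  \<comment> \<open>q_z and N_z vanish on \<sigma> and \<sigma>_zbar; the operators
    \<open>D1\<close> and \<open>D2\<close> are odd for \<rho>, so \<open>odd_orth\<close> handles
    the other two products.\<close>
  have kill: "Q *v a = 0 \<and> N *v a = 0 \<and> Q *v (D1 z *v a) = 0 \<and> Q *v (D2 z *v a) = 0"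
    if a: "a \<in> Lam01 A \<Lambda> p" for a
  proof -
    obtain x y where xy: "a = x *s \<sigma> p + y *s B p" using Lam01_products(3)[OF p a] by blast
    have "Q *v a = 0" "N *v a = 0"
      using qcoef_\<sigma>[OF p] closed_form_q[OF p] Ncoef_dz[OF p] by (simp_all add: xy Q_def N_def vec_linear)
    moreover have "a \<in> S p" unfolding xy bundles(3)[OF p]
      by (intro vec.span_add vec.span_scale vec.span_base) auto
    ultimately show ?thesis using odd_orth[OF p, of a] oddD by (simp add: Q_def)
  qed
  obtain W where W: "mdirder dz F (- (W ** F z)) z"
    "\<And>a b. a \<in> Lam01 A \<Lambda> p \<Longrightarrow> b \<in> Lam01 A \<Lambda> p \<Longrightarrow> mform (W *v a) b = 0"
    using two_step_dressing[OF _ _ C_def dl1 dk1 dl dk dist, of "Lam01 A \<Lambda> p"] skew_qcoef[OF p] skew_Ncoef[OF p]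
      pwp kill
    unfolding F_def D2_def l2_def k2_def D1_def Q_def N_def by blast
  define v where "v = (\<lambda>y. F y *v in_chart c s y)"
  define v' where "v' = - (W *v v z) + F z *v pdz c s p"
  have dv: "vdirder dz v v' z"
    using vdirder_mult_vec[OF W(1) pd_vdirder[OF c p' sn, of dz, folded z_def]]
    by (simp add: v_def v'_def mat_apply pdz_eq_pdw)
  \<comment> \<open>A point of the transform is r*(1)^(-1) r*(0) a with \<open>a\<close> in
    \<open>Lam01\<close>; the involution \<open>R\<close> cancels and \<open>F\<close> recovers
    \<open>a\<close>.\<close>
  have vF: "v (snd c x) \<in> Lam01 A \<Lambda> x" if x: "x \<in> V" "x \<in> cdom c" for x
  proof -
    define y where "y = snd c x"
    obtain R where R: "R ** R = mat 1" "r_star (S x) \<alpha> (L x) (Fin 0) = R" "r_star (S x) \<alpha> (L x) (Fin 1) = R ** F y"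
      using pw[OF x y_def] by blast
    have FF: "F y ** F' y = mat 1" using pw[OF x y_def] by blast
    have "R ** F y ** (F' y ** R) = R ** (F y ** F' y) ** R" by (simp only: matrix_mul_assoc)
    then have inv: "matrix_inv (R ** F y) = F' y ** R" by (intro matrix_inv_eqI) (simp add: FF R(1))
    have "s x \<in> backlund_transform A \<Lambda> \<alpha> L x" using U2(4) x by (simp add: V_def)
    then obtain a where a: "a \<in> Lam01 A \<Lambda> x" "s x = (F' y ** R ** R) *v a"
      unfolding backlund_transform_def Let_def R(2,3) inv by blast
    have "s x = F' y *v a" using a(2) R(1) by (metis matrix_mul_assoc matrix_mul_rid)
    then have "F y *v s x = a" using FF by (simp add: matrix_vector_mul_assoc)
    then show ?thesis using a(1) x by (simp add: v_def y_def in_chart_apply[OF c])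
  qed
  have prod0: "mform v' (u p) + mform (v z) (pdw dz c u p) = 0"
    if u: "smooth_near c p u" and 0: "\<And>x. x \<in> V \<Longrightarrow> x \<in> cdom c \<Longrightarrow> mform (v (snd c x)) (u x) = 0" for u
  proof -
    have "dirder dz (\<lambda>y. mform (v y) (in_chart c u y)) (mform v' (in_chart c u z) + mform (v z) (pdw dz c u p)) z"
      by (intro dirder_mform dv) (use pd_vdirder[OF c p' u] in \<open>simp add: z_def\<close>)
    moreover have "eventually (\<lambda>y. 0 = mform (v y) (in_chart c u y)) (nhds z)"
    proof (rule eventually_mono)
      show "eventually (\<lambda>y. y \<in> snd c ` (V \<inter> cdom c)) (nhds z)"
        using open_chart_image[OF c V(1)] V(2) p' by (intro eventually_nhds_in_open) (auto simp: z_def)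
    qed (use 0 in \<open>auto simp: in_chart_apply[OF c]\<close>)
    from dirder_cong[OF this dirder_const]
    have "dirder dz (\<lambda>y. mform (v y) (in_chart c u y)) 0 z" .
    ultimately show ?thesis using dirder_unique p' by (fastforce simp: z_def in_chart_apply[OF c])
  qed
  have vz: "v z \<in> Lam01 A \<Lambda> p" using vF[OF V(2) p'] by (simp add: z_def)
  obtain x y where xy: "v z = x *s \<sigma> p + y *s B p" using Lam01_products(3)[OF p vz] by blast
  have Vd: "a \<in> V \<Longrightarrow> a \<in> cdom c \<Longrightarrow> a \<in> chart_dom" for a by (simp add: V_def)
  \<comment> \<open>Differentiate (v, \<sigma>) = 0, and for \<open>v2\<close> also (v, B) = 0; the
    surviving products are (B, Z) = h and (\<sigma>, T) = - h.\<close>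
  have v1: "mform v' (\<sigma> p) = - (y * h p)"
    using prod0[OF near[OF p]] vF Lam01_products(1)[OF Vd] frame_products[OF p] frame_products'[OF p]
    by (simp add: xy mform_linear eq_neg_iff_add_eq_0 flip: pdz_eq_pdw)
  have v2: "mform v' (B p) = x * h p"
    using prod0[OF near'[OF p, of dzbar, folded pdzbar_eq_pdw]] vF Lam01_products(2)[OF Vd]
      frame_products[OF p] frame_products'[OF p]
    by (simp add: xy mform_linear flip: pdz_eq_pdw)
  have kk: "k = - (y0 * h p)"
  proof -
    have "Q *v Z p = (- (y0 * h p)) *s \<sigma> p"
      unfolding y0 wedge_apply using frame_products'[OF p] by (simp add: mform_linear)
    then have "k *s \<sigma> p = (- (y0 * h p)) *s \<sigma> p" unfolding Q_def k .
    then show ?thesis using sec[of p] p by (simp only: vector_mul_rcancel) simp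
  qed
  have mem: "\<sigma> p \<in> Lam01 A \<Lambda> p" "B p \<in> Lam01 A \<Lambda> p"
    by (auto simp: bundles(2)[OF p] vec.span_base)
  \<comment> \<open>In the wedge formula for \<open>Q\<close> the term with \<open>W\<close> has
    zero products with \<sigma> and \<open>B\<close>; \<open>v1\<close> and \<open>v2\<close>
    reassemble x \<sigma> + y B with the factor - y0 h, which is \<open>k\<close>.\<close>
  have "F z *v pdz c s p = v' + W *v v z" by (simp add: v'_def)
  then have "Q *v (F z *v pdz c s p) = k *s v z"
    unfolding y0 wedge_apply using W(2)[OF vz] mem
    by (simp add: mform_linear v1 v2 kk) (simp add: xy vec_eq_iff algebra_simps)
  moreover obtain R where R: "R ** R = mat 1" "r_star (S p) \<alpha> (L p) (Fin 0) = R" "r_star (S p) \<alpha> (L p) (Fin 1) = R ** F z"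
    using pwp by blast
  moreover have FF: "F z ** F' z = mat 1" using pwp by blast
  moreover have "F' z ** F z = mat 1" using FF matrix_left_right_inverse by blast
  ultimately show ?thesis
    using at_dz_backlund_multiplier[where p = p and L = L and \<alpha> = \<alpha>, OF R(2,1,3) FF p, of "pdz c s p"]
    by (simp add: vec_linear v_def zz Q_def matrix_vector_mul_assoc)
qed

end

theorem proposition6p36:
  fixes A :: "'m::{t2_space, second_countable_topology} chart set"
    and \<Lambda> L :: "'m \<Rightarrow> 'n::finite cvec set"
    and q :: "('m, 'n) form1"
    and \<alpha> :: complex
  assumes "3 \<le> CARD('n)"
    and "oriented_surface A"
    and "constrained_willmore A \<Lambda> q"
    and "backlund_parameters A \<Lambda> q \<alpha> L"
    and "immerses A (backlund_transform A \<Lambda> \<alpha> L)"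
  shows "\<forall>c. holomorphic_chart A \<Lambda> c \<longrightarrow> (\<forall>p\<in>cdom c. \<forall>X.
    quad_diff A (backlund_transform A \<Lambda> \<alpha> L) (backlund_multiplier A \<Lambda> q \<alpha> L) c p X =
    quad_diff A \<Lambda> q c p X)"
proof (intro allI impI ballI)
  fix c p X assume hol: "holomorphic_chart A \<Lambda> c" and p: "p \<in> cdom c"
  let ?\<Lambda> = "backlund_transform A \<Lambda> \<alpha> L" and ?q = "backlund_multiplier A \<Lambda> q \<alpha> L"
  have imm: "immerses A \<Lambda>" using assms(3) by (simp add: constrained_willmore_def real_surface_def)
  interpret surf A \<Lambda> by unfold_locales (use assms(2) imm in auto)
  interpret B: surf A ?\<Lambda> by unfold_locales (use assms(2,5) in auto)
  obtain \<sigma> U where U: "open U" "p \<in> U" "smooth_map A U \<sigma>"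
    "\<And>x. x \<in> U \<Longrightarrow> \<sigma> x \<in> \<Lambda> x \<and> \<sigma> x \<noteq> 0 \<and> real_vec (\<sigma> x)"
    using local_real_section_exists[of p] unfolding local_real_section_def by blast
  interpret F: cw_frame A \<Lambda> c U \<sigma> q
    by unfold_locales (use hol U assms(3) in auto)
  have pd: "p \<in> U \<inter> cdom c" using p U by simp
  obtain k where k: "F.qcoef dz p *v pdz c \<sigma> p = k *s \<sigma> p"
    using F.qcoef_deriv[OF pd, of dz dz] by (auto simp: pdz_eq_pdw)
  \<comment> \<open>The same scalar \<open>k\<close> serves both surfaces; the existence of a
    nonvanishing section makes the defining description unique.\<close>
  have qz: "qz A \<Lambda>' q' c p = - 2 * k"
    if ex: "local_real_section A \<Lambda>' p s0"
      and eq: "\<And>s. local_real_section A \<Lambda>' p s \<Longrightarrow> at_dz q' c p *v pdz c s p = k *s s p"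
    for \<Lambda>' :: "'m \<Rightarrow> 'n cvec set" and q' s0
    unfolding qz_def
  proof (rule the_equality)
    show "\<forall>s. local_real_section A \<Lambda>' p s \<longrightarrow> (- 2 * k) *s s p = (- 2) *s (at_dz q' c p *v pdz c s p)"
      using eq by simp
    fix k' assume "\<forall>s. local_real_section A \<Lambda>' p s \<longrightarrow> k' *s s p = (- 2) *s (at_dz q' c p *v pdz c s p)"
    then have "k' *s s0 p = (- 2 * k) *s s0 p" using ex eq by simp
    moreover have "s0 p \<noteq> 0" using ex unfolding local_real_section_def by blast
    ultimately show "k' = - 2 * k" by (simp only: vector_mul_rcancel simp_thms)
  qed
  have "qz A \<Lambda> q c p = - 2 * k"
  proof -
    obtain s0 where s0: "local_real_section A \<Lambda> p s0" using local_real_section_exists by blast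
    \<comment> \<open>Another section changes \<open>pdz c \<sigma> p\<close> by the factor f and by
      a multiple of \<sigma>, which q kills.\<close>
    have "at_dz q c p *v pdz c s p = k *s s p" if s: "local_real_section A \<Lambda> p s" for s
    proof -
      obtain f where f: "s p = f *s \<sigma> p" "\<And>w. \<exists>a. pdw w c s p = a *s \<sigma> p + f *s pdw w c \<sigma> p"
        using F.change_section[OF pd s] by metis
      obtain a where "pdz c s p = a *s \<sigma> p + f *s pdz c \<sigma> p" using f(2)[of dz] by (auto simp: pdz_eq_pdw)
      then show ?thesis using F.qcoef_\<sigma>[OF pd] k f(1) by (simp add: F.at_dz_q vec_linear mult.commute)
    qed
    from qz[OF s0 this] show ?thesis .
  qed
  moreover have "qz A ?\<Lambda> ?q c p = - 2 * k"
  proof -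
    obtain s0 where s0: "local_real_section A ?\<Lambda> p s0" using B.local_real_section_exists by blast
    from qz[OF s0 F.backlund_section[OF assms(4) pd _ k]] show ?thesis .
  qed
  ultimately show "quad_diff A ?\<Lambda> ?q c p X = quad_diff A \<Lambda> q c p X"
    by (simp add: quad_diff_def)
qed

end
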